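(* Let $M$ be a smooth Riemannian manifold. Let $\mathcal{F}\subset C^\infty(M,\mathbb{R}^k)$ be a linear subspace of dimension $n<\infty$ endowed with a scalar product and such that for all $p\in M$ the evaluation map $ev_p:\mathcal{F}\to\mathbb{R}^k$, $\varphi\mapsto\varphi(p)$, is surjective. Let $X$ be a random element of $\mathcal{F}$ whose law admits a continuous density $\rho_X:\mathcal{F}\to\mathbb{R}$ (with respect to Lebesgue measure) such that $\rho_X(0)>0$ and such that, as $\|\varphi\|\to\infty$, $\rho_X(\varphi)=O(\|\varphi\|^{-\alpha})$ for some $\alpha>n$. Then $X$ is z-KROK.
   Context: $M$ is a smooth manifold, possibly non-compact, with Riemannian metric $g$. $C^1(M,\mathbb{R}^k)$ carries the weak Whitney topology; a random field $X$ is a measurable map from a probability space into it; $[Y]$ denotes the law of a random element $Y$. For $f\in C^1(M,\mathbb{R}^k)$ let $J_pf:=\|d_pf^1\wedge\cdots\wedge d_pf^k\|$, with the norm on $\Lambda^kT^*_pM$ induced by $g$ through $\langle v_1\wedge\dots\wedge v_k,w_1\wedge\dots\wedge w_k\rangle=\det(\langle v_i,w_j\rangle)_{i,j}$. A regular conditional probability of $X$ given $X(p)$ is a map $(x,B)\mapsto\mu(p,x)(B)$ ($x\in\mathbb{R}^k$, $B\subset C^1(M,\mathbb{R}^k)$ Borel) such that each $\mu(p,x)$ is a Borel probability measure, $x\mapsto\mu(p,x)(B)$ is Borel, and $\mathbb{P}\{X\in B,\,X(p)\in V\}=\int_V\mu(p,x)(B)\,d[X(p)](x)$ for all Borel $B$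 and $V\subset\mathbb{R}^k$. $X$ is z-KROK if: (i) $X$ is a random element of $C^1(M,\mathbb{R}^k)$; (ii) almost surely $0$ is a regular value of $X$; (iii) for every $p\in M$ the law of $X(p)$ is absolutely continuous with density $\rho_{X(p)}:\mathbb{R}^k\to[0,+\infty)$; (iv) $(p,x)\mapsto\rho_{X(p)}(x)$ on $M\times\mathbb{R}^k$ is continuous at $(p,0)$ for all $p\in M$; (v) there are regular conditional probabilities $\mu(p,\cdot)$ of $X$ given $X(p)$, $p\in M$, such that the measures $J_p\cdot\mu(p,x)$, $B\mapsto\int_BJ_pf\,d\mu(p,x)(f)$, are finite and $(p,x)\mapsto J_p\cdot\mu(p,x)$, with values in the finite positive Borel measures on $C^1(M,\mathbb{R}^k)$ with the weak topology (tested on bounded continuous functions), is continuous at $(p,0)$ for all $p\in M$. *)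

theory Defs
  imports "HOL-Probability.Probability" "HOL-Library.Function_Algebras"
    "HOL-Library.Landau_Symbols"
begin

section \<open>Function spaces and scalar products\<close>

instantiation "fun" :: (type, real_vector) real_vector
begin

definition scaleR_fun :: "real \<Rightarrow> ('a \<Rightarrow> 'b) \<Rightarrow> 'a \<Rightarrow> 'b"
  where "scaleR_fun c f = (\<lambda>x. c *\<^sub>R f x)"

instance
  by standard (simp_all add: scaleR_fun_def fun_eq_iff algebra_simps)

end

definition scalar_product_on :: "'v::real_vector set \<Rightarrow> ('v \<Rightarrow> 'v \<Rightarrow> real) \<Rightarrow> bool" where
  "scalar_product_on V ip \<longleftrightarrow>
     (\<forall>u\<in>V. \<forall>v\<in>V. ip u v = ip v u) \<and>
     (\<forall>u\<in>V. \<forall>v\<in>V. \<forall>w\<in>V. ip (u + v) w = ip u w + ip v w) \<and>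
     (\<forall>c. \<forall>u\<in>V. \<forall>v\<in>V. ip (c *\<^sub>R u) v = c * ip u v) \<and>
     (\<forall>u\<in>V. u \<noteq> 0 \<longrightarrow> 0 < ip u u)"

definition ip_norm :: "('v::real_vector \<Rightarrow> 'v \<Rightarrow> real) \<Rightarrow> 'v \<Rightarrow> real" where
  "ip_norm ip v = sqrt (ip v v)"

text \<open>The locale \<open>Metric_space\<close> requires a symmetric nonnegative distance also off its carrier,
  hence the case distinction.\<close>

definition ip_topology :: "'v::real_vector set \<Rightarrow> ('v \<Rightarrow> 'v \<Rightarrow> real) \<Rightarrow> 'v topology" where
  "ip_topology V ip =
     Metric_space.mtopology V (\<lambda>u v. if u \<in> V \<and> v \<in> V then ip_norm ip (u - v) else 0)"

definition borel_of :: "'x topology \<Rightarrow> 'x measure" where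
  "borel_of T = sigma (topspace T) {U. openin T U}"

definition orthonormal_basis_on ::
    "'v::real_vector set \<Rightarrow> ('v \<Rightarrow> 'v \<Rightarrow> real) \<Rightarrow> nat \<Rightarrow> (nat \<Rightarrow> 'v) \<Rightarrow> bool" where
  "orthonormal_basis_on V ip n b \<longleftrightarrow>
     (\<forall>i<n. b i \<in> V) \<and> (\<forall>i<n. \<forall>j<n. ip (b i) (b j) = (if i = j then 1 else 0)) \<and>
     span (b ` {..<n}) = V"

text \<open>Lebesgue measure of a finite-dimensional Euclidean space: the image of Lebesgue measure on
  \<open>\<real>\<^sup>n\<close> under the linear isometry given by an orthonormal basis. By rotation invariance the
  basis chosen is irrelevant.\<close>

definition lborel_on :: "'v::real_vector set \<Rightarrow> ('v \<Rightarrow> 'v \<Rightarrow> real) \<Rightarrow> 'v measure" where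
  "lborel_on V ip =
     (let n = dim V; b = (SOME b. orthonormal_basis_on V ip n b)
      in distr (\<Pi>\<^sub>M i\<in>{..<n}. lborel) (borel_of (ip_topology V ip)) (\<lambda>c. \<Sum>i<n. c i *\<^sub>R b i))"


section \<open>Smooth manifolds\<close>

text \<open>\<open>r\<close> times continuously differentiable; meant for open \<open>S\<close> in a finite-dimensional space,
  where continuity of all iterated directional derivatives is the usual notion.\<close>

primrec Ck_on :: "nat \<Rightarrow> ('e::real_normed_vector \<Rightarrow> 'b::real_normed_vector) \<Rightarrow> 'e set \<Rightarrow> bool" where
  "Ck_on 0 f S \<longleftrightarrow> continuous_on S f"
| "Ck_on (Suc r) f S \<longleftrightarrow> (\<forall>x\<in>S. f differentiable (at x)) \<and>
     (\<forall>v. Ck_on r (\<lambda>x. frechet_derivative f (at x) v) S)"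

definition smooth_on :: "('e::real_normed_vector \<Rightarrow> 'b::real_normed_vector) \<Rightarrow> 'e set \<Rightarrow> bool" where
  "smooth_on f S \<longleftrightarrow> (\<forall>r. Ck_on r f S)"

text \<open>A chart is a domain together with a coordinate map, of which only the values on the domain
  matter. The underlying set of a manifold is the whole type \<open>'a\<close>.\<close>

type_synonym ('a, 'e) chart = "'a set \<times> ('a \<Rightarrow> 'e)"

definition local_rep :: "('a, 'e) chart \<Rightarrow> ('a \<Rightarrow> 'b) \<Rightarrow> 'e \<Rightarrow> 'b" where
  "local_rep c f = f \<circ> inv_into (fst c) (snd c)"

definition is_chart :: "('a::topological_space, 'e::euclidean_space) chart \<Rightarrow> bool" where
  "is_chart c \<longleftrightarrow> open (fst c) \<and> open (snd c ` fst c) \<and>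
     homeomorphism (fst c) (snd c ` fst c) (snd c) (inv_into (fst c) (snd c))"

definition smooth_atlas ::
    "('a::{t2_space, second_countable_topology}, 'e::euclidean_space) chart set \<Rightarrow> bool" where
  "smooth_atlas A \<longleftrightarrow>
     (\<forall>c\<in>A. is_chart c) \<and> (\<Union>c\<in>A. fst c) = UNIV \<and>
     (\<forall>c\<in>A. \<forall>d\<in>A. smooth_on (local_rep c (snd d)) (snd c ` (fst c \<inter> fst d)))"

definition Ck_maps ::
    "nat \<Rightarrow> ('a, 'e::euclidean_space) chart set \<Rightarrow> ('a \<Rightarrow> 'b::real_normed_vector) set" where
  "Ck_maps r A = {f. \<forall>c\<in>A. Ck_on r (local_rep c f) (snd c ` fst c)}"

definition smooth_maps ::
    "('a, 'e::euclidean_space) chart set \<Rightarrow> ('a \<Rightarrow> 'b::real_normed_vector) set" where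
  "smooth_maps A = {f. \<forall>c\<in>A. smooth_on (local_rep c f) (snd c ` fst c)}"

text \<open>The weak (compact-open) Whitney topology on \<open>C\<^sup>1\<close> maps.\<close>

definition whitney_nbhd ::
    "('a, 'e::euclidean_space) chart set \<Rightarrow> ('a \<Rightarrow> 'b::real_normed_vector) \<Rightarrow> ('a, 'e) chart \<Rightarrow>
     'a set \<Rightarrow> real \<Rightarrow> ('a \<Rightarrow> 'b) set" where
  "whitney_nbhd A f c K \<epsilon> = {h \<in> Ck_maps 1 A. \<forall>x\<in>snd c ` K.
     norm (local_rep c h x - local_rep c f x) < \<epsilon> \<and>
     onorm (\<lambda>v. frechet_derivative (local_rep c h) (at x) v
                - frechet_derivative (local_rep c f) (at x) v) < \<epsilon>}"

definition whitney_topology ::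
    "('a::topological_space, 'e::euclidean_space) chart set \<Rightarrow>
     ('a \<Rightarrow> 'b::real_normed_vector) topology" where
  "whitney_topology A = topology_generated_by
     {whitney_nbhd A f c K \<epsilon> | f c K \<epsilon>.
        f \<in> Ck_maps 1 A \<and> c \<in> A \<and> compact K \<and> K \<subseteq> fst c \<and> 0 < \<epsilon>}"


section \<open>Tangent spaces and Riemannian metrics\<close>

text \<open>Tangent vectors at \<open>p\<close> are the directional derivatives at \<open>p\<close>, as functionals on real-valued
  \<open>C\<^sup>1\<close> functions. They are cut off to \<open>0\<close> on other functions, so that the same tangent vector,
  represented in two charts, is the same functional.\<close>

definition coord_vector ::
    "('a, 'e::euclidean_space) chart set \<Rightarrow> ('a, 'e) chart \<Rightarrow> 'a \<Rightarrow> 'e \<Rightarrow> ('a \<Rightarrow> real) \<Rightarrow> real" where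
  "coord_vector A c p e =
     (\<lambda>f. if f \<in> Ck_maps 1 A then frechet_derivative (local_rep c f) (at (snd c p)) e else 0)"

definition tangent_space ::
    "('a, 'e::euclidean_space) chart set \<Rightarrow> 'a \<Rightarrow> (('a \<Rightarrow> real) \<Rightarrow> real) set" where
  "tangent_space A p = {coord_vector A c p e | c e. c \<in> A \<and> p \<in> fst c}"

text \<open>The differential of \<open>f\<close>, to be applied to tangent vectors; the base point is carried by
  the tangent vector.\<close>

definition differential :: "('a \<Rightarrow> real ^ 'k) \<Rightarrow> (('a \<Rightarrow> real) \<Rightarrow> real) \<Rightarrow> real ^ 'k" where
  "differential f v = (\<chi> i. v (\<lambda>q. f q $ i))"

definition regular_value ::
    "('a, 'e::euclidean_space) chart set \<Rightarrow> ('a \<Rightarrow> real ^ 'k) \<Rightarrow> real ^ 'k \<Rightarrow> bool" where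
  "regular_value A f y \<longleftrightarrow> (\<forall>p. f p = y \<longrightarrow> differential f ` tangent_space A p = UNIV)"

definition riemannian_metric ::
    "('a, 'e::euclidean_space) chart set \<Rightarrow>
     ('a \<Rightarrow> (('a \<Rightarrow> real) \<Rightarrow> real) \<Rightarrow> (('a \<Rightarrow> real) \<Rightarrow> real) \<Rightarrow> real) \<Rightarrow> bool" where
  "riemannian_metric A g \<longleftrightarrow>
     (\<forall>p. scalar_product_on (tangent_space A p) (g p)) \<and>
     (\<forall>c\<in>A. \<forall>u v. smooth_on
        (local_rep c (\<lambda>p. g p (coord_vector A c p u) (coord_vector A c p v))) (snd c ` fst c))"

text \<open>The scalar product on the dual of \<open>V\<close> (linear forms matter on \<open>V\<close> only), via the Riesz
  isomorphism.\<close>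

definition riesz :: "'v set \<Rightarrow> ('v \<Rightarrow> 'v \<Rightarrow> real) \<Rightarrow> ('v \<Rightarrow> real) \<Rightarrow> 'v" where
  "riesz V ip \<alpha> = (THE u. u \<in> V \<and> (\<forall>v\<in>V. ip u v = \<alpha> v))"

definition dual_ip :: "'v set \<Rightarrow> ('v \<Rightarrow> 'v \<Rightarrow> real) \<Rightarrow> ('v \<Rightarrow> real) \<Rightarrow> ('v \<Rightarrow> real) \<Rightarrow> real" where
  "dual_ip V ip \<alpha> \<beta> = ip (riesz V ip \<alpha>) (riesz V ip \<beta>)"

text \<open>The norm of the decomposable \<open>k\<close>-vector \<open>w\<^sub>1 \<and> \<dots> \<and> w\<^sub>k\<close>, for the scalar product
  \<open>\<langle>v\<^sub>1 \<and> \<dots> \<and> v\<^sub>k, w\<^sub>1 \<and> \<dots> \<and> w\<^sub>k\<rangle> = det (\<langle>v\<^sub>i, w\<^sub>j\<rangle>)\<close>.\<close>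

definition wedge_norm :: "('w \<Rightarrow> 'w \<Rightarrow> real) \<Rightarrow> ('k::finite \<Rightarrow> 'w) \<Rightarrow> real" where
  "wedge_norm ip w = sqrt (det (\<chi> i j. ip (w i) (w j)))"

definition jacobian ::
    "('a, 'e::euclidean_space) chart set \<Rightarrow>
     ('a \<Rightarrow> (('a \<Rightarrow> real) \<Rightarrow> real) \<Rightarrow> (('a \<Rightarrow> real) \<Rightarrow> real) \<Rightarrow> real) \<Rightarrow>
     'a \<Rightarrow> ('a \<Rightarrow> real ^ 'k) \<Rightarrow> real" where
  "jacobian A g p f =
     wedge_norm (dual_ip (tangent_space A p) (g p)) (\<lambda>i v. differential f v $ i)"


section \<open>Random fields\<close>

text \<open>The weak topology on finite positive Borel measures: the coarsest one for which
  integration of each bounded continuous function is continuous.\<close>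

definition finite_borel_measures :: "'x topology \<Rightarrow> 'x measure set" where
  "finite_borel_measures T = {N. finite_measure N \<and> sets N = sets (borel_of T)}"

definition weak_topology :: "'x topology \<Rightarrow> 'x measure topology" where
  "weak_topology T = topology_generated_by
     {{N \<in> finite_borel_measures T. (\<integral>x. h x \<partial>N) \<in> U} | h U.
        continuous_map T euclideanreal h \<and> bounded (h ` topspace T) \<and> open U}"

definition regular_conditional_prob ::
    "('a::topological_space, 'e::euclidean_space) chart set \<Rightarrow> 'w measure \<Rightarrow>
     ('w \<Rightarrow> 'a \<Rightarrow> real ^ 'k) \<Rightarrow> 'a \<Rightarrow> (real ^ 'k \<Rightarrow> ('a \<Rightarrow> real ^ 'k) measure) \<Rightarrow> bool" where
  "regular_conditional_prob A P X p \<mu> \<longleftrightarrow>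
     (\<forall>x. prob_space (\<mu> x) \<and> sets (\<mu> x) = sets (borel_of (whitney_topology A))) \<and>
     (\<forall>B \<in> sets (borel_of (whitney_topology A)).
        (\<lambda>x. measure (\<mu> x) B) \<in> borel_measurable borel \<and>
        (\<forall>V \<in> sets borel.
           emeasure P {\<omega> \<in> space P. X \<omega> \<in> B \<and> X \<omega> p \<in> V} =
           (\<integral>\<^sup>+x\<in>V. emeasure (\<mu> x) B \<partial>distr P borel (\<lambda>\<omega>. X \<omega> p))))"

definition z_KROK ::
    "('a::{t2_space, second_countable_topology}, 'e::euclidean_space) chart set \<Rightarrow>
     ('a \<Rightarrow> (('a \<Rightarrow> real) \<Rightarrow> real) \<Rightarrow> (('a \<Rightarrow> real) \<Rightarrow> real) \<Rightarrow> real) \<Rightarrow>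
     'w measure \<Rightarrow> ('w \<Rightarrow> 'a \<Rightarrow> real ^ 'k) \<Rightarrow> bool" where
  "z_KROK A g P X \<longleftrightarrow>
     X \<in> measurable P (borel_of (whitney_topology A)) \<and>
     (AE \<omega> in P. regular_value A (X \<omega>) 0) \<and>
     (\<exists>\<rho> :: 'a \<Rightarrow> real ^ 'k \<Rightarrow> real.
        (\<forall>p. (\<forall>x. 0 \<le> \<rho> p x) \<and> distributed P lborel (\<lambda>\<omega>. X \<omega> p) (\<lambda>x. ennreal (\<rho> p x))) \<and>
        (\<forall>p. isCont (\<lambda>(q, x). \<rho> q x) (p, 0))) \<and>
     (\<exists>\<mu> :: 'a \<Rightarrow> real ^ 'k \<Rightarrow> ('a \<Rightarrow> real ^ 'k) measure.
        (\<forall>p. regular_conditional_prob A P X p (\<mu> p)) \<and>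
        (\<forall>p x. finite_measure (density (\<mu> p x) (\<lambda>f. ennreal (jacobian A g p f)))) \<and>
        (\<forall>p. topcontinuous_at euclidean (weak_topology (whitney_topology A))
           (\<lambda>(q, x). density (\<mu> q x) (\<lambda>f. ennreal (jacobian A g q f))) (p, 0)))"

end

theory Submission
  imports Defs
begin

text \<open>
  In coordinates of an orthonormal basis \<open>b\<close>, \<open>X\<close> is a random linear combination of the \<open>b\<^sub>i\<close>. The law of
  \<open>X\<close> conditioned on \<open>X(p) = x\<close> is the normalised restriction of its density to an affine fibre of the
  evaluation at \<open>p\<close>; it depends continuously on \<open>(p, x)\<close> by dominated convergence, the decay exponent
  leaving exactly enough room for the factor \<open>J\<^sub>p\<close>, which grows like the power \<open>k\<close> of the norm.

  Regularity of the zeros reduces to Sard's theorem for real-valued functions: \<open>\<phi>\<close> has a degenerate zero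
  at \<open>p\<close> iff for some \<open>\<xi> \<noteq> 0\<close> the scalar function \<open>h\<^sub>\<phi>(p, \<xi>) = \<phi>(p) \<bullet> \<xi>\<close> has a critical zero at \<open>(p, \<xi>)\<close>.
  Where \<open>h\<^sub>\<psi> \<noteq> 0\<close> for a basis vector \<open>\<psi>\<close>, a critical zero of \<open>h\<^sub>\<phi> + t h\<^sub>\<psi>\<close> is a critical point of
  \<open>h\<^sub>\<phi> / h\<^sub>\<psi>\<close> with value \<open>- t\<close>, which excludes all but a null set of \<open>t\<close>; then Fubini applies.
\<close>

section \<open>Functions of class \<open>C\<^sup>r\<close>\<close>

text \<open>Continuity in \<open>z_KROK\<close> is required at the points \<open>(p, 0)\<close>
  only, and that is where the hypothesis \<open>0 < \<rho> 0\<close> acts: the fibre over 0 passes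
  through the zero function, so its mass is positive, stays positive nearby, and can be divided by.
  Elsewhere the mass may vanish and the conditional law takes a default value. The obstacle is that
  the fibres move with \<open>p\<close>, while dominated convergence needs one fixed domain and one
  integrable bound near \<open>p\<close>. The fibres are therefore never parametrised: every fibre
  integral is pulled back to the fixed coefficient space by a map that moves each point into the
  fibre, against a weight supported on a slab where k coordinates lie in [0, 1]. Such a slab has n -
  k free directions, as the fibre has. The same slab serves for all points near \<open>p\<close>,
  and as the integrals do not depend on the slab, choosing it arbitrarily at each point does no harm
  to continuity.\<close>

lemma frechet_derivative_cong_open:
  assumes "open S" "x \<in> S" "\<And>y. y \<in> S \<Longrightarrow> f y = g y" "f differentiable (at x)"
  shows "g differentiable (at x)" "frechet_derivative g (at x) = frechet_derivative f (at x)"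
proof -
  have "(f has_derivative frechet_derivative f (at x)) (at x)"
    using assms(4) frechet_derivative_works by blast
  then have *: "(g has_derivative frechet_derivative f (at x)) (at x)"
    using has_derivative_transform_within_open assms(1-3) by blast
  then show "g differentiable (at x)" by (auto simp: differentiable_def)
  show "frechet_derivative g (at x) = frechet_derivative f (at x)"
    using frechet_derivative_at[OF *] by simp
qed

lemma Ck_on_cong:
  assumes "open S" "\<And>x. x \<in> S \<Longrightarrow> f x = g x" "Ck_on r f S"
  shows "Ck_on r g S"
  using assms(2,3)
proof (induction r arbitrary: f g)
  case 0
  then show ?case using continuous_on_cong by force
next
  case (Suc r)
  have d: "f differentiable (at x)" if "x \<in> S" for x
    using Suc.prems that by simp
  have "Ck_on r (\<lambda>x. frechet_derivative g (at x) v) S" for v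
    by (rule Suc.IH[of "\<lambda>x. frechet_derivative f (at x) v"])
       (use Suc.prems frechet_derivative_cong_open[OF assms(1) _ _ d, of _ g] in auto)
  then show ?case
    using frechet_derivative_cong_open(1)[OF assms(1) _ _ d, of _ g] Suc.prems by auto
qed

text \<open>\<open>Ck_on\<close> speaks of \<open>frechet_derivative\<close>, a choice operator;
  this rule accepts any explicit derivative instead. Uniqueness makes the two agree on
  \<open>S\<close>, and openness lets smoothness pass from one to the other.\<close>

lemma Ck_on_SucI:
  assumes "open S" "\<And>x. x \<in> S \<Longrightarrow> (f has_derivative f' x) (at x)"
    "\<And>v. Ck_on r (\<lambda>x. f' x v) S"
  shows "Ck_on (Suc r) f S"
proof -
  have "Ck_on r (\<lambda>x. frechet_derivative f (at x) v) S" for v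
    by (rule Ck_on_cong[OF assms(1) _ assms(3)[of v]])
       (use frechet_derivative_at[OF assms(2)] in auto)
  then show ?thesis using assms(2) by (auto simp: differentiable_def)
qed

lemma Ck_on_SucD:
  assumes "Ck_on (Suc r) f S"
  shows "x \<in> S \<Longrightarrow> (f has_derivative frechet_derivative f (at x)) (at x)"
    "Ck_on r (\<lambda>x. frechet_derivative f (at x) v) S"
  using assms by (auto simp: frechet_derivative_works[symmetric])

lemma Ck_on_Suc_imp: "Ck_on (Suc r) f S \<Longrightarrow> Ck_on r f S"
proof (induction r arbitrary: f)
  case 0
  then show ?case
    by (auto intro!: differentiable_imp_continuous_on
        simp: differentiable_on_def differentiable_at_withinI)
next
  case (Suc r)
  have "f differentiable (at x)" if "x \<in> S" for x
    using Suc.prems that by simp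
  moreover have "Ck_on r (\<lambda>x. frechet_derivative f (at x) v) S" for v
    using Suc.IH Ck_on_SucD(2)[OF Suc.prems] by blast
  ultimately show ?case by simp
qed

lemma Ck_on_subset: "Ck_on r f S \<Longrightarrow> T \<subseteq> S \<Longrightarrow> Ck_on r f T"
proof (induction r arbitrary: f)
  case 0
  then show ?case using continuous_on_subset by auto
qed auto

lemma Ck_on_imp_continuous_on: "Ck_on r f S \<Longrightarrow> continuous_on S f"
  by (induction r) (auto dest: Ck_on_Suc_imp simp del: Ck_on.simps(2))

lemma Ck_on_const [simp]: "Ck_on r (\<lambda>x. c) S"
proof (induction r arbitrary: c)
  case (Suc r)
  have "frechet_derivative (\<lambda>x::'a. c) (at x) = (\<lambda>v. 0)" for x
    by (metis frechet_derivative_at has_derivative_const)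
  then show ?case using Suc by auto
qed auto

lemma Ck_on_bounded_linear:
  assumes "open S" "bounded_linear T" "Ck_on r f S"
  shows "Ck_on r (\<lambda>x. T (f x)) S"
  using assms(3)
proof (induction r arbitrary: f)
  case 0
  then show ?case using assms(2) bounded_linear.continuous_on by auto
next
  case (Suc r)
  show ?case
    by (rule Ck_on_SucI[OF assms(1) bounded_linear.has_derivative[OF assms(2)]])
       (use Suc Ck_on_SucD[OF Suc.prems] in blast)+
qed

lemma Ck_on_linear:
  assumes "open S" "bounded_linear T"
  shows "Ck_on r T S"
proof (cases r)
  case 0
  then show ?thesis using assms bounded_linear.continuous_on[OF assms(2) continuous_on_id] by simp
next
  case (Suc s)
  have "Ck_on (Suc s) T S"
    by (rule Ck_on_SucI[OF assms(1) bounded_linear_imp_has_derivative[OF assms(2)]]) auto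
  then show ?thesis using Suc by simp
qed

lemma Ck_on_add:
  assumes "open S" "Ck_on r f S" "Ck_on r g S"
  shows "Ck_on r (\<lambda>x. f x + g x) S"
  using assms(2,3)
proof (induction r arbitrary: f g)
  case (Suc r)
  show ?case
    by (rule Ck_on_SucI[OF assms(1) has_derivative_add])
       (use Suc Ck_on_SucD[OF Suc.prems(1)] Ck_on_SucD[OF Suc.prems(2)] in blast)+
qed (auto intro: continuous_on_add)

lemma Ck_on_scaleR:
  fixes f :: "'a::real_normed_vector \<Rightarrow> real"
  assumes "open S" "Ck_on r f S" "Ck_on r g S"
  shows "Ck_on r (\<lambda>x. f x *\<^sub>R g x) S"
  using assms(2,3)
proof (induction r arbitrary: f g)
  case (Suc r)
  note D = Ck_on_SucD[OF Suc.prems(1)] Ck_on_SucD[OF Suc.prems(2)]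
  show ?case
    by (rule Ck_on_SucI[OF assms(1) has_derivative_scaleR])
      (use D in blast, use D in blast,
       intro Ck_on_add[OF assms(1)] Suc.IH D Ck_on_Suc_imp[OF Suc.prems(1)] Ck_on_Suc_imp[OF Suc.prems(2)])
qed (auto intro: continuous_on_scaleR)

lemma Ck_on_mult:
  fixes f :: "'a::real_normed_vector \<Rightarrow> real"
  assumes "open S" "Ck_on r f S" "Ck_on r g S"
  shows "Ck_on r (\<lambda>x. f x * g x) S"
  using Ck_on_scaleR[OF assms] by simp

lemma Ck_on_minus:
  assumes "open S" "Ck_on r f S"
  shows "Ck_on r (\<lambda>x. - f x) S"
  using Ck_on_bounded_linear[OF assms(1) bounded_linear_minus[OF bounded_linear_ident] assms(2)] .

lemma Ck_on_diff:
  assumes "open S" "Ck_on r f S" "Ck_on r g S"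
  shows "Ck_on r (\<lambda>x. f x - g x) S"
  using Ck_on_add[OF assms(1,2) Ck_on_minus[OF assms(1,3)]] by simp

lemma Ck_on_sum:
  assumes "open S" "\<And>i. i \<in> I \<Longrightarrow> Ck_on r (f i) S"
  shows "Ck_on r (\<lambda>x. \<Sum>i\<in>I. f i x) S"
  using assms(2) by (induction I rule: infinite_finite_induct) (auto intro: Ck_on_add[OF assms(1)])

text \<open>By the chain rule the direction fed to the derivative of \<open>f\<close> is itself a
  function of \<open>x\<close>, whereas \<open>Ck_on\<close> differentiates along fixed directions.
  Expanding in the basis turns the derivative into a sum of products in which every direction is
  fixed, and to these the induction hypothesis applies.\<close>

lemma Ck_on_compose:
  fixes g :: "'a::euclidean_space \<Rightarrow> 'b::euclidean_space"
  assumes "open S" "open T" "Ck_on r g S" "g ` S \<subseteq> T" "Ck_on r f T"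
  shows "Ck_on r (\<lambda>x. f (g x)) S"
  using assms(3,5)
proof (induction r arbitrary: f)
  case 0
  then show ?case using assms(4) by (auto intro: continuous_on_compose2)
next
  case (Suc r)
  note D = Ck_on_SucD[OF Suc.prems(1)] Ck_on_SucD[OF Suc.prems(2)]
  define h where "h = (\<lambda>x v. \<Sum>b\<in>Basis. (frechet_derivative g (at x) v \<bullet> b) *\<^sub>R
    frechet_derivative f (at (g x)) b)"
  have 1: "((\<lambda>x. f (g x)) has_derivative h x) (at x)" if "x \<in> S" for x
  proof -
    have gx: "g x \<in> T" using that assms(4) by auto
    have "((\<lambda>x. f (g x)) has_derivative
        (\<lambda>v. frechet_derivative f (at (g x)) (frechet_derivative g (at x) v))) (at x)"
      using diff_chain_at[OF D(1)[OF that] D(3)[OF gx]] by (simp add: o_def)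
    moreover have "h x = (\<lambda>v. frechet_derivative f (at (g x)) (frechet_derivative g (at x) v))"
    proof -
    have *: "frechet_derivative f (at (g x)) w =
        (\<Sum>b\<in>Basis. (w \<bullet> b) *\<^sub>R frechet_derivative f (at (g x)) b)" for w
    proof -
      have l: "linear (frechet_derivative f (at (g x)))"
        using D(3)[OF gx] has_derivative_linear by blast
      have "frechet_derivative f (at (g x)) w =
        frechet_derivative f (at (g x)) (\<Sum>b\<in>Basis. (w \<bullet> b) *\<^sub>R b)"
        by (simp add: euclidean_representation)
      then show ?thesis by (simp add: linear_sum[OF l] linear_cmul[OF l])
    qed
    show ?thesis unfolding h_def by (rule ext) (rule *[symmetric])
    qed
    ultimately show ?thesis by simp
  qed
  have 2: "Ck_on r (\<lambda>x. h x v) S" for v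
    unfolding h_def
    by (intro Ck_on_sum[OF assms(1)] Ck_on_scaleR[OF assms(1)] Suc.IH
        Ck_on_bounded_linear[OF assms(1) bounded_linear_inner_left] D
        Ck_on_Suc_imp[OF Suc.prems(1)])
  show ?case by (rule Ck_on_SucI[OF assms(1) 1 2])
qed

text \<open>The derivative is a polynomial in the inverse itself, so each order of differentiability
  yields the next.\<close>

lemma Ck_on_inverse_real: "Ck_on r (inverse :: real \<Rightarrow> real) (- {0})"
proof (induction r)
  case 0
  then show ?case by (auto intro!: continuous_intros)
next
  case (Suc r)
  have o: "open (- {0::real})" by auto
  show ?case
  proof (rule Ck_on_SucI[OF o])
    show "(inverse has_derivative (\<lambda>v. - (inverse x * v * inverse x))) (at x)"
      if "x \<in> - {0}" for x :: real
      using that by (intro has_derivative_inverse') auto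
    show "Ck_on r (\<lambda>x. - (inverse x * v * inverse x)) (- {0})" for v :: real
      by (intro Ck_on_minus[OF o] Ck_on_mult[OF o] Suc Ck_on_const)
  qed
qed

lemma Ck_on_divide:
  fixes f :: "'a::euclidean_space \<Rightarrow> real"
  assumes "open S" "Ck_on r f S" "Ck_on r g S" "\<And>x. x \<in> S \<Longrightarrow> g x \<noteq> 0"
  shows "Ck_on r (\<lambda>x. f x / g x) S"
proof -
  have "Ck_on r (\<lambda>x. inverse (g x)) S"
    by (rule Ck_on_compose[OF assms(1) _ assms(3) _ Ck_on_inverse_real]) (use assms(4) in auto)
  from Ck_on_mult[OF assms(1,2) this] show ?thesis by (simp add: divide_inverse)
qed

lemma smooth_on_compose:
  fixes g :: "'a::euclidean_space \<Rightarrow> 'b::euclidean_space"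
  assumes "open S" "open T" "smooth_on g S" "g ` S \<subseteq> T" "smooth_on f T"
  shows "smooth_on (\<lambda>x. f (g x)) S"
  using assms Ck_on_compose unfolding smooth_on_def by blast

lemma smooth_on_has_derivative:
  assumes "smooth_on f S" "x \<in> S"
  shows "(f has_derivative frechet_derivative f (at x)) (at x)"
  using assms Ck_on_SucD(1)[of 0 f S x] unfolding smooth_on_def by blast

lemma smooth_on_derivative:
  assumes "smooth_on f S"
  shows "smooth_on (\<lambda>x. frechet_derivative f (at x) v) S"
  using assms Ck_on_SucD(2) unfolding smooth_on_def by blast

lemma smooth_on_imp_continuous_on: "smooth_on f S \<Longrightarrow> continuous_on S f"
  unfolding smooth_on_def using Ck_on_imp_continuous_on by blast

section \<open>Sard's theorem for real-valued functions\<close>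

lemma negligible_image_locally:
  fixes f :: "'a::euclidean_space \<Rightarrow> 'b::euclidean_space"
  assumes "\<And>x. x \<in> S \<Longrightarrow> \<exists>N. open N \<and> x \<in> N \<and> negligible (f ` (S \<inter> N))"
  shows "negligible (f ` S)"
proof -
  let ?F = "{N. open N \<and> negligible (f ` (S \<inter> N))}"
  obtain F' where F': "F' \<subseteq> ?F" "countable F'" "\<Union>F' = \<Union>?F"
    using Lindelof[of ?F] by auto
  have "S \<subseteq> \<Union>F'"
    using assms F'(3) by blast
  then have "f ` S \<subseteq> (\<Union>N\<in>F'. f ` (S \<inter> N))" by blast
  moreover have "negligible (\<Union>N\<in>F'. f ` (S \<inter> N))"
    by (intro negligible_countable_Union) (use F' in auto)
  ultimately show ?thesis using negligible_subset by blast
qed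

text \<open>With cells of side 1/l, a bounded set in dimension D meets at most a multiple of l^D of
  them, and each has an image of length of order l^-(D+1). The total is of order 1/l and tends to
  0.\<close>

lemma negligible_image_high_order:
  fixes f :: "'a::euclidean_space \<Rightarrow> real"
  assumes S: "bounded S" and M: "0 \<le> M"
    and f: "\<And>x y. x \<in> S \<Longrightarrow> y \<in> S \<Longrightarrow> \<bar>f x - f y\<bar> \<le> M * norm (x - y) ^ (DIM('a) + 1)"
  shows "negligible (f ` S)"
  unfolding negligible_outer_le
proof (intro allI impI)
  fix e :: real assume e: "0 < e"
  define D where "D = DIM('a)"
  obtain R0 where R0: "\<And>x. x \<in> S \<Longrightarrow> norm x \<le> R0"
    using S bounded_iff by blast
  obtain R :: nat where R: "R0 \<le> real R" using real_arch_simple by blast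
  define Q where "Q = 2 * real R + 1"
  \<comment> \<open>\<open>C / real l\<close> will bound the total length of the covering intervals.
    \<open>Q\<close> absorbs the cell count \<open>(2 * l * R + 1) ^ D\<close> into
    \<open>(l * Q) ^ D\<close>, and \<open>real D ^ (D + 1)\<close> comes from estimating the
    diameter of a cell by the l1 norm.\<close>
  define C where "C = 2 * M * Q ^ D * real D ^ (D + 1)"
  obtain l0 :: nat where l0: "C / e \<le> real l0" using real_arch_simple by blast
  define l where "l = Suc l0"
  have l: "C / real l \<le> e" "0 < real l"
    using l0 e by (auto simp: l_def field_simps)
  define key where "key x = (\<lambda>b\<in>Basis. \<lfloor>real l * (x \<bullet> b)\<rfloor>)" for x :: 'a
  define I where "I = PiE (Basis :: 'a set) (\<lambda>_. {- int (l * R) .. int (l * R)})"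
  define \<delta> where "\<delta> = M * (real D / real l) ^ (D + 1)"
  have \<delta>: "0 \<le> \<delta>" using M by (auto simp: \<delta>_def)
  \<comment> \<open>One interval per cell that meets \<open>S\<close>, centred at the value of an
    arbitrary point of \<open>S\<close> in it; the other cells contribute the empty set.\<close>
  define T where "T \<kappa> = (if \<exists>x\<in>S. key x = \<kappa> then cball (f (SOME x. x \<in> S \<and> key x = \<kappa>)) \<delta> else {})" for \<kappa>
  have finI: "finite I" unfolding I_def by (intro finite_PiE) auto
  have cardI: "real (card I) \<le> (real l * Q) ^ D"
  proof -
    have "real (card I) = (2 * real l * real R + 1) ^ D"
      unfolding I_def D_def by (simp add: card_PiE nat_add_distrib nat_mult_distrib algebra_simps)
    also have "\<dots> \<le> (real l * Q) ^ D"
      by (intro power_mono) (auto simp: l_def Q_def algebra_simps)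
    finally show ?thesis .
  qed
  have keyI: "key x \<in> I" if "x \<in> S" for x
    unfolding I_def key_def
  proof (intro PiE_I)
    fix b :: 'a assume b: "b \<in> Basis"
    have "\<bar>x \<bullet> b\<bar> \<le> real R" using Basis_le_norm[of b x] R0[OF that] R b by auto
    then have "\<bar>real l * (x \<bullet> b)\<bar> \<le> real l * real R"
      by (simp add: abs_mult mult_left_mono)
    then have "- (real l * real R) \<le> real l * (x \<bullet> b)" "real l * (x \<bullet> b) \<le> real l * real R"
      by linarith+
    then have "- int (l * R) \<le> \<lfloor>real l * (x \<bullet> b)\<rfloor>" "\<lfloor>real l * (x \<bullet> b)\<rfloor> \<le> int (l * R)"
      by (auto simp: le_floor_iff floor_le_iff)
    with b show "(\<lambda>b\<in>Basis. \<lfloor>real l * (x \<bullet> b)\<rfloor>) b \<in> {- int (l * R)..int (l * R)}" by simp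
  qed auto
  have close: "norm (x - y) \<le> real D / real l" if "key x = key y" for x y
  proof -
    have "\<bar>(x - y) \<bullet> b\<bar> \<le> 1 / real l" if b: "b \<in> Basis" for b
    proof -
      have "\<lfloor>real l * (x \<bullet> b)\<rfloor> = \<lfloor>real l * (y \<bullet> b)\<rfloor>"
        using fun_cong[OF \<open>key x = key y\<close>, of b] b by (simp add: key_def)
      then have "\<bar>real l * (x \<bullet> b) - real l * (y \<bullet> b)\<bar> \<le> 1" by linarith
      moreover have "real l * (x \<bullet> b) - real l * (y \<bullet> b) = real l * ((x - y) \<bullet> b)"
        by (simp add: inner_diff_left algebra_simps)
      ultimately show ?thesis using l(2) by (simp add: abs_mult field_simps)
    qed
    then have "(\<Sum>b\<in>Basis. \<bar>(x - y) \<bullet> b\<bar>) \<le> (\<Sum>b\<in>(Basis::'a set). 1 / real l)"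
      by (intro sum_mono) auto
    then show ?thesis using norm_le_l1[of "x - y"] by (simp add: D_def)
  qed
  show "\<exists>T. f ` S \<subseteq> T \<and> T \<in> lmeasurable \<and> measure lebesgue T \<le> e"
  proof (intro exI conjI)
    show "f ` S \<subseteq> (\<Union>\<kappa>\<in>I. T \<kappa>)"
    proof
      fix t assume "t \<in> f ` S"
      then obtain x where x: "x \<in> S" "t = f x" by blast
      define y where "y = (SOME y. y \<in> S \<and> key y = key x)"
      have y: "y \<in> S" "key y = key x"
        using someI_ex[of "\<lambda>y. y \<in> S \<and> key y = key x"] x unfolding y_def by auto
      have "\<bar>f y - f x\<bar> \<le> M * norm (y - x) ^ (D + 1)" using f y x by (simp add: D_def)
      also have "\<dots> \<le> \<delta>" unfolding \<delta>_def
        by (intro mult_left_mono power_mono close y M) auto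
      finally have "t \<in> T (key x)" using x y unfolding T_def y_def[symmetric]
        by (auto simp: dist_real_def)
      then show "t \<in> (\<Union>\<kappa>\<in>I. T \<kappa>)" using keyI x by blast
    qed
    have Tm: "T \<kappa> \<in> lmeasurable" for \<kappa> by (simp add: T_def)
    then show "(\<Union>\<kappa>\<in>I. T \<kappa>) \<in> lmeasurable"
      by (intro fmeasurable.finite_UN finI) auto
    have "measure lebesgue (\<Union>\<kappa>\<in>I. T \<kappa>) \<le> (\<Sum>\<kappa>\<in>I. measure lebesgue (T \<kappa>))"
      by (intro measure_UNION_le finI fmeasurableD Tm)
    also have "\<dots> \<le> (\<Sum>\<kappa>\<in>I. 2 * \<delta>)"
      by (intro sum_mono) (use \<delta> in \<open>auto simp: T_def cball_eq_atLeastAtMost\<close>)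
    also have "\<dots> = real (card I) * (2 * \<delta>)" by simp
    also have "\<dots> \<le> (real l * Q) ^ D * (2 * \<delta>)"
      by (intro mult_right_mono cardI) (use \<delta> in auto)
    also have "\<dots> = C / real l"
      using l(2) by (simp add: \<delta>_def C_def power_divide power_mult_distrib field_simps)
    also have "\<dots> \<le> e" by (rule l)
    finally show "measure lebesgue (\<Union>\<kappa>\<in>I. T \<kappa>) \<le> e" .
  qed
qed

section \<open>Growth bounds at points where iterated derivatives vanish\<close>

primrec iter_deriv :: "('a::real_normed_vector \<Rightarrow> real) \<Rightarrow> 'a list \<Rightarrow> 'a \<Rightarrow> real" where
  "iter_deriv f [] = f"
| "iter_deriv f (b # bs) = (\<lambda>x. frechet_derivative (iter_deriv f bs) (at x) b)"

text \<open>The head of the list is the derivative taken last. Splitting off the final entry exposes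
  the derivative taken first, which is how the induction in \<open>flat_point_bound\<close> passes
  from \<open>f\<close> to its partial derivatives.\<close>

lemma iter_deriv_snoc:
  "iter_deriv f (bs @ [b]) = iter_deriv (\<lambda>x. frechet_derivative f (at x) b) bs"
  by (induction bs) auto

lemma smooth_on_iter_deriv: "smooth_on f U \<Longrightarrow> smooth_on (iter_deriv f bs) U"
  by (induction bs) (auto intro: smooth_on_derivative)

lemma mvt_directional:
  fixes f :: "'a::euclidean_space \<Rightarrow> real"
  assumes f: "\<And>z. z \<in> closed_segment x y \<Longrightarrow> (f has_derivative frechet_derivative f (at z)) (at z)"
    and B: "B \<subseteq> Basis" and V: "\<And>b. b \<in> Basis - B \<Longrightarrow> (y - x) \<bullet> b = 0"
  shows "\<exists>z\<in>closed_segment x y.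
     f y - f x = (\<Sum>b\<in>B. ((y - x) \<bullet> b) * frechet_derivative f (at z) b)"
proof -
  let ?p = "\<lambda>t::real. x + t *\<^sub>R (y - x)"
  have seg: "?p t \<in> closed_segment x y" if "0 \<le> t" "t \<le> 1" for t
    using that by (auto simp: in_segment algebra_simps intro!: exI[of _ t])
  have der: "((\<lambda>t. f (?p t)) has_real_derivative frechet_derivative f (at (?p t)) (y - x)) (at t)"
    if "0 \<le> t" "t \<le> 1" for t
  proof -
    have "(?p has_derivative (\<lambda>s. s *\<^sub>R (y - x))) (at t)"
      by (auto intro!: derivative_eq_intros)
    from diff_chain_at[OF this f[OF seg[OF that]]]
    have "((\<lambda>t. f (?p t)) has_derivative (\<lambda>s. frechet_derivative f (at (?p t)) (s *\<^sub>R (y - x)))) (at t)"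
      by (simp add: o_def)
    moreover have "linear (frechet_derivative f (at (?p t)))"
      using f[OF seg[OF that]] has_derivative_linear by blast
    ultimately show ?thesis
      by (simp add: has_field_derivative_def linear_cmul mult_commute_abs)
  qed
  obtain t where t: "0 < t" "t < 1" "f (?p 1) - f (?p 0) = (1 - 0) * frechet_derivative f (at (?p t)) (y - x)"
    using MVT2[of 0 1 "\<lambda>t. f (?p t)" "\<lambda>t. frechet_derivative f (at (?p t)) (y - x)"] der by auto
  have z: "?p t \<in> closed_segment x y" using seg t by auto
  have lin: "linear (frechet_derivative f (at (?p t)))"
    using f[OF z] has_derivative_linear by blast
  have "y - x = (\<Sum>b\<in>Basis. ((y - x) \<bullet> b) *\<^sub>R b)" by (simp add: euclidean_representation)
  also have "\<dots> = (\<Sum>b\<in>B. ((y - x) \<bullet> b) *\<^sub>R b)"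
    by (rule sum.mono_neutral_right) (use B V in auto)
  finally have "frechet_derivative f (at (?p t)) (y - x) =
      frechet_derivative f (at (?p t)) (\<Sum>b\<in>B. ((y - x) \<bullet> b) *\<^sub>R b)" by simp
  also have "\<dots> = (\<Sum>b\<in>B. ((y - x) \<bullet> b) * frechet_derivative f (at (?p t)) b)"
    by (simp add: linear_sum[OF lin] linear_cmul[OF lin])
  finally show ?thesis using t z by (intro bexI[of _ "?p t"]) auto
qed

text \<open>The mean value theorem expresses the increment from \<open>x\<close> to \<open>y\<close>
  by first partial derivatives along \<open>B\<close>, and by the induction hypothesis these already
  vanish to one order less, so each level gains one power. The constant is chosen before
  \<open>x\<close>, which makes the bound uniform over all flat points of \<open>K\<close>.\<close>

lemma flat_point_bound:
  fixes f :: "'a::euclidean_space \<Rightarrow> real"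
  assumes "convex K" "compact K" "K \<subseteq> U" "B \<subseteq> Basis" "smooth_on f U"
  shows "\<exists>M\<ge>0. \<forall>x\<in>K. (\<forall>b\<in>Basis - B. x \<bullet> b = 0) \<and>
      (\<forall>bs. set bs \<subseteq> B \<and> bs \<noteq> [] \<and> length bs \<le> j \<longrightarrow> iter_deriv f bs x = 0) \<longrightarrow>
      (\<forall>y\<in>K. (\<forall>b\<in>Basis - B. y \<bullet> b = 0) \<longrightarrow> \<bar>f y - f x\<bar> \<le> M * norm (y - x) ^ (j + 1))"
  using assms(5)
proof (induction j arbitrary: f)
  case 0
  have "\<exists>m\<ge>0. \<forall>z\<in>K. \<bar>frechet_derivative f (at z) b\<bar> \<le> m" for b
  proof -
    have "continuous_on K (\<lambda>z. frechet_derivative f (at z) b)"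
      using smooth_on_imp_continuous_on[OF smooth_on_derivative[OF 0]] assms(3) continuous_on_subset by blast
    from compact_imp_bounded[OF compact_continuous_image[OF this assms(2)]]
    obtain m where "\<forall>z\<in>K. \<bar>frechet_derivative f (at z) b\<bar> \<le> m"
      by (auto simp: bounded_iff)
    then show ?thesis by (intro exI[of _ "max m 0"]) auto
  qed
  then obtain m where m: "\<And>b. 0 \<le> m b" "\<And>b z. z \<in> K \<Longrightarrow> \<bar>frechet_derivative f (at z) b\<bar> \<le> m b"
    by metis
  have "\<bar>f y - f x\<bar> \<le> (\<Sum>b\<in>B. m b) * norm (y - x)"
    if xy: "x \<in> K" "y \<in> K" "\<forall>b\<in>Basis - B. x \<bullet> b = 0" "\<forall>b\<in>Basis - B. y \<bullet> b = 0" for x y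
  proof -
    have seg: "closed_segment x y \<subseteq> K" using xy assms(1) by (simp add: closed_segment_subset)
    obtain z where z: "z \<in> closed_segment x y"
      "f y - f x = (\<Sum>b\<in>B. ((y - x) \<bullet> b) * frechet_derivative f (at z) b)"
      using mvt_directional[of x y f B] seg smooth_on_has_derivative[OF 0] assms xy
      by (auto simp: inner_diff_left)
    have "\<bar>f y - f x\<bar> \<le> (\<Sum>b\<in>B. \<bar>((y - x) \<bullet> b) * frechet_derivative f (at z) b\<bar>)"
      using z(2) by simp
    also have "\<dots> \<le> (\<Sum>b\<in>B. norm (y - x) * m b)"
      unfolding abs_mult using z seg assms(4)
      by (intro sum_mono mult_mono m) (auto simp: Basis_le_norm)
    finally show ?thesis by (simp add: sum_distrib_right mult.commute)
  qed
  then show ?case using m(1) by (intro exI[of _ "\<Sum>b\<in>B. m b"]) (auto intro: sum_nonneg)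
next
  case (Suc j)
  let ?P = "\<lambda>b M. \<forall>x\<in>K. (\<forall>b\<in>Basis - B. x \<bullet> b = 0) \<and>
      (\<forall>bs. set bs \<subseteq> B \<and> bs \<noteq> [] \<and> length bs \<le> j \<longrightarrow>
        iter_deriv (\<lambda>x. frechet_derivative f (at x) b) bs x = 0) \<longrightarrow>
      (\<forall>y\<in>K. (\<forall>b\<in>Basis - B. y \<bullet> b = 0) \<longrightarrow>
        \<bar>frechet_derivative f (at y) b - frechet_derivative f (at x) b\<bar> \<le> M * norm (y - x) ^ (j + 1))"
  have "\<forall>b. \<exists>M. 0 \<le> M \<and> ?P b M"
    using Suc.IH[OF smooth_on_derivative[OF Suc.prems]] by simp
  from choice[OF this] obtain m where m: "\<And>b. 0 \<le> m b" "\<And>b. ?P b (m b)"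
    by blast
  have "\<bar>f y - f x\<bar> \<le> (\<Sum>b\<in>B. m b) * norm (y - x) ^ (Suc j + 1)"
    if xy: "x \<in> K" "y \<in> K" "\<forall>b\<in>Basis - B. x \<bullet> b = 0" "\<forall>b\<in>Basis - B. y \<bullet> b = 0"
     and flat: "\<And>bs. set bs \<subseteq> B \<Longrightarrow> bs \<noteq> [] \<Longrightarrow> length bs \<le> Suc j \<Longrightarrow> iter_deriv f bs x = 0" for x y
  proof -
    have seg: "closed_segment x y \<subseteq> K" using xy assms(1) by (simp add: closed_segment_subset)
    obtain z where z: "z \<in> closed_segment x y"
      "f y - f x = (\<Sum>b\<in>B. ((y - x) \<bullet> b) * frechet_derivative f (at z) b)"
      using mvt_directional[of x y f B] seg smooth_on_has_derivative[OF Suc.prems] assms xy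
      by (auto simp: inner_diff_left)
    \<comment> \<open>The intermediate point stays in the subspace spanned by \<open>B\<close>, so
      the induction hypothesis can be used at it.\<close>
    have zV: "\<forall>b\<in>Basis - B. z \<bullet> b = 0"
      using z(1) xy by (auto simp: in_segment inner_add_left)
    have zx: "norm (z - x) \<le> norm (y - x)"
      using segment_bound1[OF z(1)] by (simp add: norm_minus_commute)
    have db: "\<bar>frechet_derivative f (at z) b\<bar> \<le> m b * norm (y - x) ^ (j + 1)" if b: "b \<in> B" for b
    proof -
      have "frechet_derivative f (at x) b = 0" using flat[of "[b]"] b by simp
      moreover have "iter_deriv (\<lambda>x. frechet_derivative f (at x) b) bs x = 0"
        if "set bs \<subseteq> B" "length bs \<le> j" for bs
        using flat[of "bs @ [b]"] that b by (simp add: iter_deriv_snoc)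
      ultimately have "\<bar>frechet_derivative f (at z) b\<bar> \<le> m b * norm (z - x) ^ (j + 1)"
        using m(2)[of b, rule_format, of x z] xy z(1) seg zV by auto
      also have "\<dots> \<le> m b * norm (y - x) ^ (j + 1)"
        by (intro mult_left_mono power_mono zx m) auto
      finally show ?thesis .
    qed
    have "\<bar>f y - f x\<bar> \<le> (\<Sum>b\<in>B. \<bar>((y - x) \<bullet> b) * frechet_derivative f (at z) b\<bar>)"
      using z(2) by simp
    also have "\<dots> \<le> (\<Sum>b\<in>B. norm (y - x) * (m b * norm (y - x) ^ (j + 1)))"
      unfolding abs_mult using assms(4)
      by (intro sum_mono mult_mono db) (auto simp: Basis_le_norm)
    also have "\<dots> = (\<Sum>b\<in>B. m b) * norm (y - x) ^ (Suc j + 1)"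
      by (simp add: sum_distrib_left sum_distrib_right mult_ac)
    finally show ?thesis .
  qed
  then show ?case using m(1) by (intro exI[of _ "\<Sum>b\<in>B. m b"]) (auto intro: sum_nonneg)
qed

text \<open>The map replaces the coordinate along \<open>b\<close> by \<open>w\<close>, so that the
  zero set of \<open>w\<close> becomes a piece of the hyperplane orthogonal to \<open>b\<close>. Its
  derivative is invertible wherever the derivative of \<open>w\<close> along \<open>b\<close> is
  nonzero.\<close>

lemma local_straightening:
  fixes w :: "'a::euclidean_space \<Rightarrow> real"
  assumes U: "open U" and w: "smooth_on w U" and x0: "x0 \<in> U" and b: "b \<in> Basis"
    and d: "frechet_derivative w (at x0) b \<noteq> 0"
  obtains U' V g where "open U'" "open V" "x0 \<in> U'" "U' \<subseteq> U"
    "homeomorphism U' V (\<lambda>x. x + (w x - x \<bullet> b) *\<^sub>R b) g" "smooth_on g V"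
    "\<And>y. y \<in> V \<Longrightarrow> (g has_derivative (\<lambda>v. v + ((v \<bullet> b - frechet_derivative w (at (g y)) v) /
        frechet_derivative w (at (g y)) b) *\<^sub>R b)) (at y)"
proof -
  let ?D = "\<lambda>x. frechet_derivative w (at x)"
  define U1 where "U1 = {x \<in> U. ?D x b \<noteq> 0}"
  have "continuous_on U (\<lambda>x. ?D x b)"
    using smooth_on_imp_continuous_on[OF smooth_on_derivative[OF w]] .
  then have "open (U \<inter> (\<lambda>x. ?D x b) -` (- {0}))"
    using continuous_open_preimage[OF _ U] by blast
  then have U1: "open U1" by (simp add: U1_def Int_def)
  have U1U: "U1 \<subseteq> U" by (auto simp: U1_def)
  have wd: "(w has_derivative ?D x) (at x)" if "x \<in> U" for x
    using smooth_on_has_derivative[OF w that] .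
  have lin: "linear (?D x)" if "x \<in> U" for x
    using wd[OF that] has_derivative_linear by blast
  \<comment> \<open>\<open>L\<close> is the derivative of the map and \<open>J\<close> its explicit
    inverse: only the component along \<open>b\<close> has to be corrected, and dividing by the
    derivative of \<open>w\<close> along \<open>b\<close> solves for it.\<close>
  define L where "L x v = v + (?D x v - v \<bullet> b) *\<^sub>R b" for x v
  define J where "J x v = v + ((v \<bullet> b - ?D x v) / ?D x b) *\<^sub>R b" for x v
  have bb: "b \<bullet> b = 1" using b by simp
  have LJ: "L x (J x v) = v" "J x (L x v) = v" if "x \<in> U1" for x v
  proof -
    have l: "linear (?D x)" and n: "?D x b \<noteq> 0" using that lin by (auto simp: U1_def)
    show "L x (J x v) = v"
      using n by (simp add: L_def J_def linear_add[OF l] linear_cmul[OF l] inner_add_left bb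
          scaleR_left_diff_distrib scaleR_left_distrib)
    define t where "t = ?D x v - v \<bullet> b"
    have Lt: "L x v = v + t *\<^sub>R b" by (simp add: L_def t_def)
    have "(L x v) \<bullet> b - ?D x (L x v) = - t * ?D x b"
      unfolding Lt by (simp add: linear_add[OF l] linear_cmul[OF l] inner_add_left bb)
        (simp add: t_def)
    then have "J x (L x v) = L x v + (- t) *\<^sub>R b" using n by (simp add: J_def)
    then show "J x (L x v) = v" by (simp add: Lt)
  qed
  have blL: "bounded_linear (L x)" "bounded_linear (J x)" if "x \<in> U" for x
  proof -
    have l: "bounded_linear (?D x)" using lin[OF that] by (simp add: linear_conv_bounded_linear)
    have l2: "bounded_linear (\<lambda>v. v \<bullet> b)" by (rule bounded_linear_inner_left)
    show "bounded_linear (L x)" unfolding L_def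
      by (intro bounded_linear_add bounded_linear_ident
          bounded_linear_compose[OF bounded_linear_scaleR_left] bounded_linear_sub l l2)
    show "bounded_linear (J x)" unfolding J_def
      by (intro bounded_linear_add bounded_linear_ident
          bounded_linear_compose[OF bounded_linear_scaleR_left]
          bounded_linear_compose[OF bounded_linear_divide] bounded_linear_sub l l2)
  qed
  have BL: "blinfun_apply (Blinfun (L x)) = L x" "blinfun_apply (Blinfun (J x)) = J x" if "x \<in> U" for x
    using blL[OF that] by (auto simp: bounded_linear_Blinfun_apply)
  let ?P = "\<lambda>x. x + (w x - x \<bullet> b) *\<^sub>R b"
  have derP: "(?P has_derivative L x) (at x)" if "x \<in> U" for x
    unfolding L_def using wd[OF that] by (auto intro!: derivative_eq_intros)
  obtain U' V g g' where I: "open U'" "U' \<subseteq> U1" "x0 \<in> U'" "open V" "?P x0 \<in> V" "homeomorphism U' V ?P g"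
    "\<And>y. y \<in> V \<Longrightarrow> (g has_derivative (g' y)) (at y)"
    "\<And>y. y \<in> V \<Longrightarrow> g' y = inv (blinfun_apply (Blinfun (L (g y))))"
    "\<And>y. y \<in> V \<Longrightarrow> bij (blinfun_apply (Blinfun (L (g y))))"
  proof (rule inverse_function_theorem[OF U1, of ?P "\<lambda>x. Blinfun (L x)" x0 "Blinfun (J x0)"])
    show "x0 \<in> U1" using x0 d by (simp add: U1_def)
    show "(?P has_derivative blinfun_apply (Blinfun (L x))) (at x)" if "x \<in> U1" for x
      using derP[of x] BL[of x] that U1U by auto
    show "continuous_on U1 (\<lambda>x. Blinfun (L x))"
    proof (rule continuous_on_blinfun_componentwise)
      fix i :: 'a
      have "continuous_on U1 (\<lambda>x. L x i)" unfolding L_def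
        using smooth_on_imp_continuous_on[OF smooth_on_derivative[OF w]] continuous_on_subset[OF _ U1U]
        by (intro continuous_intros) blast
      then show "continuous_on U1 (\<lambda>x. blinfun_apply (Blinfun (L x)) i)"
        by (rule continuous_on_eq) (use BL U1U in auto)
    qed
    show "Blinfun (J x0) o\<^sub>L Blinfun (L x0) = id_blinfun"
      using LJ \<open>x0 \<in> U1\<close> U1U x0 by (intro blinfun_eqI) (auto simp: BL)
  qed (use that in blast)
  have gU: "g y \<in> U'" if "y \<in> V" for y using I(6) that by (auto simp: homeomorphism_def)
  have g': "g' y = J (g y)" if y: "y \<in> V" for y
  proof
    fix v
    have gy: "g y \<in> U1" using gU[OF y] I(2) by auto
    have bl: "blinfun_apply (Blinfun (L (g y))) = L (g y)" using BL gy U1U by auto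
    have "inj (L (g y))" using I(9)[OF y] bl by (simp add: bij_def)
    then show "g' y v = J (g y) v"
      using I(8)[OF y] LJ(1)[OF gy] bl by (simp add: inv_f_eq)
  qed
  \<comment> \<open>Bootstrapping: the derivative of \<open>g\<close> at \<open>y\<close> is
    \<open>J (g y)\<close>, and \<open>J\<close> depends smoothly on its base point, so
    \<open>g\<close> gains one order of differentiability at each step.\<close>
  have "Ck_on r g V" for r
  proof (induction r)
    case 0
    then show ?case using I(6) by (simp add: homeomorphism_def)
  next
    case (Suc r)
    show ?case
    proof (rule Ck_on_SucI[OF I(4)])
      show "(g has_derivative J (g y)) (at y)" if "y \<in> V" for y
        using I(7)[OF that] g'[OF that] by simp
      show "Ck_on r (\<lambda>y. J (g y) v) V" for v
      proof (rule Ck_on_compose[OF I(4) U1 Suc])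
        show "g ` V \<subseteq> U1" using gU I(2) by auto
        have D: "Ck_on r (\<lambda>x. ?D x u) U1" for u
          using Ck_on_subset[OF _ U1U] smooth_on_derivative[OF w] unfolding smooth_on_def by blast
        show "Ck_on r (\<lambda>x. J x v) U1" unfolding J_def
          by (intro Ck_on_add[OF U1] Ck_on_const Ck_on_scaleR[OF U1] Ck_on_divide[OF U1]
              Ck_on_diff[OF U1] D) (auto simp: U1_def)
      qed
    qed
  qed
  then have "smooth_on g V" by (simp add: smooth_on_def)
  moreover have "(g has_derivative J (g y)) (at y)" if "y \<in> V" for y
    using I(7)[OF that] g'[OF that] by simp
  ultimately show ?thesis using that[of U' V g] I U1U unfolding J_def by blast
qed

text \<open>The subspace spanned by part of the basis takes the place of a space of lower dimension,
  which makes an induction on the dimension possible inside a fixed type. A critical point is either flat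
  to high order, or some iterated derivative vanishes there while its own derivative does not; in the second
  case the zero set of that iterated derivative can be straightened to a smaller subspace.\<close>

lemma sard_partial:
  fixes f :: "'a::euclidean_space \<Rightarrow> real"
  assumes "B \<subseteq> Basis" "open U" "smooth_on f U"
  shows "negligible (f ` {x \<in> U. (\<forall>b\<in>Basis - B. x \<bullet> b = 0) \<and>
    (\<forall>b\<in>B. frechet_derivative f (at x) b = 0)})"
  using assms
proof (induction "card B" arbitrary: B U f rule: less_induct)
  case less
  let ?S = "\<lambda>f U B. {x \<in> U. (\<forall>b\<in>Basis - B. x \<bullet> b = 0) \<and> (\<forall>b\<in>B. frechet_derivative f (at x) b = 0)}"
  let ?D = "DIM('a)"
  \<comment> \<open>Flatness is demanded up to the full dimension and not up to
    \<open>card B\<close>, since \<open>negligible_image_high_order\<close> counts cells in the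
    whole space.\<close>
  define flat where "flat x \<longleftrightarrow> (\<forall>bs. set bs \<subseteq> B \<and> bs \<noteq> [] \<and> length bs \<le> ?D \<longrightarrow> iter_deriv f bs x = 0)" for x
  define E where "E = (\<lambda>(bs, b). {x \<in> ?S f U B. iter_deriv f bs x = 0 \<and>
      frechet_derivative (iter_deriv f bs) (at x) b \<noteq> 0})"
  have finB: "finite B" using less.prems(1) by (rule finite_subset) simp
  have cov: "?S f U B \<subseteq> {x \<in> ?S f U B. flat x} \<union> (\<Union>p\<in>lists B \<times> B. E p)"
  proof
    fix x assume x: "x \<in> ?S f U B"
    show "x \<in> {x \<in> ?S f U B. flat x} \<union> (\<Union>p\<in>lists B \<times> B. E p)"
    proof (cases "flat x")
      case False
      then obtain bs0 where bs0: "set bs0 \<subseteq> B" "bs0 \<noteq> []" "iter_deriv f bs0 x \<noteq> 0"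
        by (auto simp: flat_def)
      \<comment> \<open>Entries are stripped from the front until the derivative along the remaining
        list vanishes. This happens while at least one entry is left, because first derivatives
        along \<open>B\<close> vanish at a critical point.\<close>
      have "\<exists>bs\<in>lists B. \<exists>b\<in>B. iter_deriv f bs x = 0 \<and> frechet_derivative (iter_deriv f bs) (at x) b \<noteq> 0"
        using bs0
      proof (induction bs0)
        case (Cons a as)
        show ?case
        proof (cases "as = []")
          case True
          then show ?thesis using Cons x by auto
        next
          case False
          then show ?thesis using Cons by (cases "iter_deriv f as x = 0") auto
        qed
      qed simp
      then show ?thesis using x by (auto simp: E_def)
    qed (use x in auto)
  qed
  have n1: "negligible (f ` {x \<in> ?S f U B. flat x})"
  proof (rule negligible_image_locally)
    fix x0 assume x0: "x0 \<in> {x \<in> ?S f U B. flat x}"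
    then obtain r where r: "0 < r" "cball x0 r \<subseteq> U"
      using less.prems(2) open_contains_cball by blast
    obtain M where M: "0 \<le> M" "\<And>x y. \<lbrakk>x \<in> cball x0 r; \<forall>b\<in>Basis - B. x \<bullet> b = 0; flat x; y \<in> cball x0 r;
        \<forall>b\<in>Basis - B. y \<bullet> b = 0\<rbrakk> \<Longrightarrow> \<bar>f y - f x\<bar> \<le> M * norm (y - x) ^ (?D + 1)"
      using flat_point_bound[OF convex_cball compact_cball r(2) less.prems(1,3), of ?D]
      unfolding flat_def by blast
    have "negligible (f ` ({x \<in> ?S f U B. flat x} \<inter> ball x0 r))"
    proof (rule negligible_image_high_order[OF _ M(1)])
      show "bounded ({x \<in> ?S f U B. flat x} \<inter> ball x0 r)" by (simp add: bounded_Int)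
      show "\<bar>f y - f x\<bar> \<le> M * norm (y - x) ^ (?D + 1)"
        if "y \<in> {x \<in> ?S f U B. flat x} \<inter> ball x0 r" "x \<in> {x \<in> ?S f U B. flat x} \<inter> ball x0 r" for x y
        using that by (intro M(2)) auto
    qed
    then show "\<exists>N. open N \<and> x0 \<in> N \<and> negligible (f ` ({x \<in> ?S f U B. flat x} \<inter> N))"
      using r(1) by (intro exI[of _ "ball x0 r"]) auto
  qed
  have n2: "negligible (f ` E (bs, b))" if p: "bs \<in> lists B" "b \<in> B" for bs b
  proof (rule negligible_image_locally)
    fix x0 assume x0: "x0 \<in> E (bs, b)"
    define w where "w = iter_deriv f bs"
    have w: "smooth_on w U" unfolding w_def by (rule smooth_on_iter_deriv[OF less.prems(3)])
    have bB: "b \<in> Basis" using p less.prems(1) by auto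
    have x0': "x0 \<in> U" "frechet_derivative w (at x0) b \<noteq> 0"
      using x0 by (auto simp: E_def w_def)
    obtain U' V g where I: "open U'" "open V" "x0 \<in> U'" "U' \<subseteq> U"
      "homeomorphism U' V (\<lambda>x. x + (w x - x \<bullet> b) *\<^sub>R b) g" "smooth_on g V"
      "\<And>y. y \<in> V \<Longrightarrow> (g has_derivative (\<lambda>v. v + ((v \<bullet> b - frechet_derivative w (at (g y)) v) /
        frechet_derivative w (at (g y)) b) *\<^sub>R b)) (at y)"
      using local_straightening[OF less.prems(2) w x0'(1) bB x0'(2)] by blast
    have gV: "g ` V \<subseteq> U" using I(4,5) by (auto simp: homeomorphism_def)
    define h where "h = (\<lambda>y. f (g y))"
    have h: "smooth_on h V" unfolding h_def
      by (rule smooth_on_compose[OF I(2) less.prems(2) I(6) gV less.prems(3)])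
    have card: "card (B - {b}) < card B" using p(2) finB by (rule card_Diff1_less[rotated])
    have neg: "negligible (h ` ?S h V (B - {b}))"
      using less.hyps[OF card _ I(2) h] less.prems(1) by auto
    \<comment> \<open>On the zero set of \<open>w\<close> the new coordinate along \<open>b\<close>
      is 0, so the image lies in the smaller subspace. A partial derivative of \<open>h\<close>
      there is one of \<open>f\<close> plus a multiple of the one along \<open>b\<close>, and both
      vanish.\<close>
    have "f ` (E (bs, b) \<inter> U') \<subseteq> h ` ?S h V (B - {b})"
    proof
      fix t assume "t \<in> f ` (E (bs, b) \<inter> U')"
      then obtain x where x: "x \<in> E (bs, b)" "x \<in> U'" "t = f x" by blast
      define y where "y = x + (w x - x \<bullet> b) *\<^sub>R b"
      have y: "y \<in> V" "g y = x" using I(5) x(2) by (auto simp: homeomorphism_def y_def)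
      have wx: "w x = 0" and xS: "x \<in> ?S f U B" using x(1) by (auto simp: E_def w_def)
      have "y \<bullet> b' = 0" if b': "b' \<in> Basis - (B - {b})" for b'
      proof (cases "b' = b")
        case True
        then show ?thesis using bB wx by (simp add: y_def inner_diff_left)
      next
        case False
        then show ?thesis using b' bB xS wx by (auto simp: y_def inner_diff_left inner_not_same_Basis)
      qed
      moreover have "frechet_derivative h (at y) b' = 0" if b': "b' \<in> B - {b}" for b'
      proof -
        have fd: "(f has_derivative frechet_derivative f (at x)) (at (g y))"
          using smooth_on_has_derivative[OF less.prems(3)] xS y by auto
        then have l: "linear (frechet_derivative f (at x))" using has_derivative_linear by blast
        from diff_chain_at[OF I(7)[OF y(1)] fd]
        have hd: "(h has_derivative (\<lambda>v. frechet_derivative f (at x) (v + ((v \<bullet> b - frechet_derivative w (at (g y)) v) /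
        frechet_derivative w (at (g y)) b) *\<^sub>R b))) (at y)"
          by (simp add: o_def h_def)
        have "frechet_derivative f (at x) b' = 0" "frechet_derivative f (at x) b = 0"
          using xS b' p(2) by auto
        then show ?thesis
          unfolding frechet_derivative_at[OF hd, symmetric] by (simp add: linear_add[OF l] linear_cmul[OF l])
      qed
      ultimately have "y \<in> ?S h V (B - {b})" using y by auto
      then show "t \<in> h ` ?S h V (B - {b})" using x(3) y by (auto simp: h_def)
    qed
    then have "negligible (f ` (E (bs, b) \<inter> U'))" using neg negligible_subset by blast
    then show "\<exists>N. open N \<and> x0 \<in> N \<and> negligible (f ` (E (bs, b) \<inter> N))"
      using I by blast
  qed
  have "countable (lists B \<times> B)"
    using finB by (intro countable_SIGMA countable_lists countable_finite) auto
  then have "negligible (\<Union>p\<in>lists B \<times> B. f ` E p)"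
    using n2 by (intro negligible_countable_Union) auto
  then have "negligible (f ` {x \<in> ?S f U B. flat x} \<union> (\<Union>p\<in>lists B \<times> B. f ` E p))"
    using n1 by (rule negligible_Un[rotated])
  moreover have "f ` ?S f U B \<subseteq> f ` {x \<in> ?S f U B. flat x} \<union> (\<Union>p\<in>lists B \<times> B. f ` E p)"
    using image_mono[OF cov, of f] by (simp only: image_Un image_UN)
  ultimately show ?case by (rule negligible_subset)
qed

theorem sard_real:
  fixes f :: "'a::euclidean_space \<Rightarrow> real"
  assumes "open U" "smooth_on f U"
  shows "negligible (f ` {x \<in> U. frechet_derivative f (at x) = (\<lambda>v. 0)})"
  by (rule negligible_subset[OF sard_partial[OF order_refl assms]]) auto

section \<open>Coordinates in a finite-dimensional scalar product space\<close>

lemma scalar_product_onD: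
  assumes "scalar_product_on V ip"
  shows "u \<in> V \<Longrightarrow> v \<in> V \<Longrightarrow> ip u v = ip v u"
    "u \<in> V \<Longrightarrow> v \<in> V \<Longrightarrow> w \<in> V \<Longrightarrow> ip (u + v) w = ip u w + ip v w"
    "u \<in> V \<Longrightarrow> v \<in> V \<Longrightarrow> ip (c *\<^sub>R u) v = c * ip u v"
    "u \<in> V \<Longrightarrow> u \<noteq> 0 \<Longrightarrow> 0 < ip u u"
  using assms by (auto simp: scalar_product_on_def)

lemma scalar_product_on_sum:
  assumes ip: "scalar_product_on V ip" and V: "subspace V"
    and f: "\<And>i. i \<in> I \<Longrightarrow> f i \<in> V" and w: "w \<in> V"
  shows "ip (\<Sum>i\<in>I. c i *\<^sub>R f i) w = (\<Sum>i\<in>I. c i * ip (f i) w)"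
  using f
proof (induction I rule: infinite_finite_induct)
  case (insert i I)
  have "(\<Sum>i\<in>I. c i *\<^sub>R f i) \<in> V" "c i *\<^sub>R f i \<in> V"
    using insert by (auto intro!: subspace_sum[OF V] subspace_scale[OF V])
  then show ?case using insert scalar_product_onD(2,3)[OF ip] w by simp
qed (use scalar_product_onD(3)[OF ip w w, of 0] in auto)

lemma gram_schmidt:
  assumes ip: "scalar_product_on V ip" and V: "subspace V"
    and C: "finite C" "independent C" "C \<subseteq> V"
  shows "\<exists>b. (\<forall>i<card C. b i \<in> V) \<and>
     (\<forall>i<card C. \<forall>j<card C. ip (b i) (b j) = (if i = j then 1 else 0)) \<and>
     span (b ` {..<card C}) = span C"
  using C
proof (induction C)
  case (insert x C)
  let ?m = "card C"
  have indep: "independent C" "x \<notin> span C"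
    using insert by (auto simp: independent_insert)
  have "C \<subseteq> V" using insert.prems by simp
  from insert.IH[OF indep(1) this] obtain b where "\<forall>i<?m. b i \<in> V"
    "\<forall>i<?m. \<forall>j<?m. ip (b i) (b j) = (if i = j then 1 else 0)"
    and b3: "span (b ` {..<?m}) = span C" by blast
  then have b: "\<And>i. i < ?m \<Longrightarrow> b i \<in> V"
    "\<And>i j. i < ?m \<Longrightarrow> j < ?m \<Longrightarrow> ip (b i) (b j) = (if i = j then 1 else 0)" by auto
  note b = b b3
  \<comment> \<open>The projection of \<open>x\<close> onto the span of the vectors already built.
    As \<open>x\<close> lies outside that span, the remainder \<open>u\<close> is nonzero and can be
    normalised.\<close>
  define s where "s = (\<Sum>i<?m. ip x (b i) *\<^sub>R b i)"
  define u where "u = x - s"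
  have xV: "x \<in> V" using insert by auto
  have sV: "s \<in> V" unfolding s_def
    using b by (auto intro!: subspace_sum[OF V] subspace_scale[OF V])
  have uV: "u \<in> V" unfolding u_def using subspace_diff[OF V xV sV] .
  have s_span: "s \<in> span C" unfolding s_def b(3)[symmetric]
    by (intro span_sum span_scale span_base) auto
  have u0: "u \<noteq> 0" using indep(2) s_span by (auto simp: u_def)
  have ub: "ip u (b j) = 0" if j: "j < ?m" for j
  proof -
    have "ip s (b j) = (\<Sum>i<?m. ip x (b i) * ip (b i) (b j))"
      unfolding s_def by (rule scalar_product_on_sum[OF ip V]) (use b j in auto)
    also have "\<dots> = (\<Sum>i<?m. if i = j then ip x (b j) else 0)"
      by (rule sum.cong) (use b j in auto)
    also have "\<dots> = ip x (b j)" using j by simp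
    finally have "ip s (b j) = ip x (b j)" .
    moreover have "ip x (b j) = ip u (b j) + ip s (b j)"
      using scalar_product_onD(2)[OF ip uV sV b(1)[OF j]] by (simp add: u_def)
    ultimately show ?thesis by simp
  qed
  define l where "l = sqrt (ip u u)"
  have l: "0 < l" "l * l = ip u u"
    using scalar_product_onD(4)[OF ip uV u0] by (auto simp: l_def)
  define w where "w = (1 / l) *\<^sub>R u"
  have wV: "w \<in> V" unfolding w_def using subspace_scale[OF V uV] .
  have wb1: "ip w (b j) = 0" if "j < ?m" for j
    using scalar_product_onD(3)[OF ip uV b(1)[OF that]] ub[OF that] by (simp add: w_def)
  have wb2: "ip (b j) w = 0" if "j < ?m" for j
    using scalar_product_onD(1)[OF ip b(1)[OF that] wV] wb1[OF that] by simp
  note wb = wb1 wb2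
  have ww: "ip w w = 1"
  proof -
    have "ip w w = (1 / l) * ip u w" unfolding w_def[symmetric]
      using scalar_product_onD(3)[OF ip uV wV, of "1 / l"] by (simp add: w_def)
    also have "ip u w = (1 / l) * ip u u"
      using scalar_product_onD(1,3)[OF ip] uV wV by (metis w_def)
    finally show ?thesis unfolding l(2)[symmetric] using l(1) by simp
  qed
  let ?b = "b(?m := w)"
  have cx: "card (insert x C) = Suc ?m" using insert by simp
  have im: "?b ` {..<Suc ?m} = insert w (b ` {..<?m})"
    by (auto simp: lessThan_Suc)
  have "span (insert w (b ` {..<?m})) = span (insert x C)"
  proof -
    have "span (insert w (b ` {..<?m})) = span (insert w C)"
      using b(3) by (simp add: span_insert)
    also have "\<dots> = span (insert x C)"
    proof (rule span_eq[THEN iffD2], intro conjI insert_subsetI)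
      have sx: "s \<in> span (insert x C)" using s_span span_mono[of C "insert x C"] by auto
      show "w \<in> span (insert x C)" unfolding w_def u_def
        by (intro span_scale span_diff sx span_base) auto
      have "x = l *\<^sub>R w + s" using l by (simp add: w_def u_def)
      moreover have "l *\<^sub>R w + s \<in> span (insert w C)"
        using s_span span_mono[of C "insert w C"] by (intro span_add span_scale) (auto simp: span_base)
      ultimately show "x \<in> span (insert w C)" by simp
      show "C \<subseteq> span (insert x C)" "C \<subseteq> span (insert w C)"
        by (auto intro: span_base)
    qed
    finally show ?thesis .
  qed
  then show ?case unfolding cx
    by (intro exI[of _ ?b]) (use b wb ww wV im in \<open>auto simp: less_Suc_eq\<close>)
qed auto

lemma orthonormal_basis_exists:
  assumes ip: "scalar_product_on V ip" and V: "subspace V" and B: "finite B" "span B = V"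
  shows "\<exists>b. orthonormal_basis_on V ip (dim V) b"
proof -
  obtain C where C: "C \<subseteq> V" "independent C" "V \<subseteq> span C" "card C = dim V"
    using basis_exists by blast
  have "finite C" using independent_span_bound[OF B(1) C(2)] C(1) B(2) by auto
  from gram_schmidt[OF ip V this C(2,1)] C(4) obtain b where
    "\<forall>i<dim V. b i \<in> V" "\<forall>i<dim V. \<forall>j<dim V. ip (b i) (b j) = (if i = j then 1 else 0)"
    "span (b ` {..<dim V}) = span C" by auto
  moreover have "span C = V" using C(1,3) span_minimal[OF C(1) V] by auto
  ultimately show ?thesis unfolding orthonormal_basis_on_def by blast
qed

section \<open>Borel structures and the coefficient space\<close>

lemma space_borel_of [simp]: "space (borel_of T) = topspace T"
  unfolding borel_of_def by (rule space_measure_of) (auto dest: openin_subset)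

lemma sets_borel_of: "sets (borel_of T) = sigma_sets (topspace T) {U. openin T U}"
  unfolding borel_of_def by (rule sets_measure_of) (auto dest: openin_subset)

lemma borel_of_euclidean: "sets (borel_of euclidean) = sets borel"
  by (simp add: sets_borel_of borel_def)

lemma continuous_map_measurable:
  assumes "continuous_map T T' f"
  shows "f \<in> measurable (borel_of T) (borel_of T')"
proof -
  have "f \<in> measurable (borel_of T) (sigma (topspace T') {U. openin T' U})"
  proof (rule measurable_measure_of)
    show "{U. openin T' U} \<subseteq> Pow (topspace T')" by (auto dest: openin_subset)
    show "f \<in> space (borel_of T) \<rightarrow> topspace T'"
      using assms by (auto simp: continuous_map_def)
    fix U assume "U \<in> {U. openin T' U}"
    then have "openin T {x \<in> topspace T. f x \<in> U}" using assms by (auto simp: continuous_map_def)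
    moreover have "f -` U \<inter> space (borel_of T) = {x \<in> topspace T. f x \<in> U}" by auto
    ultimately show "f -` U \<inter> space (borel_of T) \<in> sets (borel_of T)" by (auto simp: sets_borel_of)
  qed
  then show ?thesis by (simp add: borel_of_def)
qed

lemma continuous_map_borel_measurable:
  assumes "continuous_map T euclidean f"
  shows "f \<in> borel_measurable (borel_of T)"
  using continuous_map_measurable[OF assms] measurable_cong_sets[OF refl borel_of_euclidean] by blast

text \<open>A point of the finite product has the value \<open>undefined\<close> at every index from
  \<open>n\<close> on. Its coordinates there are constant, hence measurable, and so every function
  that is continuous on all of \<open>nat \<Rightarrow> real\<close> becomes measurable on the
  finite product.\<close>

lemma measurable_ident_PiM:
  "(\<lambda>c. c) \<in> measurable (\<Pi>\<^sub>M i\<in>{..<n}. lborel) (borel :: (nat \<Rightarrow> real) measure)"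
proof -
  have "(\<lambda>c. c) \<in> measurable (\<Pi>\<^sub>M i\<in>{..<n}. lborel :: real measure) (\<Pi>\<^sub>M i\<in>(UNIV::nat set). borel)"
  proof (rule measurable_PiM_single')
    fix i :: nat
    show "(\<lambda>c. c i) \<in> borel_measurable (\<Pi>\<^sub>M i\<in>{..<n}. lborel :: real measure)"
    proof (cases "i < n")
      case False
      have "(\<lambda>c. c i) \<in> borel_measurable (\<Pi>\<^sub>M i\<in>{..<n}. lborel :: real measure) \<longleftrightarrow>
         (\<lambda>c. undefined :: real) \<in> borel_measurable (\<Pi>\<^sub>M i\<in>{..<n}. lborel :: real measure)"
        by (rule measurable_cong) (use False in \<open>auto simp: space_PiM PiE_def extensional_def\<close>)
      then show ?thesis by simp
    qed simp
  qed auto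
  then show ?thesis using measurable_cong_sets[OF refl sets_PiM_equal_borel] by blast
qed

lemma continuous_on_measurable_PiM:
  fixes f :: "(nat \<Rightarrow> real) \<Rightarrow> 'b::topological_space"
  assumes "continuous_on UNIV f"
  shows "f \<in> borel_measurable (\<Pi>\<^sub>M i\<in>{..<n}. lborel)"
  using measurable_comp[OF measurable_ident_PiM borel_measurable_continuous_onI[OF assms]]
  by (simp add: o_def)

lemma continuous_map_measurable_PiM:
  fixes f :: "(nat \<Rightarrow> real) \<Rightarrow> 'b"
  assumes "continuous_map euclidean T f"
  shows "f \<in> measurable (\<Pi>\<^sub>M i\<in>{..<n}. lborel) (borel_of T)"
proof -
  have "f \<in> measurable borel (borel_of T)"
    using continuous_map_measurable[OF assms] measurable_cong_sets[OF borel_of_euclidean refl, of "borel_of T"]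
    by blast
  from measurable_comp[OF measurable_ident_PiM this] show ?thesis by (simp add: o_def)
qed

lemma continuous_on_coordinate: "continuous_on UNIV (\<lambda>c :: nat \<Rightarrow> real. c i)"
  by (rule continuous_on_product_coordinates)

text \<open>Trades \<open>X\<close> for a random vector of coordinates with a density against
  product Lebesgue measure; all later integrals live on the coefficient space.\<close>

lemma coordinates_law:
  fixes ip :: "'v::real_vector \<Rightarrow> 'v \<Rightarrow> real" and X :: "'w \<Rightarrow> 'v"
  assumes ip: "scalar_product_on V ip" and V: "subspace V" and B: "finite B" "span B = V"
    and X: "distributed P (lborel_on V ip) X (\<lambda>\<phi>. ennreal (\<rho> \<phi>))"
    and \<rho>: "continuous_map (ip_topology V ip) euclideanreal \<rho>"
  obtains b Y where "\<And>c. (\<Sum>i<dim V. c i *\<^sub>R b i) \<in> V"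
    "\<And>\<phi>. \<phi> \<in> V \<Longrightarrow> \<exists>c. \<phi> = (\<Sum>i<dim V. c i *\<^sub>R b i)"
    "\<And>c. ip_norm ip (\<Sum>i<dim V. c i *\<^sub>R b i) = L2_set c {..<dim V}"
    "continuous_on UNIV (\<lambda>c. \<rho> (\<Sum>i<dim V. c i *\<^sub>R b i))"
    "distributed P (\<Pi>\<^sub>M i\<in>{..<dim V}. lborel) Y (\<lambda>c. ennreal (\<rho> (\<Sum>i<dim V. c i *\<^sub>R b i)))"
    "\<And>\<omega>. \<omega> \<in> space P \<Longrightarrow> X \<omega> = (\<Sum>i<dim V. Y \<omega> i *\<^sub>R b i)"
proof -
  define n where "n = dim V"
  \<comment> \<open>The same choice term as in \<open>lborel_on\<close>, so that Lebesgue measure on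
    \<open>V\<close> is by definition the image of the product measure under
    \<open>e\<close>.\<close>
  define b where "b = (SOME b. orthonormal_basis_on V ip n b)"
  have ob: "orthonormal_basis_on V ip n b"
    using someI_ex[OF orthonormal_basis_exists[OF ip V B]] by (simp add: b_def n_def)
  then have b: "\<And>i. i < n \<Longrightarrow> b i \<in> V" "\<And>i j. i < n \<Longrightarrow> j < n \<Longrightarrow> ip (b i) (b j) = (if i = j then 1 else 0)"
    "span (b ` {..<n}) = V" by (auto simp: orthonormal_basis_on_def)
  define e where "e c = (\<Sum>i<n. c i *\<^sub>R b i)" for c :: "nat \<Rightarrow> real"
  have eV: "e c \<in> V" for c unfolding e_def
    using b(1) by (auto intro!: subspace_sum[OF V] subspace_scale[OF V])
  have e_diff: "e c - e c' = e (\<lambda>i. c i - c' i)" for c c'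
    by (simp add: e_def sum_subtractf scaleR_left_diff_distrib)
  have ipe: "ip (e c) (b j) = c j" if j: "j < n" for c j
  proof -
    have "ip (e c) (b j) = (\<Sum>i<n. c i * ip (b i) (b j))"
      unfolding e_def by (rule scalar_product_on_sum[OF ip V]) (use b j in auto)
    also have "\<dots> = (\<Sum>i<n. if i = j then c j else 0)"
      by (rule sum.cong) (use b j in auto)
    finally show ?thesis using j by simp
  qed
  have e_norm: "ip_norm ip (e c) = L2_set c {..<n}" for c
  proof -
    have "ip (e c) (e c) = (\<Sum>i<n. c i * ip (b i) (e c))"
      by (subst (1) e_def, rule scalar_product_on_sum[OF ip V]) (use b eV in auto)
    also have "\<dots> = (\<Sum>i<n. (c i)\<^sup>2)"
      using ipe scalar_product_onD(1)[OF ip] b(1) eV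
      by (intro sum.cong) (auto simp: power2_eq_square)
    finally show ?thesis by (simp add: ip_norm_def L2_set_def)
  qed
  have e_surj: "\<exists>c. \<phi> = e c" if "\<phi> \<in> V" for \<phi>
  proof -
    have "V \<subseteq> range e"
      unfolding b(3)[symmetric]
    proof (rule span_minimal)
      show "b ` {..<n} \<subseteq> range e"
      proof
        fix v assume "v \<in> b ` {..<n}"
        then obtain i where i: "i < n" "v = b i" by auto
        have "e (\<lambda>j. if j = i then 1 else 0) = (\<Sum>j<n. if j = i then b i else 0)"
          unfolding e_def by (rule sum.cong) auto
        then have "v = e (\<lambda>j. if j = i then 1 else 0)" using i by simp
        then show "v \<in> range e" by blast
      qed
      have "e (\<lambda>i. 0) = 0" "e (\<lambda>i. c i + c' i) = e c + e c'" "e (\<lambda>i. t * c i) = t *\<^sub>R e c" for c c' t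
        by (simp_all add: e_def scaleR_left_distrib sum.distrib scaleR_sum_right)
      then show "subspace (range e)" unfolding subspace_def
        by (auto simp: image_iff) metis+
    qed
    then show ?thesis using that by auto
  qed
  \<comment> \<open>The restriction to \<open>{..<n}\<close> makes \<open>\<kappa>\<close> inverse
    to \<open>e\<close> on the space of the product measure, whose points are
    \<open>undefined\<close> from \<open>n\<close> on.\<close>
  define \<kappa> where "\<kappa> \<phi> = (\<lambda>i\<in>{..<n}. ip \<phi> (b i))" for \<phi>
  have ek: "e (\<kappa> \<phi>) = \<phi>" if V: "\<phi> \<in> V" for \<phi>
  proof -
    obtain c where c: "\<phi> = e c" using e_surj[OF V] by blast
    show ?thesis unfolding c \<kappa>_def e_def[of "\<lambda>i\<in>_. _ i"] using ipe by (simp add: e_def)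
  qed
  have nn: "ip_norm ip (e c) = 0 \<longleftrightarrow> e c = 0" for c
  proof
    assume "ip_norm ip (e c) = 0"
    then have "\<forall>i<n. c i = 0" by (simp add: e_norm L2_set_eq_0_iff)
    then show "e c = 0" by (simp add: e_def)
  next
    assume "e c = 0"
    moreover have "ip (0 *\<^sub>R e c) (e c) = 0" using scalar_product_onD(3)[OF ip eV eV, of 0] by simp
    ultimately have "ip (e c) (e c) = 0" by simp
    then show "ip_norm ip (e c) = 0" by (simp add: ip_norm_def)
  qed
  define d where "d u v = (if u \<in> V \<and> v \<in> V then ip_norm ip (u - v) else 0)" for u v
  have de: "d (e c) (e c') = L2_set (\<lambda>i. c i - c' i) {..<n}" for c c'
    by (simp add: d_def eV e_diff e_norm)
  interpret Metric_space V d
  proof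
    show "0 \<le> d x y" for x y
    proof (cases "x \<in> V \<and> y \<in> V")
      case True
      then obtain c c' where "x = e c" "y = e c'" using e_surj by blast
      then show ?thesis by (simp add: de)
    qed (auto simp: d_def)
    show "d x y = d y x" for x y
    proof (cases "x \<in> V \<and> y \<in> V")
      case True
      then obtain c c' where "x = e c" "y = e c'" using e_surj by blast
      then show ?thesis by (simp add: de L2_set_def power2_commute)
    qed (auto simp: d_def)
    show "(d x y = 0) = (x = y)" if xy: "x \<in> V" "y \<in> V" for x y
    proof -
      obtain c c' where c: "x = e c" "y = e c'" using e_surj xy by blast
      have "d x y = ip_norm ip (e (\<lambda>i. c i - c' i))" by (simp add: c d_def eV e_diff)
      then show ?thesis unfolding c using nn[of "\<lambda>i. c i - c' i"] e_diff[of c c'] right_minus_eq[of "e c" "e c'"] by simp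
    qed
    show "d x z \<le> d x y + d y z" if xyz: "x \<in> V" "y \<in> V" "z \<in> V" for x y z
    proof -
      obtain c c' c'' where "x = e c" "y = e c'" "z = e c''" using e_surj xyz by blast
      then show ?thesis
        using L2_set_triangle_ineq[of "\<lambda>i. c i - c' i" "\<lambda>i. c' i - c'' i" "{..<n}"] by (simp add: de)
    qed
  qed
  let ?T = "ip_topology V ip"
  have T: "?T = mtopology" by (simp add: ip_topology_def d_def[abs_def])
  have cont_e: "continuous_map euclidean ?T e"
    unfolding T continuous_map_to_metric
  proof (intro ballI allI impI)
    fix c :: "nat \<Rightarrow> real" and \<epsilon> :: real assume "0 < \<epsilon>"
    let ?U = "{c'. L2_set (\<lambda>i. c i - c' i) {..<n} < \<epsilon>}"
    have "open ?U" unfolding L2_set_def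
      by (intro open_Collect_less continuous_intros continuous_on_coordinate)
    moreover have "c \<in> ?U" using \<open>0 < \<epsilon>\<close> by (simp add: L2_set_def)
    ultimately show "\<exists>U. openin euclidean U \<and> c \<in> U \<and> (\<forall>y\<in>U. e y \<in> mball (e c) \<epsilon>)"
      by (intro exI[of _ ?U]) (auto simp: eV de)
  qed
  have cont_c: "continuous_map ?T euclideanreal (\<lambda>\<phi>. ip \<phi> (b i))" if i: "i < n" for i
  proof -
    have "continuous_map mtopology (Met_TC.mtopology) (\<lambda>\<phi>. ip \<phi> (b i))"
      unfolding Met_TC.continuous_map_to_metric
    proof (intro ballI allI impI)
      fix \<phi> and \<epsilon> :: real assume "\<phi> \<in> topspace mtopology" "0 < \<epsilon>"
      then obtain c where c: "\<phi> = e c" using e_surj by auto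
      have "ip \<psi> (b i) \<in> Met_TC.mball (ip \<phi> (b i)) \<epsilon>" if \<psi>: "\<psi> \<in> mball \<phi> \<epsilon>" for \<psi>
      proof -
        obtain c' where c': "\<psi> = e c'" using \<psi> e_surj by auto
        have "\<bar>c i - c' i\<bar> \<le> L2_set (\<lambda>i. c i - c' i) {..<n}"
          using member_le_L2_set[of "{..<n}" i "\<lambda>i. \<bar>c i - c' i\<bar>"] i by (simp add: L2_set_def)
        also have "\<dots> < \<epsilon>" using \<psi> by (simp add: c c' de)
        finally show ?thesis using i by (simp add: c c' ipe dist_real_def)
      qed
      then show "\<exists>U. openin mtopology U \<and> \<phi> \<in> U \<and> (\<forall>y\<in>U. ip y (b i) \<in> Met_TC.mball (ip \<phi> (b i)) \<epsilon>)"
        using \<open>0 < \<epsilon>\<close> c eV by (intro exI[of _ "mball \<phi> \<epsilon>"]) auto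
    qed
    then show ?thesis by (simp add: T mtopology_is_euclidean)
  qed
  let ?N = "\<Pi>\<^sub>M i\<in>{..<n}. (lborel :: real measure)"
  let ?B = "borel_of ?T"
  have L: "lborel_on V ip = distr ?N ?B e"
    unfolding lborel_on_def Let_def n_def[symmetric] b_def[symmetric] e_def[abs_def] ..
  have me[measurable]: "e \<in> measurable ?N ?B"
    by (rule continuous_map_measurable_PiM[OF cont_e])
  have mk[measurable]: "\<kappa> \<in> measurable ?B ?N" unfolding \<kappa>_def
    by (rule measurable_restrict) (use continuous_map_borel_measurable[OF cont_c] in auto)
  have mr[measurable]: "\<rho> \<in> borel_measurable ?B"
    by (rule continuous_map_borel_measurable[OF \<rho>])
  have mX[measurable]: "X \<in> measurable P ?B" and dX: "distr P ?B X = density (distr ?N ?B e) (\<lambda>\<phi>. ennreal (\<rho> \<phi>))"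
    using X unfolding L distributed_def
    by (auto cong: distr_cong)
  have XV: "X \<omega> \<in> V" if "\<omega> \<in> space P" for \<omega>
    using measurable_space[OF mX that] by (simp add: T)
  have "distr P ?N (\<lambda>\<omega>. \<kappa> (X \<omega>)) = distr (distr P ?B X) ?N \<kappa>"
    by (simp add: distr_distr o_def)
  also have "\<dots> = distr (distr (density ?N (\<lambda>c. ennreal (\<rho> (e c)))) ?B e) ?N \<kappa>"
    by (simp add: dX density_distr o_def)
  also have "\<dots> = distr (density ?N (\<lambda>c. ennreal (\<rho> (e c)))) ?N (\<lambda>c. \<kappa> (e c))"
    by (simp add: distr_distr o_def)
  also have "\<dots> = distr (density ?N (\<lambda>c. ennreal (\<rho> (e c)))) ?N (\<lambda>c. c)"
  proof (rule distr_cong)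
    fix c assume "c \<in> space (density ?N (\<lambda>c. ennreal (\<rho> (e c))))"
    then have "c \<in> extensional {..<n}" by (simp add: space_PiM PiE_def)
    then show "\<kappa> (e c) = c" unfolding \<kappa>_def
      by (intro extensionalityI[of _ "{..<n}"]) (auto simp: ipe)
  qed auto
  also have "\<dots> = density ?N (\<lambda>c. ennreal (\<rho> (e c)))"
    by (rule distr_id2) simp
  finally have "distributed P ?N (\<lambda>\<omega>. \<kappa> (X \<omega>)) (\<lambda>c. ennreal (\<rho> (e c)))"
    unfolding distributed_def by auto
  moreover have "continuous_on UNIV (\<lambda>c. \<rho> (e c))"
    using continuous_map_compose[OF cont_e \<rho>] by (simp add: o_def)
  moreover have "X \<omega> = e (\<kappa> (X \<omega>))" if "\<omega> \<in> space P" for \<omega>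
    using ek XV that by simp
  ultimately show ?thesis
    using that[of b "\<lambda>\<omega>. \<kappa> (X \<omega>)"] eV e_surj e_norm unfolding e_def n_def by blast
qed

section \<open>Charts and tangent vectors\<close>

lemma Ck_on_Un:
  assumes "open S" "open T" "Ck_on r f S" "Ck_on r f T"
  shows "Ck_on r f (S \<union> T)"
  using assms(3,4)
proof (induction r arbitrary: f)
  case 0
  then show ?case using continuous_on_open_Un[OF assms(1,2)] by simp
qed auto

text \<open>The squared positive part is the building block of the bump function below. Class
  \<open>C^1\<close> is enough for it, as tangent vectors are tested on
  \<open>Ck_maps 1\<close>.\<close>

lemma sq_max_has_derivative:
  "((\<lambda>s::real. (max 0 s)\<^sup>2) has_real_derivative 2 * max 0 x) (at x)"
proof -
  let ?m = "\<lambda>s::real. (max 0 s)\<^sup>2"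
  have bound: "\<bar>?m y - ?m x - 2 * max 0 x * (y - x)\<bar> \<le> (y - x)\<^sup>2" for y
  proof -
    consider "0 \<le> x" "0 \<le> y" | "0 \<le> x" "y \<le> 0" | "x \<le> 0" "0 \<le> y" | "x \<le> 0" "y \<le> 0" by linarith
    then show ?thesis
    proof cases
      case 1
      then have "?m y - ?m x - 2 * max 0 x * (y - x) = (y - x)\<^sup>2"
        by (simp add: max_def power2_eq_square algebra_simps)
      then show ?thesis by simp
    next
      case 2
      then have eq: "?m y - ?m x - 2 * max 0 x * (y - x) = x\<^sup>2 - 2 * (x * y)"
        by (auto simp: max_def power2_eq_square algebra_simps)
      have "0 \<le> x\<^sup>2 - 2 * (x * y)" using mult_nonneg_nonpos[OF 2] zero_le_power2[of x] by linarith
      moreover have "x\<^sup>2 - 2 * (x * y) \<le> (y - x)\<^sup>2" by (simp add: power2_diff mult.commute)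
      ultimately show ?thesis unfolding eq by simp
    next
      case 3
      then have eq: "?m y - ?m x - 2 * max 0 x * (y - x) = y\<^sup>2"
        by (auto simp: max_def power2_eq_square algebra_simps)
      have "y\<^sup>2 \<le> (y - x)\<^sup>2" using 3 by (intro power_mono) auto
      then show ?thesis unfolding eq by simp
    next
      case 4
      then show ?thesis by (simp add: max_def)
    qed
  qed
  have "((\<lambda>y. (?m y - ?m x) / (y - x)) \<longlongrightarrow> 2 * max 0 x) (at x)"
  proof (rule LIM_zero_cancel, rule Lim_null_comparison)
    show "eventually (\<lambda>y. norm ((?m y - ?m x) / (y - x) - 2 * max 0 x) \<le> \<bar>y - x\<bar>) (at x)"
      unfolding eventually_at_filter
    proof (intro always_eventually allI impI)
      fix y assume "y \<noteq> x"
      then have "(?m y - ?m x) / (y - x) - 2 * max 0 x = (?m y - ?m x - 2 * max 0 x * (y - x)) / (y - x)"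
        by (simp add: field_simps)
      then have "norm ((?m y - ?m x) / (y - x) - 2 * max 0 x) \<le> (y - x)\<^sup>2 / \<bar>y - x\<bar>"
        using bound[of y] by (simp add: abs_divide divide_right_mono)
      also have "\<dots> = \<bar>y - x\<bar>" using \<open>y \<noteq> x\<close>
        by (simp add: power2_eq_square field_simps abs_mult_self_eq)
      finally show "norm ((?m y - ?m x) / (y - x) - 2 * max 0 x) \<le> \<bar>y - x\<bar>" .
    qed
    show "((\<lambda>y. \<bar>y - x\<bar>) \<longlongrightarrow> 0) (at x)" by (auto intro!: tendsto_eq_intros)
  qed
  then show ?thesis by (simp add: has_field_derivative_iff)
qed

lemma Ck_on_sq_max: "Ck_on 1 (\<lambda>s::real. (max 0 s)\<^sup>2) UNIV"
  unfolding One_nat_def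
proof (rule Ck_on_SucI)
  show "((\<lambda>s::real. (max 0 s)\<^sup>2) has_derivative (\<lambda>v. 2 * max 0 x * v)) (at x)" for x
    using sq_max_has_derivative[of x] by (simp add: has_field_derivative_def)
  show "Ck_on 0 (\<lambda>x. 2 * max 0 x * v) UNIV" for v :: real
    by (auto intro!: continuous_intros)
qed simp

lemma chart_facts:
  assumes "smooth_atlas A" "c \<in> A"
  shows chart_open: "open (fst c)" "open (snd c ` fst c)"
    and chart_homeomorphism: "homeomorphism (fst c) (snd c ` fst c) (snd c) (inv_into (fst c) (snd c))"
    and chart_inv: "\<And>q. q \<in> fst c \<Longrightarrow> inv_into (fst c) (snd c) (snd c q) = q"
    and local_rep_apply: "\<And>q f. q \<in> fst c \<Longrightarrow> local_rep c f (snd c q) = f q"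
proof -
  have "is_chart c" using assms by (auto simp: smooth_atlas_def)
  then show h: "open (fst c)" "open (snd c ` fst c)"
    "homeomorphism (fst c) (snd c ` fst c) (snd c) (inv_into (fst c) (snd c))"
    by (auto simp: is_chart_def)
  show i: "inv_into (fst c) (snd c) (snd c q) = q" if "q \<in> fst c" for q
    using h(3) that by (auto simp: homeomorphism_def)
  show "local_rep c f (snd c q) = f q" if "q \<in> fst c" for q and f :: "'a \<Rightarrow> 'c"
    using i[OF that] by (simp add: local_rep_def)
qed

lemma chart_open_image:
  assumes "smooth_atlas A" "c \<in> A" "open U" "U \<subseteq> fst c"
  shows "open (snd c ` U)"
proof -
  have "openin (top_of_set (snd c ` fst c)) (snd c ` U)"
    using homeomorphism_imp_open_map[OF chart_homeomorphism[OF assms(1,2)]] assms(3,4)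
    by (simp add: openin_open_eq chart_open[OF assms(1,2)] open_subset)
  then show ?thesis using chart_open(2)[OF assms(1,2)] by (simp add: openin_open_eq)
qed

lemma atlas_chart_ex: "smooth_atlas A \<Longrightarrow> \<exists>c\<in>A. p \<in> fst c"
  unfolding smooth_atlas_def by blast

lemma transition_smooth:
  "smooth_atlas A \<Longrightarrow> c \<in> A \<Longrightarrow> d \<in> A \<Longrightarrow> smooth_on (local_rep d (snd c)) (snd d ` (fst d \<inter> fst c))"
  unfolding smooth_atlas_def by blast

lemma chart_overlap_open:
  "smooth_atlas A \<Longrightarrow> c \<in> A \<Longrightarrow> d \<in> A \<Longrightarrow> open (snd d ` (fst d \<inter> fst c))"
  by (rule chart_open_image) (auto simp: chart_open)

lemma chart_tendsto:
  fixes A :: "('a::{t2_space, second_countable_topology}, 'e::euclidean_space) chart set"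
  assumes A: "smooth_atlas A" and c: "c \<in> A" "p \<in> fst c" and q: "(q \<longlongrightarrow> p) F"
    and k: "continuous_on (snd c ` fst c) k"
  shows "((\<lambda>l. k (snd c (q l))) \<longlongrightarrow> k (snd c p)) F"
proof -
  have "isCont k (snd c p)"
    using k chart_open(2)[OF A c(1)] c(2) by (simp add: continuous_on_eq_continuous_at)
  moreover have "isCont (snd c) p"
    using homeomorphism_cont1[OF chart_homeomorphism[OF A c(1)]] chart_open(1)[OF A c(1)] c(2)
    by (simp add: continuous_on_eq_continuous_at)
  ultimately show ?thesis
    using isCont_tendsto_compose[OF _ isCont_tendsto_compose[OF _ q]] by blast
qed

lemma Ck_maps_has_derivative:
  assumes "smooth_atlas A" "f \<in> Ck_maps 1 A" "c \<in> A" "p \<in> fst c"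
  shows "(local_rep c f has_derivative frechet_derivative (local_rep c f) (at (snd c p))) (at (snd c p))"
proof -
  have "Ck_on (Suc 0) (local_rep c f) (snd c ` fst c)" using assms by (simp add: Ck_maps_def)
  then show ?thesis by (rule Ck_on_SucD) (use assms in auto)
qed

lemma change_of_chart_derivative:
  fixes A :: "('a::{t2_space, second_countable_topology}, 'e::euclidean_space) chart set"
  assumes A: "smooth_atlas A" and f: "f \<in> Ck_maps 1 A" and c: "c \<in> A" "p \<in> fst c" and d: "d \<in> A" "p \<in> fst d"
  shows "frechet_derivative (local_rep d f) (at (snd d p)) v =
    frechet_derivative (local_rep c f) (at (snd c p))
      (frechet_derivative (local_rep d (snd c)) (at (snd d p)) v)"
proof -
  let ?W = "snd d ` (fst d \<inter> fst c)"
  have t: "(local_rep d (snd c) has_derivative frechet_derivative (local_rep d (snd c)) (at (snd d p))) (at (snd d p))"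
    using smooth_on_has_derivative[OF transition_smooth[OF A c(1) d(1)]] c d by auto
  have p: "local_rep d (snd c) (snd d p) = snd c p" by (rule local_rep_apply[OF A d])
  have "(local_rep c f has_derivative frechet_derivative (local_rep c f) (at (snd c p)))
      (at (local_rep d (snd c) (snd d p)))"
    unfolding p by (rule Ck_maps_has_derivative[OF A f c])
  from diff_chain_at[OF t this]
  have *: "(local_rep c f \<circ> local_rep d (snd c) has_derivative (\<lambda>v. frechet_derivative (local_rep c f) (at (snd c p))
      (frechet_derivative (local_rep d (snd c)) (at (snd d p)) v))) (at (snd d p))"
    by (simp add: o_def)
  have "(local_rep d f has_derivative (\<lambda>v. frechet_derivative (local_rep c f) (at (snd c p))
      (frechet_derivative (local_rep d (snd c)) (at (snd d p)) v))) (at (snd d p))"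
  proof (rule has_derivative_transform_within_open[OF * chart_overlap_open[OF A c(1) d(1)]])
    show "snd d p \<in> ?W" using c d by auto
    fix x assume "x \<in> ?W"
    then obtain q where "q \<in> fst d" "q \<in> fst c" "x = snd d q" by auto
    then show "(local_rep c f \<circ> local_rep d (snd c)) x = local_rep d f x"
      by (simp add: local_rep_apply[OF A c(1)] local_rep_apply[OF A d(1)])
  qed
  from frechet_derivative_at[OF this] show ?thesis by metis
qed

text \<open>The derivative of the change of charts converts components from one chart to another,
  and off \<open>Ck_maps 1\<close> both functionals are 0 by definition, so they agree as
  functions.\<close>

lemma tangent_space_chart:
  fixes A :: "('a::{t2_space, second_countable_topology}, 'e::euclidean_space) chart set"
  assumes A: "smooth_atlas A" and c: "c \<in> A" "p \<in> fst c"
  shows "tangent_space A p = range (coord_vector A c p)"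
proof
  show "range (coord_vector A c p) \<subseteq> tangent_space A p"
    using c unfolding tangent_space_def by blast
  show "tangent_space A p \<subseteq> range (coord_vector A c p)"
  proof
    fix t assume "t \<in> tangent_space A p"
    then obtain d e where d: "d \<in> A" "p \<in> fst d" "t = coord_vector A d p e"
      by (auto simp: tangent_space_def)
    have "t = coord_vector A c p (frechet_derivative (local_rep d (snd c)) (at (snd d p)) e)"
      unfolding d(3) coord_vector_def
      by (rule ext) (simp add: change_of_chart_derivative[OF A _ c d(1,2)])
    then show "t \<in> range (coord_vector A c p)" by blast
  qed
qed

lemma coord_vector_linear:
  fixes A :: "('a::{t2_space, second_countable_topology}, 'e::euclidean_space) chart set"
  assumes A: "smooth_atlas A" and c: "c \<in> A" "p \<in> fst c"
  shows "coord_vector A c p (u + v) = coord_vector A c p u + coord_vector A c p v"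
    "coord_vector A c p (t *\<^sub>R u) = t *\<^sub>R coord_vector A c p u"
proof -
  have l: "linear (frechet_derivative (local_rep c f) (at (snd c p)))" if "f \<in> Ck_maps 1 A" for f :: "'a \<Rightarrow> real"
    using Ck_maps_has_derivative[OF A that c] has_derivative_linear by blast
  show "coord_vector A c p (u + v) = coord_vector A c p u + coord_vector A c p v"
    by (rule ext) (simp add: coord_vector_def linear_add[OF l])
  show "coord_vector A c p (t *\<^sub>R u) = t *\<^sub>R coord_vector A c p u"
    by (rule ext) (simp add: coord_vector_def scaleR_fun_def linear_cmul[OF l])
qed

text \<open>A \<open>C\<^sup>1\<close> bump function, extended by zero from a chart, detects each coordinate vector;
  that the support is closed in the manifold uses the Hausdorff property.\<close>

lemma coord_vector_nonzero:
  fixes A :: "('a::{t2_space, second_countable_topology}, 'e::euclidean_space) chart set"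
  assumes A: "smooth_atlas A" and c: "c \<in> A" "p \<in> fst c" and e: "e \<noteq> 0"
  shows "coord_vector A c p e \<noteq> 0"
proof -
  define x0 where "x0 = snd c p"
  obtain r where r: "0 < r" "cball x0 r \<subseteq> snd c ` fst c"
    using open_contains_cball chart_open(2)[OF A c(1)] c(2) unfolding x0_def by blast
  define M where "M y = (max 0 (r\<^sup>2 - (y - x0) \<bullet> (y - x0)))\<^sup>2" for y :: 'e
  \<comment> \<open>The bump \<open>M\<close> times a linear form that vanishes at
    \<open>x0\<close>: in the product rule only \<open>M x0 * (v \<bullet> e)\<close> survives
    there, which is positive for \<open>v = e\<close>.\<close>
  define \<beta> where "\<beta> y = M y * ((y - x0) \<bullet> e)" for y
  define f where "f q = (if q \<in> fst c then \<beta> (snd c q) else 0)" for q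
  have lin: "Ck_on r (\<lambda>y. (y - x0) \<bullet> v) UNIV" for r and v :: 'e
    by (intro Ck_on_bounded_linear[OF open_UNIV bounded_linear_inner_left] Ck_on_diff[OF open_UNIV] Ck_on_const
        Ck_on_linear[OF open_UNIV bounded_linear_ident])
  have "Ck_on 1 (\<lambda>y. r\<^sup>2 - (\<Sum>b\<in>Basis. ((y - x0) \<bullet> b) * ((y - x0) \<bullet> b))) UNIV"
    by (intro Ck_on_diff Ck_on_sum Ck_on_mult lin Ck_on_const open_UNIV)
  then have "Ck_on 1 (\<lambda>y. r\<^sup>2 - (y - x0) \<bullet> (y - x0)) UNIV"
    by (subst (asm) euclidean_inner[of "_ - x0" "_ - x0", symmetric])
  from Ck_on_compose[OF open_UNIV open_UNIV this _ Ck_on_sq_max]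
  have CM: "Ck_on 1 M UNIV" unfolding M_def[abs_def] by simp
  then have C\<beta>: "Ck_on 1 \<beta> UNIV" unfolding \<beta>_def[abs_def] by (intro Ck_on_mult lin open_UNIV)
  have M0: "M y = 0" if "y \<notin> cball x0 r" for y
  proof -
    have "r < norm (y - x0)" using that by (simp add: dist_norm norm_minus_commute)
    then have "r\<^sup>2 \<le> (norm (y - x0))\<^sup>2" using r(1) by (intro power_mono) auto
    then show ?thesis by (simp add: M_def power2_norm_eq_inner)
  qed
  define K where "K = inv_into (fst c) (snd c) ` cball x0 r"
  have K: "K \<subseteq> fst c" unfolding K_def
    using r(2) by (auto intro: inv_into_into)
  have "continuous_on (cball x0 r) (inv_into (fst c) (snd c))"
    by (rule continuous_on_subset[OF homeomorphism_cont2[OF chart_homeomorphism[OF A c(1)]] r(2)])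
  then have "compact K" unfolding K_def by (rule compact_continuous_image) simp
  then have clK: "closed K" by (rule compact_imp_closed)
  have f0: "f q = 0" if "q \<notin> K" for q
  proof (cases "q \<in> fst c")
    case True
    then have "snd c q \<notin> cball x0 r" using that chart_inv[OF A c(1) True] unfolding K_def by (metis image_eqI)
    then show ?thesis using M0 by (simp add: f_def \<beta>_def)
  qed (simp add: f_def)
  have "Ck_on 1 (local_rep d f) (snd d ` fst d)" if d: "d \<in> A" for d
  proof -
    \<comment> \<open>Two open sets cover the domain of every chart: on the overlap with
      \<open>c\<close> the function is a composite of \<open>C^1\<close> maps, and off the closed
      set \<open>K\<close> it is 0.\<close>
    let ?W1 = "snd d ` (fst d \<inter> fst c)" and ?W2 = "snd d ` (fst d - K)"
    have o1: "open ?W1" by (rule chart_overlap_open[OF A c(1) d])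
    have o2: "open ?W2" by (rule chart_open_image[OF A d]) (auto simp: clK chart_open[OF A d])
    have "Ck_on 1 (local_rep d (snd c)) ?W1"
      using transition_smooth[OF A c(1) d] by (simp add: smooth_on_def)
    from Ck_on_compose[OF o1 open_UNIV this _ C\<beta>]
    have "Ck_on 1 (\<lambda>x. \<beta> (local_rep d (snd c) x)) ?W1" by simp
    then have 1: "Ck_on 1 (local_rep d f) ?W1"
    proof (rule Ck_on_cong[OF o1, rotated])
      fix x assume "x \<in> ?W1"
      then obtain q where "q \<in> fst d" "q \<in> fst c" "x = snd d q" by auto
      then show "\<beta> (local_rep d (snd c) x) = local_rep d f x"
        by (simp add: f_def local_rep_apply[OF A d])
    qed
    have 2: "Ck_on 1 (local_rep d f) ?W2"
    proof (rule Ck_on_cong[OF o2 _ Ck_on_const[of 1 0]])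
      fix x assume "x \<in> ?W2"
      then obtain q where "q \<in> fst d" "q \<notin> K" "x = snd d q" by auto
      then show "0 = local_rep d f x" by (simp add: local_rep_apply[OF A d] f0)
    qed
    have "snd d ` fst d = ?W1 \<union> ?W2" using K by blast
    then show ?thesis using Ck_on_Un[OF o1 o2 1 2] by simp
  qed
  then have fC: "f \<in> Ck_maps 1 A" by (simp add: Ck_maps_def)
  have Md: "(M has_derivative frechet_derivative M (at x0)) (at x0)"
    using Ck_on_SucD(1)[of 0 M UNIV x0] CM by simp
  have "(\<beta> has_derivative (\<lambda>v. M x0 * (v \<bullet> e) + frechet_derivative M (at x0) v * ((x0 - x0) \<bullet> e))) (at x0)"
    unfolding \<beta>_def[abs_def]
    by (rule has_derivative_mult[OF Md]) (auto intro!: derivative_eq_intros)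
  then have *: "(\<beta> has_derivative (\<lambda>v. M x0 * (v \<bullet> e))) (at x0)" by simp
  have **: "(local_rep c f has_derivative (\<lambda>v. M x0 * (v \<bullet> e))) (at x0)"
    by (rule has_derivative_transform_within_open[OF * chart_open(2)[OF A c(1)]])
      (use c(2) in \<open>auto simp: x0_def f_def local_rep_apply[OF A c(1)]\<close>)
  then have "coord_vector A c p e f = M x0 * (e \<bullet> e)"
    using fC unfolding coord_vector_def x0_def[symmetric] frechet_derivative_at[OF **, symmetric] by simp
  moreover have "M x0 > 0" using r(1) by (simp add: M_def)
  ultimately have "coord_vector A c p e f \<noteq> 0" using e by simp
  then show ?thesis by auto
qed

lemma component_Ck_maps:
  fixes f :: "'a::{t2_space, second_countable_topology} \<Rightarrow> real ^ 'k"
  assumes A: "smooth_atlas A" and f: "f \<in> Ck_maps r A"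
  shows "(\<lambda>q. f q $ i) \<in> Ck_maps r A"
proof -
  have "Ck_on r (\<lambda>x. local_rep c f x $ i) (snd c ` fst c)" if "c \<in> A" for c
    using f that by (intro Ck_on_bounded_linear[OF chart_open(2)[OF A that] bounded_linear_vec_nth])
      (auto simp: Ck_maps_def)
  then show ?thesis by (auto simp: Ck_maps_def local_rep_def o_def)
qed

lemma differential_coord_vector:
  fixes f :: "'a::{t2_space, second_countable_topology} \<Rightarrow> real ^ 'k" and c :: "('a, 'e::euclidean_space) chart"
  assumes A: "smooth_atlas A" and f: "f \<in> Ck_maps 1 A" and c: "c \<in> A" "p \<in> fst c"
  shows "differential f (coord_vector A c p v) = frechet_derivative (local_rep c f) (at (snd c p)) v"
proof -
  have "coord_vector A c p v (\<lambda>q. f q $ i) = frechet_derivative (local_rep c f) (at (snd c p)) v $ i" for i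
  proof -
    have "(local_rep c (\<lambda>q. f q $ i) has_derivative
       (\<lambda>v. frechet_derivative (local_rep c f) (at (snd c p)) v $ i)) (at (snd c p))"
      using bounded_linear.has_derivative[OF bounded_linear_vec_nth Ck_maps_has_derivative[OF A f c]]
      by (simp add: local_rep_def o_def)
    from fun_cong[OF frechet_derivative_at[OF this], of v]
    show ?thesis using component_Ck_maps[OF A f] by (simp add: coord_vector_def)
  qed
  then show ?thesis by (simp add: differential_def vec_eq_iff)
qed

lemma smooth_maps_Ck_maps: "f \<in> smooth_maps A \<Longrightarrow> f \<in> Ck_maps r A"
  by (auto simp: smooth_maps_def Ck_maps_def smooth_on_def)

section \<open>Inverses of positive definite operators and the Jacobian\<close>

lemma positive_definite_bij:
  fixes T :: "'v::euclidean_space \<Rightarrow> 'v"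
  assumes "linear T" "\<And>v. v \<noteq> 0 \<Longrightarrow> 0 < T v \<bullet> v"
  shows "bij T"
proof -
  have "inj T" unfolding linear_injective_0[OF assms(1)]
    using assms(2) by (metis inner_zero_left less_irrefl)
  then show ?thesis
    using linear_injective_imp_surjective[OF assms(1)] by (simp add: bij_def)
qed

lemma positive_definite_inverse:
  fixes T :: "'v::euclidean_space \<Rightarrow> 'v"
  assumes "linear T" "\<And>v. v \<noteq> 0 \<Longrightarrow> 0 < T v \<bullet> v"
  shows "T (inv T v) = v" "inv T (T v) = v" "linear (inv T)"
proof -
  note b = positive_definite_bij[OF assms]
  then show "T (inv T v) = v" "inv T (T v) = v"
    by (simp_all add: bij_is_surj bij_is_inj surj_f_inv_f)
  show "linear (inv T)" using inj_linear_imp_inv_linear[OF assms(1) bij_is_inj[OF b]] .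
qed

text \<open>Pointwise convergence of linear maps on a finite-dimensional space is uniform on the
  unit ball, because it is so on a basis. An error below half of the lower bound for
  \<open>T0\<close> leaves the other half to the nearby maps.\<close>

lemma coercive_family:
  fixes T :: "'i \<Rightarrow> 'v::euclidean_space \<Rightarrow> 'w::euclidean_space"
  assumes lin: "eventually (\<lambda>i. linear (T i)) F" and lin0: "linear T0" "inj T0"
    and lim: "\<And>v. ((\<lambda>i. T i v) \<longlongrightarrow> T0 v) F"
  shows "\<exists>a>0. eventually (\<lambda>i. \<forall>v. a * norm v \<le> norm (T i v)) F"
proof -
  obtain B where B: "0 < B" "\<And>v. B * norm v \<le> norm (T0 v)"
    using linear_inj_bounded_below_pos[OF lin0] by blast
  define a where "a = B / 2"
  have a: "0 < a" using B by (simp add: a_def)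
  have co: "2 * a * norm v \<le> norm (T0 v)" for v using B(2) by (simp add: a_def)
  have "((\<lambda>i. \<Sum>b\<in>Basis. norm (T i b - T0 b)) \<longlongrightarrow> (\<Sum>b\<in>(Basis::'v set). norm (T0 b - T0 b))) F"
    by (intro tendsto_intros lim)
  then have "eventually (\<lambda>i. (\<Sum>b\<in>Basis. norm (T i b - T0 b)) < a) F"
    using a by (intro order_tendstoD(2)) auto
  then have "eventually (\<lambda>i. \<forall>v. a * norm v \<le> norm (T i v)) F"
    using lin
  proof eventually_elim
    case (elim i)
    show ?case
    proof
      fix v
      let ?L = "\<lambda>v. T i v - T0 v"
      have L: "linear ?L" using elim(2) lin0(1) by (rule linear_compose_sub)
      have "?L v = (\<Sum>b\<in>Basis. (v \<bullet> b) *\<^sub>R ?L b)"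
      proof -
        have "?L v = ?L (\<Sum>b\<in>Basis. (v \<bullet> b) *\<^sub>R b)" by (simp only: euclidean_representation)
        also have "\<dots> = (\<Sum>b\<in>Basis. ?L ((v \<bullet> b) *\<^sub>R b))" by (rule linear_sum[OF L])
        also have "\<dots> = (\<Sum>b\<in>Basis. (v \<bullet> b) *\<^sub>R ?L b)" by (intro sum.cong refl linear_cmul[OF L])
        finally show ?thesis .
      qed
      then have "norm (?L v) \<le> (\<Sum>b\<in>Basis. norm ((v \<bullet> b) *\<^sub>R ?L b))" by (simp only: norm_sum)
      also have "\<dots> \<le> (\<Sum>b\<in>Basis. norm v * norm (?L b))"
        by (intro sum_mono) (simp add: Basis_le_norm mult_right_mono)
      also have "\<dots> \<le> norm v * a"
        using elim(1) by (simp add: sum_distrib_left[symmetric] mult_left_mono)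
      finally have 1: "norm (?L v) \<le> norm v * a" .
      have "norm (T0 v) \<le> norm (T i v) + norm (?L v)"
        using norm_triangle_ineq4[of "T i v" "?L v"] by simp
      then show "a * norm v \<le> norm (T i v)" using co[of v] 1 by (simp add: algebra_simps)
    qed
  qed
  then show ?thesis using a by blast
qed

text \<open>The distance of \<open>inv (T i) (y i)\<close> from its limit is the norm of
  \<open>inv (T i)\<close> applied to \<open>y i - T i (inv T0 y0)\<close>. This argument tends to
  0, and coercivity bounds the inverses uniformly, so no formula for the inverses is
  involved.\<close>

lemma tendsto_inverse_operator:
  fixes T :: "'i \<Rightarrow> 'v::euclidean_space \<Rightarrow> 'v"
  assumes lin: "eventually (\<lambda>i. linear (T i) \<and> (\<forall>v. v \<noteq> 0 \<longrightarrow> 0 < T i v \<bullet> v)) F" and lin0: "linear T0"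
    and pos: "\<And>v. v \<noteq> 0 \<Longrightarrow> 0 < T0 v \<bullet> v"
    and lim: "\<And>v. ((\<lambda>i. T i v) \<longlongrightarrow> T0 v) F"
  shows "(y \<longlongrightarrow> y0) F \<Longrightarrow> ((\<lambda>i. inv (T i) (y i)) \<longlongrightarrow> inv T0 y0) F"
    "\<exists>C>0. eventually (\<lambda>i. \<forall>v. norm (inv (T i) v) \<le> C * norm v) F"
proof -
  have "eventually (\<lambda>i. linear (T i)) F" using lin by eventually_elim simp
  from coercive_family[OF this lin0 bij_is_inj[OF positive_definite_bij[OF lin0 pos]] lim] obtain a where a: "0 < a"
    "eventually (\<lambda>i. \<forall>v. a * norm v \<le> norm (T i v)) F" by blast
  have bd: "eventually (\<lambda>i. \<forall>v. norm (inv (T i) v) \<le> 1 / a * norm v) F"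
    using a(2) lin
  proof eventually_elim
    case (elim i)
    show ?case
    proof
      fix v
      have "a * norm (inv (T i) v) \<le> norm v"
        using elim(1)[rule_format, of "inv (T i) v"] positive_definite_inverse(1)[of "T i" v] elim(2) by auto
      then show "norm (inv (T i) v) \<le> 1 / a * norm v" using a(1) by (simp add: field_simps)
    qed
  qed
  then show "\<exists>C>0. eventually (\<lambda>i. \<forall>v. norm (inv (T i) v) \<le> C * norm v) F"
    using a(1) by (intro exI[of _ "1 / a"]) auto
  assume y: "(y \<longlongrightarrow> y0) F"
  let ?z = "inv T0 y0"
  have z: "T0 ?z = y0" using positive_definite_inverse(1)[OF lin0 pos] .
  show "((\<lambda>i. inv (T i) (y i)) \<longlongrightarrow> ?z) F"
  proof (rule LIM_zero_cancel, rule Lim_null_comparison)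
    show "eventually (\<lambda>i. norm (inv (T i) (y i) - ?z) \<le> 1 / a * norm (y i - T i ?z)) F"
      using bd lin
    proof eventually_elim
      case (elim i)
      have "inv (T i) (y i - T i ?z) = inv (T i) (y i) - ?z"
        using positive_definite_inverse(2,3)[of "T i"] elim(2) by (auto simp: linear_diff)
      then show ?case using elim(1)[rule_format, of "y i - T i ?z"] by simp
    qed
    have "((\<lambda>i. 1 / a * norm (y i - T i ?z)) \<longlongrightarrow> 1 / a * norm (y0 - T0 ?z)) F"
      by (intro tendsto_intros y lim)
    then show "((\<lambda>i. 1 / a * norm (y i - T i ?z)) \<longlongrightarrow> 0) F" by (simp add: z)
  qed
qed

section \<open>The Jacobian in coordinates\<close>

definition metric_operator ::
    "('a, 'e::euclidean_space) chart set \<Rightarrow>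
     ('a \<Rightarrow> (('a \<Rightarrow> real) \<Rightarrow> real) \<Rightarrow> (('a \<Rightarrow> real) \<Rightarrow> real) \<Rightarrow> real) \<Rightarrow>
     ('a, 'e) chart \<Rightarrow> 'a \<Rightarrow> 'e \<Rightarrow> 'e" where
  "metric_operator A g c p u =
     (\<Sum>b\<in>Basis. g p (coord_vector A c p u) (coord_vector A c p b) *\<^sub>R b)"

text \<open>The Euclidean gradient of a component in the chart. \<open>metric_operator\<close>, the
  matrix of \<open>g\<close> in the chart, maps the coordinates of the Riemannian gradient to
  it.\<close>

definition chart_gradient ::
    "('a, 'e::euclidean_space) chart \<Rightarrow> 'a \<Rightarrow> ('a \<Rightarrow> real ^ 'k) \<Rightarrow> 'k \<Rightarrow> 'e" where
  "chart_gradient c p f i =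
     (\<Sum>b\<in>Basis. (frechet_derivative (local_rep c f) (at (snd c p)) b $ i) *\<^sub>R b)"

text \<open>Positivity of \<open>g p\<close> concerns nonzero functionals. It becomes positivity on
  nonzero coordinates because, by \<open>coord_vector_nonzero\<close>, no nonzero coordinate vector
  represents the zero functional.\<close>

lemma riemannian_metric_coord:
  fixes A :: "('a::{t2_space, second_countable_topology}, 'e::euclidean_space) chart set"
  assumes A: "smooth_atlas A" and g: "riemannian_metric A g" and c: "c \<in> A" "p \<in> fst c"
  shows "metric_operator A g c p u \<bullet> v = g p (coord_vector A c p u) (coord_vector A c p v)"
    "linear (metric_operator A g c p)"
    "v \<noteq> 0 \<Longrightarrow> 0 < metric_operator A g c p v \<bullet> v"
proof -
  let ?t = "coord_vector A c p"
  have sp: "scalar_product_on (range ?t) (g p)"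
    using g unfolding riemannian_metric_def tangent_space_chart[OF A c, symmetric] by blast
  note D = scalar_product_onD[OF sp]
  have l: "linear ?t"
    by (rule linearI) (simp_all add: coord_vector_linear[OF A c])
  have V: "subspace (range ?t)" using linear_subspace_image[OF l subspace_UNIV] .
  show 1: "metric_operator A g c p u \<bullet> v = g p (?t u) (?t v)" for u v
  proof -
    have "g p (?t v) (?t u) = g p (\<Sum>b\<in>Basis. (v \<bullet> b) *\<^sub>R ?t b) (?t u)"
      by (subst (1) euclidean_representation[of v, symmetric]) (simp add: linear_sum[OF l] linear_cmul[OF l])
    also have "\<dots> = (\<Sum>b\<in>Basis. (v \<bullet> b) * g p (?t b) (?t u))"
      by (rule scalar_product_on_sum[OF sp V]) auto
    also have "\<dots> = (\<Sum>b\<in>Basis. (v \<bullet> b) * g p (?t u) (?t b))"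
      using D(1) by (intro sum.cong) auto
    also have "\<dots> = metric_operator A g c p u \<bullet> v"
      by (simp add: metric_operator_def inner_sum_left inner_commute[of v] mult.commute)
    finally show ?thesis using D(1) by auto
  qed
  show "linear (metric_operator A g c p)"
    by (rule linearI) (simp_all add: metric_operator_def coord_vector_linear[OF A c] D(2,3)
        scaleR_left_distrib sum.distrib scaleR_sum_right)
  show "0 < metric_operator A g c p v \<bullet> v" if "v \<noteq> 0"
    unfolding 1 using D(4)[of "?t v"] coord_vector_nonzero[OF A c that] by auto
qed

text \<open>The Riesz representative of a component of the differential is its Riemannian gradient,
  whose coordinates are the inverse metric operator applied to the Euclidean gradient. In this form
  the Jacobian is explicit in finitely many derivatives, in a chart that may be kept fixed while
  \<open>p\<close> moves.\<close>

lemma jacobian_chart: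
  fixes A :: "('a::{t2_space, second_countable_topology}, 'e::euclidean_space) chart set"
    and f :: "'a \<Rightarrow> real ^ 'k"
  assumes A: "smooth_atlas A" and g: "riemannian_metric A g" and c: "c \<in> A" "p \<in> fst c"
    and f: "f \<in> Ck_maps 1 A"
  shows "jacobian A g p f =
    sqrt (det (\<chi> i j. inv (metric_operator A g c p) (chart_gradient c p f j) \<bullet> chart_gradient c p f i))"
proof -
  let ?t = "coord_vector A c p" and ?G = "metric_operator A g c p"
  note G = riemannian_metric_coord[OF A g c]
  have inv: "?G (inv ?G v) = v" for v by (rule positive_definite_inverse(1)[OF G(2,3)])
  have lf: "linear (frechet_derivative (local_rep c f) (at (snd c p)))"
    using Ck_maps_has_derivative[OF A f c] has_derivative_linear by blast
  have df: "differential f (?t v) $ i = chart_gradient c p f i \<bullet> v" for v i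
  proof -
    have "frechet_derivative (local_rep c f) (at (snd c p)) v =
       frechet_derivative (local_rep c f) (at (snd c p)) (\<Sum>b\<in>Basis. (v \<bullet> b) *\<^sub>R b)"
      by (simp add: euclidean_representation)
    then show ?thesis unfolding differential_coord_vector[OF A f c]
      by (simp add: chart_gradient_def linear_sum[OF lf] linear_cmul[OF lf] inner_sum_left
          inner_commute[of v] mult.commute)
  qed
  have r: "riesz (range ?t) (g p) (\<lambda>v. differential f v $ i) = ?t (inv ?G (chart_gradient c p f i))" for i
    unfolding riesz_def
  proof (rule the_equality)
    let ?u = "inv ?G (chart_gradient c p f i)"
    show "?t ?u \<in> range ?t \<and> (\<forall>v\<in>range ?t. g p (?t ?u) v = differential f v $ i)"
      by (auto simp: G(1)[symmetric] df inv)
    fix w assume w: "w \<in> range ?t \<and> (\<forall>v\<in>range ?t. g p w v = differential f v $ i)"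
    then obtain u where u: "w = ?t u" by auto
    have "?G u \<bullet> v = chart_gradient c p f i \<bullet> v" for v
      using w unfolding u by (auto simp: G(1) df)
    then have "?G u = chart_gradient c p f i" by (metis vector_eq_rdot)
    then show "w = ?t ?u" using positive_definite_inverse(2)[OF G(2,3), of u] u by simp
  qed
  show ?thesis
    unfolding jacobian_def wedge_norm_def dual_ip_def tangent_space_chart[OF A c] r
    by (simp add: G(1)[symmetric] inv inner_commute)
qed

lemma metric_operator_tendsto:
  fixes A :: "('a::{t2_space, second_countable_topology}, 'e::euclidean_space) chart set"
  assumes A: "smooth_atlas A" and g: "riemannian_metric A g" and c: "c \<in> A" "p \<in> fst c"
    and q: "(q \<longlongrightarrow> p) F"
  shows "((\<lambda>i. metric_operator A g c (q i) v) \<longlongrightarrow> metric_operator A g c p v) F"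
  unfolding metric_operator_def
proof (intro tendsto_intros)
  fix b :: 'e
  let ?h = "\<lambda>p. g p (coord_vector A c p v) (coord_vector A c p b)"
  have "continuous_on (snd c ` fst c) (local_rep c ?h)"
    using g c by (intro smooth_on_imp_continuous_on) (simp add: riemannian_metric_def)
  note chart_tendsto[OF A c q this]
  moreover have "eventually (\<lambda>i. q i \<in> fst c) F"
    using q c(2) chart_open(1)[OF A c(1)] by (simp add: topological_tendstoD)
  then have "eventually (\<lambda>i. local_rep c ?h (snd c (q i)) = ?h (q i)) F"
    by eventually_elim (simp add: local_rep_apply[OF A c(1)])
  ultimately show "((\<lambda>i. ?h (q i)) \<longlongrightarrow> ?h p) F"
    using local_rep_apply[OF A c, of ?h] by (simp add: tendsto_cong)
qed

lemma jacobian_tendsto: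
  fixes A :: "('a::{t2_space, second_countable_topology}, 'e::euclidean_space) chart set"
    and f :: "'i \<Rightarrow> 'a \<Rightarrow> real ^ 'k"
  assumes A: "smooth_atlas A" and g: "riemannian_metric A g" and c: "c \<in> A" "p \<in> fst c"
    and q: "(q \<longlongrightarrow> p) F" and f: "\<And>i. f i \<in> Ck_maps 1 A" "f0 \<in> Ck_maps 1 A"
    and df: "\<And>b. b \<in> Basis \<Longrightarrow> ((\<lambda>i. frechet_derivative (local_rep c (f i)) (at (snd c (q i))) b) \<longlongrightarrow>
      frechet_derivative (local_rep c f0) (at (snd c p)) b) F"
  shows "((\<lambda>i. jacobian A g (q i) (f i)) \<longlongrightarrow> jacobian A g p f0) F"
proof -
  let ?G = "metric_operator A g c"
  have ev: "eventually (\<lambda>i. q i \<in> fst c) F"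
    using q c(2) chart_open(1)[OF A c(1)] by (simp add: topological_tendstoD)
  have grad: "((\<lambda>i. chart_gradient c (q i) (f i) j) \<longlongrightarrow> chart_gradient c p f0 j) F" for j
    unfolding chart_gradient_def by (intro tendsto_intros df)
  have lin: "eventually (\<lambda>i. linear (?G (q i)) \<and> (\<forall>v. v \<noteq> 0 \<longrightarrow> 0 < ?G (q i) v \<bullet> v)) F"
    using ev by eventually_elim (use riemannian_metric_coord[OF A g c(1)] in blast)
  have "((\<lambda>i. inv (?G (q i)) (chart_gradient c (q i) (f i) j)) \<longlongrightarrow> inv (?G p) (chart_gradient c p f0 j)) F" for j
    by (rule tendsto_inverse_operator(1)[OF lin riemannian_metric_coord(2,3)[OF A g c]
        metric_operator_tendsto[OF A g c q] grad])
  then have "((\<lambda>i. sqrt (det (\<chi> l j. inv (?G (q i)) (chart_gradient c (q i) (f i) j) \<bullet> chart_gradient c (q i) (f i) l)))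
    \<longlongrightarrow> sqrt (det (\<chi> l j. inv (?G p) (chart_gradient c p f0 j) \<bullet> chart_gradient c p f0 l))) F"
    unfolding det_def by (simp, intro tendsto_intros grad)
  moreover have "eventually (\<lambda>i. sqrt (det (\<chi> l j. inv (?G (q i)) (chart_gradient c (q i) (f i) j) \<bullet>
      chart_gradient c (q i) (f i) l)) = jacobian A g (q i) (f i)) F"
    using ev by eventually_elim (simp add: jacobian_chart[OF A g c(1) _ f(1)])
  ultimately show ?thesis unfolding jacobian_chart[OF A g c f(2)] by (rule Lim_transform_eventually)
qed

lemma abs_det_le:
  fixes M :: "real ^ 'k ^ 'k"
  assumes "\<And>i j. \<bar>M $ i $ j\<bar> \<le> m"
  shows "\<bar>det M\<bar> \<le> fact CARD('k) * m ^ CARD('k)"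
proof -
  have m: "0 \<le> m" using assms[of undefined undefined] by linarith
  have "\<bar>det M\<bar> \<le> (\<Sum>p\<in>{p. p permutes (UNIV :: 'k set)}. \<bar>of_int (sign p) * (\<Prod>i\<in>UNIV. M $ i $ p i)\<bar>)"
    unfolding det_def by (rule sum_abs)
  also have "\<dots> \<le> (\<Sum>p\<in>{p. p permutes (UNIV :: 'k set)}. m ^ CARD('k))"
  proof (intro sum_mono)
    fix p :: "'k \<Rightarrow> 'k"
    have "\<bar>of_int (sign p) * (\<Prod>i\<in>UNIV. M $ i $ p i)\<bar> = (\<Prod>i\<in>UNIV. \<bar>M $ i $ p i\<bar>)"
      by (simp add: abs_mult sign_def abs_prod)
    also have "\<dots> \<le> (\<Prod>i\<in>(UNIV::'k set). m)" by (intro prod_mono) (auto simp: assms)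
    finally show "\<bar>of_int (sign p) * (\<Prod>i\<in>UNIV. M $ i $ p i)\<bar> \<le> m ^ CARD('k)" by simp
  qed
  also have "\<dots> = fact CARD('k) * m ^ CARD('k)"
    using card_permutations[of "UNIV :: 'k set" "CARD('k)"] by simp
  finally show ?thesis .
qed

text \<open>Gram entries are quadratic in the derivatives, their determinant has degree 2k and its
  square root degree k. One constant serves a neighbourhood of \<open>p\<close> because the inverse
  metric operators are uniformly bounded there.\<close>

lemma jacobian_bound:
  fixes A :: "('a::{t2_space, second_countable_topology}, 'e::euclidean_space) chart set"
  assumes A: "smooth_atlas A" and g: "riemannian_metric A g" and c: "c \<in> A" "p \<in> fst c"
  shows "\<exists>C\<ge>0. eventually (\<lambda>q. \<forall>(f :: 'a \<Rightarrow> real ^ 'k) m. f \<in> Ck_maps 1 A \<longrightarrow>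
     (\<forall>b\<in>Basis. norm (frechet_derivative (local_rep c f) (at (snd c q)) b) \<le> m) \<longrightarrow>
     jacobian A g q f \<le> C * m ^ CARD('k)) (nhds p)"
proof -
  let ?G = "metric_operator A g c" and ?D = "real DIM('e)" and ?k = "CARD('k)"
  have id: "((\<lambda>q. q) \<longlongrightarrow> p) (nhds p)" by (simp add: filterlim_ident)
  have ev: "eventually (\<lambda>q. q \<in> fst c) (nhds p)"
    using eventually_nhds_in_open[OF chart_open(1)[OF A c(1)] c(2)] .
  have lin: "eventually (\<lambda>q. linear (?G q) \<and> (\<forall>v. v \<noteq> 0 \<longrightarrow> 0 < ?G q v \<bullet> v)) (nhds p)"
    using ev by eventually_elim (use riemannian_metric_coord[OF A g c(1)] in blast)
  obtain C where C: "0 < C" "eventually (\<lambda>q. \<forall>v. norm (inv (?G q) v) \<le> C * norm v) (nhds p)"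
    using tendsto_inverse_operator(2)[OF lin riemannian_metric_coord(2,3)[OF A g c]
        metric_operator_tendsto[OF A g c id]] by blast
  \<comment> \<open>Gradients are at most \<open>?D * m\<close> and inverse metric operators at most
    \<open>C\<close>, so the entries are at most \<open>C * ?D\<^sup>2 * m\<^sup>2\<close>; the
    factorial counts the terms of the Leibniz formula.\<close>
  define K where "K = sqrt (fact ?k * (C * ?D\<^sup>2) ^ ?k)"
  have "eventually (\<lambda>q. \<forall>(f :: 'a \<Rightarrow> real ^ 'k) m. f \<in> Ck_maps 1 A \<longrightarrow>
     (\<forall>b\<in>Basis. norm (frechet_derivative (local_rep c f) (at (snd c q)) b) \<le> m) \<longrightarrow>
     jacobian A g q f \<le> K * m ^ CARD('k)) (nhds p)"
    using C(2) ev
  proof eventually_elim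
    case (elim q)
    show ?case
    proof (intro allI impI)
      fix f :: "'a \<Rightarrow> real ^ 'k" and m :: real
      assume f: "f \<in> Ck_maps 1 A"
        and m: "\<forall>b\<in>Basis. norm (frechet_derivative (local_rep c f) (at (snd c q)) b) \<le> m"
      have m0: "0 \<le> m" using m SOME_Basis norm_ge_zero order_trans by blast
      have gr: "norm (chart_gradient c q f i) \<le> ?D * m" for i
      proof -
        have "norm (chart_gradient c q f i) \<le> (\<Sum>b\<in>(Basis::'e set). m)"
          unfolding chart_gradient_def
        proof (rule sum_norm_le)
          fix b :: 'e assume b: "b \<in> Basis"
          show "norm (frechet_derivative (local_rep c f) (at (snd c q)) b $ i *\<^sub>R b) \<le> m"
            using m b component_le_norm_cart[of "frechet_derivative (local_rep c f) (at (snd c q)) b" i]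
            by force
        qed
        then show ?thesis by simp
      qed
      have "\<bar>inv (?G q) (chart_gradient c q f i) \<bullet> chart_gradient c q f j\<bar> \<le> C * ?D\<^sup>2 * m\<^sup>2" for i j
      proof -
        have "\<bar>inv (?G q) (chart_gradient c q f i) \<bullet> chart_gradient c q f j\<bar> \<le>
            norm (inv (?G q) (chart_gradient c q f i)) * norm (chart_gradient c q f j)"
          by (rule Cauchy_Schwarz_ineq2)
        also have "\<dots> \<le> (C * (?D * m)) * (?D * m)"
        proof (intro mult_mono gr)
          show "norm (inv (?G q) (chart_gradient c q f i)) \<le> C * (?D * m)"
            using elim(1)[rule_format, of "chart_gradient c q f i"] gr[of i] C(1)
            by (meson mult_left_mono less_imp_le order_trans)
        qed (use C(1) m0 in auto)
        finally show ?thesis by (simp add: power2_eq_square mult_ac)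
      qed
      then have "\<bar>det (\<chi> i j. inv (?G q) (chart_gradient c q f j) \<bullet> chart_gradient c q f i)\<bar> \<le>
          fact ?k * (C * ?D\<^sup>2 * m\<^sup>2) ^ ?k"
        by (intro abs_det_le) simp
      then have "det (\<chi> i j. inv (?G q) (chart_gradient c q f j) \<bullet> chart_gradient c q f i) \<le>
          fact ?k * (C * ?D\<^sup>2) ^ ?k * (m ^ ?k)\<^sup>2"
        by (simp add: power_mult_distrib power_mult[symmetric] mult_ac)
      then have "jacobian A g q f \<le> sqrt (fact ?k * (C * ?D\<^sup>2) ^ ?k * (m ^ ?k)\<^sup>2)"
        unfolding jacobian_chart[OF A g c(1) elim(2) f] by (rule real_sqrt_le_mono)
      then show "jacobian A g q f \<le> K * m ^ ?k" using m0 by (simp add: real_sqrt_mult K_def)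
    qed
  qed
  moreover have "0 \<le> K" unfolding K_def using C(1) by simp
  ultimately show ?thesis by blast
qed

section \<open>Linear combinations as elements of the Whitney space\<close>

definition lin_comb :: "nat \<Rightarrow> (nat \<Rightarrow> 'v::real_vector) \<Rightarrow> (nat \<Rightarrow> real) \<Rightarrow> 'v" where
  "lin_comb n b c = (\<Sum>i<n. c i *\<^sub>R b i)"

lemma lin_comb_apply: "lin_comb n b c q = (\<Sum>i<n. c i *\<^sub>R b i q)"
  unfolding lin_comb_def by (induction n) (auto simp: scaleR_fun_def)

lemma local_rep_lin_comb:
  "local_rep c (lin_comb n b z) = (\<lambda>x. \<Sum>i<n. z i *\<^sub>R local_rep c (b i) x)"
  by (auto simp: local_rep_def lin_comb_apply)

lemma lin_comb_Ck_maps: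
  fixes A :: "('a::{t2_space, second_countable_topology}, 'e::euclidean_space) chart set"
  assumes A: "smooth_atlas A" and b: "\<And>i. i < n \<Longrightarrow> b i \<in> Ck_maps r A"
  shows "lin_comb n b z \<in> Ck_maps r A"
proof -
  have "Ck_on r (\<lambda>x. \<Sum>i<n. z i *\<^sub>R local_rep c (b i) x) (snd c ` fst c)" if c: "c \<in> A" for c
  proof -
    have o: "open (snd c ` fst c)" by (rule chart_open(2)[OF A c])
    show ?thesis
      by (intro Ck_on_sum Ck_on_scaleR o Ck_on_const) (use b c in \<open>auto simp: Ck_maps_def\<close>)
  qed
  then show ?thesis by (simp add: Ck_maps_def local_rep_lin_comb)
qed

lemma lin_comb_derivative:
  fixes A :: "('a::{t2_space, second_countable_topology}, 'e::euclidean_space) chart set"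
  assumes A: "smooth_atlas A" and b: "\<And>i. i < n \<Longrightarrow> b i \<in> Ck_maps 1 A" and c: "c \<in> A" "p \<in> fst c"
  shows "frechet_derivative (local_rep c (lin_comb n b z)) (at (snd c p)) v =
    (\<Sum>i<n. z i *\<^sub>R frechet_derivative (local_rep c (b i)) (at (snd c p)) v)"
proof -
  have "(local_rep c (lin_comb n b z) has_derivative (\<lambda>v. \<Sum>i<n. z i *\<^sub>R
      frechet_derivative (local_rep c (b i)) (at (snd c p)) v)) (at (snd c p))"
    unfolding local_rep_lin_comb
    by (intro has_derivative_sum has_derivative_scaleR_right Ck_maps_has_derivative[OF A b c]) auto
  from fun_cong[OF frechet_derivative_at[OF this], of v] show ?thesis by simp
qed

text \<open>For empty \<open>K\<close> the condition of a neighbourhood is void, so that a single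
  generator already contains every \<open>C^1\<close> map.\<close>

lemma topspace_whitney:
  fixes A :: "('a::{t2_space, second_countable_topology}, 'e::euclidean_space) chart set"
  assumes A: "smooth_atlas A"
  shows "topspace (whitney_topology A :: ('a \<Rightarrow> 'b::real_normed_vector) topology) = Ck_maps 1 A"
proof -
  obtain c where c: "c \<in> A" using atlas_chart_ex[OF A] by blast
  have nb: "f \<in> whitney_nbhd A f c {} 1" if "f \<in> Ck_maps 1 A" for f :: "'a \<Rightarrow> 'b"
    using that by (simp add: whitney_nbhd_def)
  have "openin (whitney_topology A) (whitney_nbhd A f c {} 1)" if "f \<in> Ck_maps 1 A" for f :: "'a \<Rightarrow> 'b"
    unfolding whitney_topology_def
    by (rule topology_generated_by_Basis) (use that c in \<open>blast intro: compact_empty zero_less_one\<close>)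
  then have "Ck_maps 1 A \<subseteq> topspace (whitney_topology A :: ('a \<Rightarrow> 'b) topology)"
    using nb openin_subset by blast
  moreover have "topspace (whitney_topology A :: ('a \<Rightarrow> 'b) topology) \<subseteq> Ck_maps 1 A"
    unfolding whitney_topology_def topology_generated_by_topspace by (auto simp: whitney_nbhd_def)
  ultimately show ?thesis by blast
qed

text \<open>A Whitney neighbourhood imposes a bound uniformly over a compact set, while a
  combination and its derivative are jointly continuous in coefficients and point. The tube lemma
  passes from the latter to the former.\<close>

lemma continuous_lin_comb_whitney:
  fixes A :: "('a::{t2_space, second_countable_topology}, 'e::euclidean_space) chart set"
    and b :: "nat \<Rightarrow> 'a \<Rightarrow> 'b::euclidean_space"
  assumes A: "smooth_atlas A" and b: "\<And>i. i < n \<Longrightarrow> b i \<in> Ck_maps 1 A"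
  shows "continuous_map euclidean (whitney_topology A) (lin_comb n b)"
  unfolding whitney_topology_def
proof (rule continuous_on_generated_topo)
  show "lin_comb n b ` topspace euclidean \<subseteq>
     \<Union>{whitney_nbhd A f c K \<epsilon> |f c K \<epsilon>. f \<in> Ck_maps 1 A \<and> c \<in> A \<and> compact K \<and> K \<subseteq> fst c \<and> 0 < \<epsilon>}"
    using topspace_whitney[OF A, where 'b='b] lin_comb_Ck_maps[OF A b]
    unfolding whitney_topology_def topology_generated_by_topspace by auto
next
  fix U :: "('a \<Rightarrow> 'b) set"
  assume "U \<in> {whitney_nbhd A f c K \<epsilon> |f c K \<epsilon>. f \<in> Ck_maps 1 A \<and> c \<in> A \<and> compact K \<and> K \<subseteq> fst c \<and> 0 < \<epsilon>}"
  then obtain f c K \<epsilon> where U: "U = whitney_nbhd A f c K \<epsilon>" and f: "f \<in> Ck_maps 1 A" and c: "c \<in> A"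
    and K: "compact K" "K \<subseteq> fst c" and \<epsilon>: "0 < \<epsilon>" by blast
  let ?O = "snd c ` fst c"
  let ?D = "\<lambda>h x. frechet_derivative (local_rep c h) (at x)"
  have O: "open ?O" by (rule chart_open(2)[OF A c])
  have cK: "compact (snd c ` K)"
    by (rule compact_continuous_image[OF continuous_on_subset[OF
          homeomorphism_cont1[OF chart_homeomorphism[OF A c]] K(2)] K(1)])
  have bl: "bounded_linear (?D h x)" if "h \<in> Ck_maps 1 A" "x \<in> ?O" for h :: "'a \<Rightarrow> 'b" and x
    using Ck_maps_has_derivative[OF A that(1) c] that(2) has_derivative_bounded_linear by blast
  have ca: "continuous_on ?O (local_rep c h)" "continuous_on ?O (\<lambda>x. ?D h x v)"
    if "h \<in> Ck_maps 1 A" for h :: "'a \<Rightarrow> 'b" and v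
  proof -
    have "Ck_on (Suc 0) (local_rep c h) ?O" using that c by (simp add: Ck_maps_def)
    from Ck_on_imp_continuous_on[OF this] Ck_on_SucD(2)[OF this]
    show "continuous_on ?O (local_rep c h)" "continuous_on ?O (\<lambda>x. ?D h x v)" by auto
  qed
  \<comment> \<open>Derivatives packed as bounded linear functions: their \<open>onorm\<close>
    becomes a norm, whose continuity follows from continuity along each basis direction.\<close>
  define H where "H h x = Blinfun (?D h x)" for h :: "'a \<Rightarrow> 'b" and x
  have H: "blinfun_apply (H h x) = ?D h x" if "h \<in> Ck_maps 1 A" "x \<in> ?O" for h x
    unfolding H_def using bl[OF that] by (simp add: bounded_linear_Blinfun_apply)
  have cH: "continuous_on ?O (H h)" if "h \<in> Ck_maps 1 A" for h
    by (rule continuous_on_blinfun_componentwise)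
      (rule continuous_on_eq[OF ca(2)[OF that]], simp add: H[OF that])
  define \<Phi> where "\<Phi> = (\<lambda>(z, x). max
     (norm ((\<Sum>i<n. z i *\<^sub>R local_rep c (b i) x) - local_rep c f x))
     (norm ((\<Sum>i<n. z i *\<^sub>R H (b i) x) - H f x)))"
  have cz: "continuous_on (UNIV \<times> ?O) (\<lambda>y :: (nat \<Rightarrow> real) \<times> 'e. fst y i)" for i
    by (rule continuous_on_compose2[OF continuous_on_coordinate[of i] continuous_on_fst[OF continuous_on_id]]) auto
  have cs: "continuous_on (UNIV \<times> ?O) (\<lambda>y :: (nat \<Rightarrow> real) \<times> 'e. k (snd y))"
    if "continuous_on ?O k" for k :: "'e \<Rightarrow> 'c::topological_space"
    by (rule continuous_on_compose2[OF that continuous_on_snd[OF continuous_on_id]]) auto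
  have c\<Phi>: "continuous_on (UNIV \<times> ?O) \<Phi>"
    unfolding \<Phi>_def case_prod_beta
    by (intro continuous_intros cz cs ca cH b f) auto
  have eq: "\<Phi> (z, x) < \<epsilon> \<longleftrightarrow> norm (local_rep c (lin_comb n b z) x - local_rep c f x) < \<epsilon> \<and>
     onorm (\<lambda>v. ?D (lin_comb n b z) x v - ?D f x v) < \<epsilon>" if x: "x \<in> ?O" for z x
  proof -
    obtain p where p: "p \<in> fst c" "x = snd c p" using x by auto
    have "norm ((\<Sum>i<n. z i *\<^sub>R H (b i) x) - H f x) = onorm (\<lambda>v. ?D (lin_comb n b z) x v - ?D f x v)"
      unfolding norm_blinfun.rep_eq
    proof (rule arg_cong[where f = onorm], rule ext)
      fix v
      have "(\<Sum>i<n. z i *\<^sub>R blinfun_apply (H (b i) x) v) = ?D (lin_comb n b z) x v"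
        unfolding p(2) using H[OF b] p
        by (subst lin_comb_derivative[OF A b c p(1)]) (auto intro: sum.cong)
      then show "blinfun_apply ((\<Sum>i<n. z i *\<^sub>R H (b i) x) - H f x) v = ?D (lin_comb n b z) x v - ?D f x v"
        using H[OF f x] by (simp add: blinfun.diff_left blinfun.sum_left blinfun.scaleR_left)
    qed
    then show ?thesis by (simp add: \<Phi>_def local_rep_lin_comb)
  qed
  have pre: "lin_comb n b -` U = {z. \<forall>x\<in>snd c ` K. \<Phi> (z, x) < \<epsilon>}"
    using K(2) eq lin_comb_Ck_maps[OF A b] unfolding U whitney_nbhd_def by (auto; blast)
  have "open (UNIV \<times> ?O)" using O by (simp add: open_Times)
  with continuous_open_preimage[OF c\<Phi> this, of "{..<\<epsilon>}"]
  have W: "open ((UNIV \<times> ?O) \<inter> \<Phi> -` {..<\<epsilon>})" by simp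
  have "open {z. \<forall>x\<in>snd c ` K. \<Phi> (z, x) < \<epsilon>}"
  proof (subst open_subopen, intro ballI)
    fix z assume "z \<in> {z. \<forall>x\<in>snd c ` K. \<Phi> (z, x) < \<epsilon>}"
    then have "{z} \<times> snd c ` K \<subseteq> (UNIV \<times> ?O) \<inter> \<Phi> -` {..<\<epsilon>}" using K(2) by auto
    from Elementary_Topology.tube_lemma[OF cK W this] obtain X0 where "z \<in> X0" "open X0"
      "X0 \<times> snd c ` K \<subseteq> (UNIV \<times> ?O) \<inter> \<Phi> -` {..<\<epsilon>}" by blast
    then show "\<exists>T. open T \<and> z \<in> T \<and> T \<subseteq> {z. \<forall>x\<in>snd c ` K. \<Phi> (z, x) < \<epsilon>}"
      by (intro exI[of _ X0]) auto
  qed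
  then show "openin euclidean (lin_comb n b -` U \<inter> topspace euclidean)" by (simp add: pre)
qed

lemma whitney_derivative_continuous:
  fixes A :: "('a::{t2_space, second_countable_topology}, 'e::euclidean_space) chart set"
  assumes A: "smooth_atlas A" and c: "c \<in> A" "p \<in> fst c"
  shows "continuous_map (whitney_topology A) euclidean
    (\<lambda>f :: 'a \<Rightarrow> 'b::euclidean_space. frechet_derivative (local_rep c f) (at (snd c p)) v)"
proof -
  let ?D = "\<lambda>f :: 'a \<Rightarrow> 'b. frechet_derivative (local_rep c f) (at (snd c p))"
  have "continuous_map (whitney_topology A) Met_TC.mtopology (\<lambda>f. ?D f v)"
    unfolding Met_TC.continuous_map_to_metric
  proof (intro ballI allI impI)
    fix f :: "'a \<Rightarrow> 'b" and \<epsilon> :: real assume "f \<in> topspace (whitney_topology A)" "0 < \<epsilon>"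
    then have f: "f \<in> Ck_maps 1 A" by (simp add: topspace_whitney[OF A])
    \<comment> \<open>The summand 1 keeps the denominator positive for \<open>v = 0\<close>.\<close>
    define \<delta> where "\<delta> = \<epsilon> / (norm v + 1)"
    have \<delta>: "0 < \<delta>" "\<delta> * norm v < \<epsilon>"
      using \<open>0 < \<epsilon>\<close> add_nonneg_pos[OF norm_ge_zero[of v] zero_less_one]
      by (simp_all add: \<delta>_def divide_less_eq distrib_left)
    let ?U = "whitney_nbhd A f c {p} \<delta>"
    have "openin (whitney_topology A) ?U"
      unfolding whitney_topology_def
      by (rule topology_generated_by_Basis, intro CollectI exI conjI, rule refl) (use f c \<delta> in auto)
    moreover have "f \<in> ?U" using f \<delta> by (simp add: whitney_nbhd_def onorm_zero)
    moreover have "?D h v \<in> Met_TC.mball (?D f v) \<epsilon>" if h: "h \<in> ?U" for h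
    proof -
      have hC: "h \<in> Ck_maps 1 A" and o: "onorm (\<lambda>v. ?D h v - ?D f v) < \<delta>"
        using h by (auto simp: whitney_nbhd_def)
      have "bounded_linear (\<lambda>v. ?D h v - ?D f v)"
        by (intro bounded_linear_sub has_derivative_bounded_linear[OF Ck_maps_has_derivative[OF A _ c]] hC f)
      from onorm[OF this, of v] have "norm (?D h v - ?D f v) \<le> onorm (\<lambda>v. ?D h v - ?D f v) * norm v" .
      also have "\<dots> \<le> \<delta> * norm v" using o by (intro mult_right_mono) auto
      also have "\<dots> < \<epsilon>" by (rule \<delta>)
      finally show ?thesis by (simp add: dist_norm norm_minus_commute)
    qed
    ultimately show "\<exists>U. openin (whitney_topology A) U \<and> f \<in> U \<and> (\<forall>h\<in>U. ?D h v \<in> Met_TC.mball (?D f v) \<epsilon>)"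
      by blast
  qed
  then show ?thesis by (simp add: mtopology_is_euclidean)
qed

lemma jacobian_measurable:
  fixes A :: "('a::{t2_space, second_countable_topology}, 'e::euclidean_space) chart set"
  assumes A: "smooth_atlas A" and g: "riemannian_metric A g"
  shows "(jacobian A g p :: ('a \<Rightarrow> real ^ 'k) \<Rightarrow> real) \<in> borel_measurable (borel_of (whitney_topology A))"
proof -
  obtain c where c: "c \<in> A" "p \<in> fst c" using atlas_chart_ex[OF A] by blast
  let ?W = "borel_of (whitney_topology A :: ('a \<Rightarrow> real ^ 'k) topology)"
  have m: "(\<lambda>f. frechet_derivative (local_rep c f) (at (snd c p)) v) \<in> borel_measurable ?W" for v
    by (rule continuous_map_borel_measurable[OF whitney_derivative_continuous[OF A c]])
  have [measurable]: "(\<lambda>f. frechet_derivative (local_rep c f) (at (snd c p)) v $ i) \<in> borel_measurable ?W" for v i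
    using measurable_compose[OF m borel_measurable_continuous_onI[OF linear_continuous_on[OF bounded_linear_vec_nth]]]
    by simp
  have gm[measurable]: "(\<lambda>f. chart_gradient c p f i) \<in> borel_measurable ?W" for i
    unfolding chart_gradient_def by measurable
  have l: "linear (inv (metric_operator A g c p))"
    by (rule positive_definite_inverse(3)[OF riemannian_metric_coord(2,3)[OF A g c]])
  have [measurable]: "(\<lambda>f. inv (metric_operator A g c p) (chart_gradient c p f i)) \<in> borel_measurable ?W" for i
    using measurable_compose[OF gm borel_measurable_continuous_onI[OF linear_continuous_on]] l
    by (simp add: linear_conv_bounded_linear)
  have "(\<lambda>f. sqrt (det (\<chi> i j. inv (metric_operator A g c p) (chart_gradient c p f j) \<bullet> chart_gradient c p f i)))
    \<in> borel_measurable ?W"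
    unfolding det_def by simp
  then show ?thesis
    by (rule measurable_cong[THEN iffD1, rotated]) (simp add: topspace_whitney[OF A] jacobian_chart[OF A g c])
qed

section \<open>Almost every linear combination has regular zeros\<close>

text \<open>An existential quantifier over an uncountable set does not preserve measurability in
  general. Here the infimum over \<open>K\<close> is attained by compactness, and by continuity it
  can be read off a countable dense subset, so only countable operations remain.\<close>

lemma sets_Ex_zero_compact:
  fixes \<Phi> :: "'z \<Rightarrow> 'y::euclidean_space \<Rightarrow> real"
  assumes K: "compact K" and cont: "\<And>z. continuous_on K (\<Phi> z)" and nonneg: "\<And>z y. 0 \<le> \<Phi> z y"
    and meas: "\<And>y. y \<in> K \<Longrightarrow> (\<lambda>z. \<Phi> z y) \<in> borel_measurable M"
  shows "{z \<in> space M. \<exists>y\<in>K. \<Phi> z y = 0} \<in> sets M"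
proof -
  obtain D where D: "countable D" "D \<subseteq> K" "K \<subseteq> closure D" using separable[of K] by blast
  have eq: "{z \<in> space M. \<exists>y\<in>K. \<Phi> z y = 0} =
     {z \<in> space M. \<forall>m. \<exists>y\<in>D. \<Phi> z y < 1 / real (Suc m)}"
  proof (intro Collect_cong conj_cong refl iffI allI)
    fix z m assume "\<exists>y\<in>K. \<Phi> z y = 0"
    then obtain y where y: "y \<in> K" "\<Phi> z y = 0" by blast
    have "0 < 1 / real (Suc m)" by simp
    with cont y(1) obtain d where d: "0 < d" "\<And>x. x \<in> K \<Longrightarrow> dist x y < d \<Longrightarrow> dist (\<Phi> z x) (\<Phi> z y) < 1 / real (Suc m)"
      unfolding continuous_on_iff by metis
    obtain x where "x \<in> D" "dist x y < d"
      using D(3) y(1) d(1) by (meson closure_approachable subsetD)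
    then show "\<exists>y\<in>D. \<Phi> z y < 1 / real (Suc m)"
      using d(2)[of x] D(2) y(2) by (intro bexI[of _ x]) (auto simp: dist_real_def)
  next
    fix z assume all: "\<forall>m. \<exists>y\<in>D. \<Phi> z y < 1 / real (Suc m)"
    then have "K \<noteq> {}" using D(2) by blast
    from continuous_attains_inf[OF K this cont[of z]]
    obtain y where y: "y \<in> K" "\<And>x. x \<in> K \<Longrightarrow> \<Phi> z y \<le> \<Phi> z x" by blast
    have "\<Phi> z y = 0"
    proof (rule ccontr)
      assume "\<Phi> z y \<noteq> 0"
      then have "0 < \<Phi> z y" using nonneg[of z y] by simp
      then obtain m where "1 / real (Suc m) < \<Phi> z y" using reals_Archimedean by (auto simp: inverse_eq_divide)
      then show False using all[rule_format, of m] y(2) D(2) by force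
    qed
    then show "\<exists>y\<in>K. \<Phi> z y = 0" using y(1) by blast
  qed
  have "{z \<in> space M. \<Phi> z y < 1 / real (Suc m)} \<in> sets M" if "y \<in> D" for y m
    using meas[of y] that D(2) by (intro borel_measurable_less) auto
  then show ?thesis unfolding eq using D(1)
    by (intro sets.sets_Collect_countable_All sets.sets_Collect_countable_Bex) auto
qed

text \<open>The variables are the pairs \<open>(x, \<xi>)\<close>. The derivative in \<xi> vanishes
  because the combination is 0 at \<open>x\<close>, the derivative in \<open>x\<close> because \<xi>
  is orthogonal to the range of its differential; a degenerate zero thus becomes a critical point of
  one real function.\<close>

lemma regular_zero_slice_negligible:
  fixes \<beta> :: "nat \<Rightarrow> 'e::euclidean_space \<Rightarrow> real ^ 'k"
  assumes O: "open O'" and \<beta>: "\<And>j. j < n \<Longrightarrow> smooth_on (\<beta> j) O'" and i: "i < n"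
  shows "negligible {t. \<exists>x \<xi>. x \<in> O' \<and> \<beta> i x \<bullet> \<xi> \<noteq> 0 \<and> (\<Sum>j<n. (z(i := t)) j *\<^sub>R \<beta> j x) = 0 \<and>
     (\<forall>v\<in>Basis. (\<Sum>j<n. (z(i := t)) j *\<^sub>R frechet_derivative (\<beta> j) (at x) v) \<bullet> \<xi> = 0)}"
    (is "negligible ?T")
proof -
  define U where "U = {y :: 'e \<times> (real ^ 'k). fst y \<in> O' \<and> \<beta> i (fst y) \<bullet> snd y \<noteq> 0}"
  define h where "h j y = \<beta> j (fst y) \<bullet> snd y" for j and y :: "'e \<times> (real ^ 'k)"
  have OU: "open (O' \<times> (UNIV :: (real ^ 'k) set))" using O by (simp add: open_Times)
  have h: "Ck_on r (h j) (O' \<times> UNIV)" if "j < n" for j r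
  proof -
    have "Ck_on r (\<lambda>y. \<beta> j (fst y)) (O' \<times> (UNIV :: (real ^ 'k) set))"
      by (rule Ck_on_compose[OF OU O Ck_on_linear[OF OU bounded_linear_fst]])
        (use \<beta>[OF that] in \<open>auto simp: smooth_on_def\<close>)
    moreover have "Ck_on r snd (O' \<times> (UNIV :: (real ^ 'k) set))"
      by (rule Ck_on_linear[OF OU bounded_linear_snd])
    ultimately have "Ck_on r (\<lambda>y. \<Sum>k\<in>Basis. (\<beta> j (fst y) \<bullet> k) * (snd y \<bullet> k)) (O' \<times> (UNIV :: (real ^ 'k) set))"
      by (intro Ck_on_sum[OF OU] Ck_on_mult[OF OU] Ck_on_bounded_linear[OF OU bounded_linear_inner_left])
    moreover have "(\<lambda>y. \<Sum>k\<in>Basis. (\<beta> j (fst y) \<bullet> k) * (snd y \<bullet> k)) = h j"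
      by (rule ext) (simp add: h_def euclidean_inner[symmetric])
    ultimately show ?thesis by simp
  qed
  have U: "open U" "U \<subseteq> O' \<times> UNIV"
  proof -
    have "open ((O' \<times> UNIV) \<inter> h i -` (- {0}))"
      by (intro continuous_open_preimage[OF Ck_on_imp_continuous_on[OF h[OF i]] OU]) auto
    moreover have "(O' \<times> UNIV) \<inter> h i -` (- {0}) = U" by (auto simp: U_def h_def)
    ultimately show "open U" by simp
  qed (auto simp: U_def)
  \<comment> \<open>\<open>q y\<close> is the unique value of the \<open>i\<close>-th coefficient
    for which the combination, paired with \<open>snd y\<close>, vanishes at
    \<open>y\<close>.\<close>
  define q where "q y = - (\<Sum>j\<in>{..<n} - {i}. z j * h j y) / h i y" for y
  have hU: "Ck_on r (h j) U" if "j < n" for j r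
    using Ck_on_subset[OF h[OF that] U(2)] .
  have q: "smooth_on q U" unfolding smooth_on_def q_def[abs_def]
    by (intro allI Ck_on_divide[OF U(1)] Ck_on_minus[OF U(1)] Ck_on_sum[OF U(1)] Ck_on_mult[OF U(1)]
        Ck_on_const hU) (use i in \<open>auto simp: U_def h_def\<close>)
  have "?T \<subseteq> q ` {y \<in> U. frechet_derivative q (at y) = (\<lambda>v. 0)}"
  proof
    fix t assume "t \<in> ?T"
    then obtain x \<xi> where x: "x \<in> O'" "\<beta> i x \<bullet> \<xi> \<noteq> 0" "(\<Sum>j<n. (z(i := t)) j *\<^sub>R \<beta> j x) = 0"
      "\<And>v. v \<in> Basis \<Longrightarrow> (\<Sum>j<n. (z(i := t)) j *\<^sub>R frechet_derivative (\<beta> j) (at x) v) \<bullet> \<xi> = 0" by blast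
    define y where "y = (x, \<xi>)"
    have y: "y \<in> U" using x by (simp add: y_def U_def)
    define H where "H y = (\<Sum>j<n. (z(i := t)) j * h j y)" for y
    have qH: "q y = t - H y / h i y" if "y \<in> U" for y
    proof -
      have "H y = t * h i y + (\<Sum>j\<in>{..<n} - {i}. z j * h j y)"
        unfolding H_def using i by (subst sum.remove[of _ i]) (auto intro: sum.cong)
      then show ?thesis using that by (simp add: q_def U_def h_def[symmetric] field_simps)
    qed
    have Hy: "H y = 0"
      using arg_cong[OF x(3), of "\<lambda>w. w \<bullet> \<xi>"] by (simp add: H_def h_def y_def inner_sum_left)
    have \<beta>d: "(\<beta> j has_derivative frechet_derivative (\<beta> j) (at x)) (at x)" if "j < n" for j
      using smooth_on_has_derivative[OF \<beta>[OF that] x(1)] .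
    define B where "B v = (\<Sum>j<n. (z(i := t)) j *\<^sub>R frechet_derivative (\<beta> j) (at x) v)" for v
    have lB: "linear B" unfolding B_def
      by (intro linear_compose_sum linear_compose_scale_right ballI has_derivative_linear[OF \<beta>d]) auto
    have B0: "B v \<bullet> \<xi> = 0" for v
    proof -
      have "B v = (\<Sum>b\<in>Basis. (v \<bullet> b) *\<^sub>R B b)"
        by (subst (1) euclidean_representation[of v, symmetric]) (simp only: linear_sum[OF lB] linear_cmul[OF lB])
      then show ?thesis using x(4) by (simp add: inner_sum_left B_def)
    qed
    have hd: "(h j has_derivative (\<lambda>w. \<beta> j x \<bullet> snd w + frechet_derivative (\<beta> j) (at x) (fst w) \<bullet> \<xi>)) (at y)"
      if "j < n" for j
    proof -
      have "(fst has_derivative fst) (at y)" by (rule bounded_linear_imp_has_derivative[OF bounded_linear_fst])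
      from diff_chain_at[OF this, of "\<beta> j"] \<beta>d[OF that]
      have "((\<lambda>y. \<beta> j (fst y)) has_derivative (\<lambda>w. frechet_derivative (\<beta> j) (at x) (fst w))) (at y)"
        by (simp add: y_def o_def)
      from has_derivative_inner[OF this bounded_linear_imp_has_derivative[OF bounded_linear_snd]]
      show ?thesis unfolding h_def[abs_def] by (simp add: y_def)
    qed
    have "(H has_derivative (\<lambda>w. \<Sum>j<n. (z(i := t)) j *
        (\<beta> j x \<bullet> snd w + frechet_derivative (\<beta> j) (at x) (fst w) \<bullet> \<xi>))) (at y)"
      unfolding H_def[abs_def] by (intro has_derivative_sum has_derivative_mult_right hd) simp
    moreover have "(\<Sum>j<n. (z(i := t)) j * (\<beta> j x \<bullet> snd w + frechet_derivative (\<beta> j) (at x) (fst w) \<bullet> \<xi>)) = 0" for w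
    proof -
      have "(\<Sum>j<n. (z(i := t)) j * (\<beta> j x \<bullet> snd w + frechet_derivative (\<beta> j) (at x) (fst w) \<bullet> \<xi>)) =
         (\<Sum>j<n. (z(i := t)) j *\<^sub>R \<beta> j x) \<bullet> snd w + B (fst w) \<bullet> \<xi>"
        by (simp add: B_def inner_sum_left sum.distrib distrib_left del: fun_upd_apply)
      then show ?thesis using x(3) B0 by (simp del: fun_upd_apply)
    qed
    ultimately have Hd: "(H has_derivative (\<lambda>w. 0)) (at y)" by simp
    have hi: "h i y \<noteq> 0" using x by (simp add: h_def y_def)
    \<comment> \<open>The numerator of the quotient rule is 0, since both \<open>H\<close> and its
      derivative vanish at \<open>y\<close>.\<close>
    have "((\<lambda>y. t - H y / h i y) has_derivative (\<lambda>w. 0)) (at y)"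
      by (rule has_derivative_eq_rhs[OF has_derivative_diff[OF has_derivative_const has_derivative_divide[OF Hd hd[OF i] hi]]])
        (simp add: Hy)
    then have "(q has_derivative (\<lambda>w. 0)) (at y)"
      by (rule has_derivative_transform_within_open[OF _ U(1) y]) (simp add: qH)
    then have "frechet_derivative q (at y) = (\<lambda>v. 0)" using frechet_derivative_at by metis
    moreover have "q y = t" using qH[OF y] Hy by simp
    ultimately show "t \<in> q ` {y \<in> U. frechet_derivative q (at y) = (\<lambda>v. 0)}" using y by force
  qed
  then show ?thesis using sard_real[OF U(1) q] negligible_subset by blast
qed

lemma negligible_AE: "negligible S \<Longrightarrow> AE x in lborel. x \<notin> S"
  unfolding negligible_iff_null_sets null_sets_completion_iff2
  by (auto intro!: AE_I' elim!: AE_I'[rotated])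

lemma product_null_slices:
  fixes n i :: nat
  assumes i: "i < n" and B: "B \<in> sets (\<Pi>\<^sub>M i\<in>{..<n}. lborel :: real measure)"
    and slice: "\<And>z. negligible {t. z(i := t) \<in> B}"
  shows "AE z in (\<Pi>\<^sub>M i\<in>{..<n}. lborel). z \<notin> B"
proof -
  interpret product_sigma_finite "\<lambda>_::nat. lborel :: real measure" by standard
  let ?J = "{..<n} - {i}"
  have n: "{..<n} = insert i ?J" using i by auto
  have "emeasure (\<Pi>\<^sub>M i\<in>{..<n}. lborel) B = (\<integral>\<^sup>+z. indicator B z \<partial>(\<Pi>\<^sub>M i\<in>insert i ?J. lborel))"
    using B n[symmetric] by simp
  also have "\<dots> = (\<integral>\<^sup>+z. (\<integral>\<^sup>+t. indicator B (z(i := t)) \<partial>lborel) \<partial>(\<Pi>\<^sub>M i\<in>?J. lborel))"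
    using product_nn_integral_insert[of ?J i "indicator B"] B n[symmetric] by simp
  also have "\<dots> = (\<integral>\<^sup>+z. 0 \<partial>(\<Pi>\<^sub>M i\<in>?J. lborel :: real measure))"
  proof (rule nn_integral_cong)
    fix z
    have "(\<integral>\<^sup>+t. indicator B (z(i := t)) \<partial>lborel) = (\<integral>\<^sup>+t. 0 \<partial>(lborel :: real measure))"
      by (rule nn_integral_cong_AE, rule AE_mp[OF negligible_AE[OF slice[of z]]]) (auto simp: indicator_def)
    then show "(\<integral>\<^sup>+t. indicator B (z(i := t)) \<partial>lborel) = (0::ennreal)" by simp
  qed
  finally have "B \<in> null_sets (\<Pi>\<^sub>M i\<in>{..<n}. lborel)" using B by auto
  then show ?thesis by (rule AE_not_in)
qed

text \<open>A degenerate zero has a nonzero \<xi> orthogonal to the range of the derivative, and as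
  the \<open>b i p\<close> span, some \<open>b i p \<bullet> \<xi>\<close> is nonzero. This places
  it in one of countably many pieces, indexed by a chart, an \<open>i\<close> and a compact subset
  of \<open>U c i\<close>.\<close>

theorem AE_regular_value:
  fixes A :: "('a::{t2_space, second_countable_topology}, 'e::euclidean_space) chart set"
    and b :: "nat \<Rightarrow> 'a \<Rightarrow> real ^ 'k"
  assumes A: "smooth_atlas A" and b: "\<And>i. i < n \<Longrightarrow> b i \<in> smooth_maps A"
    and ev: "\<And>p x. \<exists>z. lin_comb n b z p = x"
  shows "AE z in (\<Pi>\<^sub>M i\<in>{..<n}. lborel). regular_value A (lin_comb n b z) 0"
proof -
  let ?N = "\<Pi>\<^sub>M i\<in>{..<n}. (lborel :: real measure)"
  \<comment> \<open>Lindelof: countably many charts cover the manifold, so that the exceptional null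
    sets can be united.\<close>
  obtain \<F> where \<F>: "\<F> \<subseteq> fst ` A" "countable \<F>" "\<Union>\<F> = \<Union>(fst ` A)"
    using Lindelof[of "fst ` A"] chart_open(1)[OF A] by blast
  obtain A0 where A0: "A0 \<subseteq> A" "countable A0" "\<F> = fst ` A0"
    using \<F>(1,2) countable_subset_image[of \<F> fst A] by blast
  have cover: "\<exists>c\<in>A0. p \<in> fst c" for p
    using atlas_chart_ex[OF A, of p] \<F>(3) A0(3) by (metis UN_iff)
  define O' where "O' c = snd c ` fst c" for c :: "('a, 'e) chart"
  define \<beta> where "\<beta> c i = local_rep c (b i)" for c :: "('a, 'e) chart" and i
  define U where "U c i = {y :: 'e \<times> (real ^ 'k). fst y \<in> O' c \<and> \<beta> c i (fst y) \<bullet> snd y \<noteq> 0}" for c :: "('a, 'e) chart" and i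
  \<comment> \<open>Its vanishing encodes a degenerate zero at \<open>fst y\<close> with covector
    \<open>snd y\<close>. As a nonnegative function, continuous in \<open>y\<close>, it fits
    \<open>sets_Ex_zero_compact\<close>, which makes the set of bad coefficients measurable.\<close>
  define \<Phi> where "\<Phi> c z y = norm (\<Sum>j<n. z j *\<^sub>R \<beta> c j (fst y)) +
     (\<Sum>v\<in>Basis. \<bar>(\<Sum>j<n. z j *\<^sub>R frechet_derivative (\<beta> c j) (at (fst y)) v) \<bullet> snd y\<bar>)"
    for c :: "('a, 'e) chart" and z and y :: "'e \<times> (real ^ 'k)"
  have \<Phi>0: "\<Phi> c z y = 0 \<longleftrightarrow> (\<Sum>j<n. z j *\<^sub>R \<beta> c j (fst y)) = 0 \<and>
     (\<forall>v\<in>Basis. (\<Sum>j<n. z j *\<^sub>R frechet_derivative (\<beta> c j) (at (fst y)) v) \<bullet> snd y = 0)" for c z y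
    unfolding \<Phi>_def by (subst add_nonneg_eq_0_iff) (auto simp: sum_nonneg sum_nonneg_eq_0_iff)
  have sm: "smooth_on (\<beta> c j) (O' c)" if "c \<in> A" "j < n" for c j
    using b[OF that(2)] that(1) by (simp add: \<beta>_def O'_def smooth_maps_def)
  have oO: "open (O' c)" if "c \<in> A" for c using chart_open(2)[OF A that] by (simp add: O'_def)
  have oU: "open (U c i)" if c: "c \<in> A" and i: "i < n" for c i
  proof -
    have "continuous_on (O' c \<times> (UNIV :: (real ^ 'k) set)) (\<lambda>y. \<beta> c i (fst y) \<bullet> snd y)"
      by (intro continuous_intros continuous_on_compose2[OF smooth_on_imp_continuous_on[OF sm[OF c i]]]) auto
    from continuous_open_preimage[OF this, of "- {0}"] oO[OF c]
    have "open ((O' c \<times> UNIV) \<inter> (\<lambda>y. \<beta> c i (fst y) \<bullet> snd y) -` (- {0}))" by (simp add: open_Times open_Compl)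
    moreover have "(O' c \<times> UNIV) \<inter> (\<lambda>y. \<beta> c i (fst y) \<bullet> snd y) -` (- {0}) = U c i" by (auto simp: U_def)
    ultimately show ?thesis by simp
  qed
  have compact_pieces: "AE z in ?N. \<not> (\<exists>y\<in>K. \<Phi> c z y = 0)"
    if c: "c \<in> A" and i: "i < n" and K: "compact K" "K \<subseteq> U c i" for c i K
  proof -
    let ?B = "{z \<in> space ?N. \<exists>y\<in>K. \<Phi> c z y = 0}"
    have "?B \<in> sets ?N"
    proof (rule sets_Ex_zero_compact[OF K(1)])
      have sub: "fst ` K \<subseteq> O' c" using K(2) by (auto simp: U_def)
      show "continuous_on K (\<Phi> c z)" for z
        unfolding \<Phi>_def
        by (intro continuous_intros continuous_on_compose2[OF smooth_on_imp_continuous_on[OF sm[OF c]]]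
            continuous_on_compose2[OF smooth_on_imp_continuous_on[OF smooth_on_derivative[OF sm[OF c]]]])
          (use sub in auto)
      show "0 \<le> \<Phi> c z y" for z y unfolding \<Phi>_def by (simp add: sum_nonneg)
      show "(\<lambda>z. \<Phi> c z y) \<in> borel_measurable ?N" for y unfolding \<Phi>_def by measurable
    qed
    moreover have "negligible {t::real. z(i := t) \<in> ?B}" for z :: "nat \<Rightarrow> real"
    proof (rule negligible_subset)
      show "negligible {t. \<exists>x \<xi>. x \<in> O' c \<and> \<beta> c i x \<bullet> \<xi> \<noteq> 0 \<and> (\<Sum>j<n. (z(i := t)) j *\<^sub>R \<beta> c j x) = 0 \<and>
        (\<forall>v\<in>Basis. (\<Sum>j<n. (z(i := t)) j *\<^sub>R frechet_derivative (\<beta> c j) (at x) v) \<bullet> \<xi> = 0)}"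
        by (rule regular_zero_slice_negligible[OF oO[OF c] sm[OF c] i])
      show "{t. z(i := t) \<in> ?B} \<subseteq> {t. \<exists>x \<xi>. x \<in> O' c \<and> \<beta> c i x \<bullet> \<xi> \<noteq> 0 \<and> (\<Sum>j<n. (z(i := t)) j *\<^sub>R \<beta> c j x) = 0 \<and>
        (\<forall>v\<in>Basis. (\<Sum>j<n. (z(i := t)) j *\<^sub>R frechet_derivative (\<beta> c j) (at x) v) \<bullet> \<xi> = 0)}"
      proof
        fix t assume "t \<in> {t. z(i := t) \<in> ?B}"
        then obtain y where y: "y \<in> K" "\<Phi> c (z(i := t)) y = 0" by blast
        show "t \<in> {t. \<exists>x \<xi>. x \<in> O' c \<and> \<beta> c i x \<bullet> \<xi> \<noteq> 0 \<and> (\<Sum>j<n. (z(i := t)) j *\<^sub>R \<beta> c j x) = 0 \<and>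
          (\<forall>v\<in>Basis. (\<Sum>j<n. (z(i := t)) j *\<^sub>R frechet_derivative (\<beta> c j) (at x) v) \<bullet> \<xi> = 0)}"
          unfolding mem_Collect_eq using y(1) y(2)[unfolded \<Phi>0] K(2)
          by (intro exI[of _ "fst y"] exI[of _ "snd y"] conjI) (auto simp: U_def simp del: fun_upd_apply)
      qed
    qed
    ultimately have "AE z in ?N. z \<notin> ?B" by (rule product_null_slices[OF i])
    then show ?thesis by (rule AE_mp) (auto intro!: AE_I2)
  qed
  have "AE z in ?N. \<not> (\<exists>y\<in>U c i. \<Phi> c z y = 0)" if ci: "c \<in> A" "i < n" for c i
  proof -
    \<comment> \<open>The measurability argument works over compact sets, hence the exhaustion of
      the open set \<open>U c i\<close>.\<close>
    obtain C where C: "\<And>m::nat. compact (C m)" "\<And>m. C m \<subseteq> U c i" "U c i = (\<Union>m. C m)"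
      using open_Union_compact_subsets[OF oU[OF ci]] by metis
    have "AE z in ?N. \<forall>m. \<not> (\<exists>y\<in>C m. \<Phi> c z y = 0)"
      using compact_pieces[OF ci C(1,2)] by (simp add: AE_all_countable)
    then show ?thesis by (rule AE_mp) (auto intro!: AE_I2 simp: C(3))
  qed
  then have "AE z in ?N. \<forall>c\<in>A0. \<forall>i\<in>{..<n}. \<not> (\<exists>y\<in>U c i. \<Phi> c z y = 0)"
    using A0(1,2) by (intro AE_ball_countable' ) auto
  then show ?thesis
  proof (rule AE_mp, intro AE_I2 impI)
    fix z assume ok: "\<forall>c\<in>A0. \<forall>i\<in>{..<n}. \<not> (\<exists>y\<in>U c i. \<Phi> c z y = 0)"
    let ?f = "lin_comb n b z"
    have bC: "b i \<in> Ck_maps 1 A" if "i < n" for i using smooth_maps_Ck_maps[OF b[OF that]] .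
    have fC: "?f \<in> Ck_maps 1 A" by (rule lin_comb_Ck_maps[OF A bC])
    show "regular_value A ?f 0"
      unfolding regular_value_def
    proof (intro allI impI)
      fix p assume fp: "?f p = 0"
      obtain c where c: "c \<in> A0" "p \<in> fst c" using cover by blast
      have cA: "c \<in> A" using c A0 by auto
      let ?L = "frechet_derivative (local_rep c ?f) (at (snd c p))"
      have lL: "linear ?L" using Ck_maps_has_derivative[OF A fC cA c(2)] has_derivative_linear by blast
      have im: "differential ?f ` tangent_space A p = range ?L"
        unfolding tangent_space_chart[OF A cA c(2)] image_image differential_coord_vector[OF A fC cA c(2)] ..
      show "differential ?f ` tangent_space A p = UNIV"
      proof (rule ccontr)
        assume "differential ?f ` tangent_space A p \<noteq> UNIV"
        moreover have "span (range ?L) = range ?L"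
          using linear_subspace_image[OF lL subspace_UNIV] by (simp only: span_eq_iff)
        ultimately have "span (range ?L) \<noteq> UNIV" by (simp only: im not_False_eq_True)
        then obtain \<xi> where \<xi>: "\<xi> \<noteq> 0" "\<And>w. w \<in> span (range ?L) \<Longrightarrow> \<xi> \<bullet> w = 0"
          using span_not_UNIV_orthogonal by blast
        obtain z' where z': "lin_comb n b z' p = \<xi>" using ev by blast
        have "\<exists>i<n. b i p \<bullet> \<xi> \<noteq> 0"
        proof (rule ccontr)
          assume "\<not> (\<exists>i<n. b i p \<bullet> \<xi> \<noteq> 0)"
          then have "lin_comb n b z' p \<bullet> \<xi> = 0" by (simp add: lin_comb_apply inner_sum_left)
          then show False using \<xi>(1) z' by simp
        qed
        then obtain i where i: "i < n" "b i p \<bullet> \<xi> \<noteq> 0" by blast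
        have "(snd c p, \<xi>) \<in> U c i"
          using i c(2) local_rep_apply[OF A cA c(2), of "b i"] by (simp add: U_def O'_def \<beta>_def)
        moreover have "\<Phi> c z (snd c p, \<xi>) = 0"
          unfolding \<Phi>0
        proof (intro conjI ballI)
          show "(\<Sum>j<n. z j *\<^sub>R \<beta> c j (fst (snd c p, \<xi>))) = 0"
            using fp by (simp add: \<beta>_def local_rep_apply[OF A cA c(2)] lin_comb_apply)
          fix v :: 'e
          have "(\<Sum>j<n. z j *\<^sub>R frechet_derivative (\<beta> c j) (at (snd c p)) v) = ?L v"
            unfolding \<beta>_def by (rule lin_comb_derivative[OF A bC cA c(2), symmetric])
          then show "(\<Sum>j<n. z j *\<^sub>R frechet_derivative (\<beta> c j) (at (fst (snd c p, \<xi>))) v) \<bullet> snd (snd c p, \<xi>) = 0"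
            using \<xi>(2)[of "?L v"] by (simp add: span_base inner_commute)
        qed
        ultimately show False using ok c(1) i(1) by blast
      qed
    qed
  qed
qed

section \<open>Slicing Lebesgue measure by a surjective linear map\<close>

lemma nn_integral_lborel_translation:
  fixes f :: "'v::euclidean_space \<Rightarrow> ennreal"
  assumes [measurable]: "f \<in> borel_measurable borel"
  shows "(\<integral>\<^sup>+x. f (y + x) \<partial>lborel) = (\<integral>\<^sup>+x. f x \<partial>lborel)"
proof -
  have "(\<integral>\<^sup>+x. f x \<partial>lborel) = (\<integral>\<^sup>+x. f x \<partial>(distr lborel borel ((+) y)))"
    by (simp add: lborel_distr_plus)
  then show ?thesis by (simp add: nn_integral_distr)
qed

lemma nn_integral_lborel_reflection:
  fixes f :: "'v::euclidean_space \<Rightarrow> ennreal"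
  assumes [measurable]: "f \<in> borel_measurable borel"
  shows "(\<integral>\<^sup>+x. f (- x) \<partial>lborel) = (\<integral>\<^sup>+x. f x \<partial>lborel)"
proof -
  have "(\<integral>\<^sup>+x. f x \<partial>lborel) = (\<integral>\<^sup>+x. f x \<partial>(density (distr lborel borel (\<lambda>x::'v. 0 + (- 1) *\<^sub>R x)) (\<lambda>_. \<bar>- 1 :: real\<bar> ^ DIM('v))))"
    by (subst lborel_affine[of "- 1" "0 :: 'v"]) auto
  then show ?thesis by (simp add: nn_integral_density nn_integral_distr)
qed

text \<open>The absolute value of the determinant, defined without reference to it because the library
  relates determinants to volumes only for well-ordered index types.\<close>

definition lin_det :: "('v::euclidean_space \<Rightarrow> 'v) \<Rightarrow> real" where
  "lin_det T = inverse (measure lborel (T -` cbox 0 One))"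

text \<open>Uniqueness of Haar measure in disguise. As \<open>T\<close> is onto, integrating
  \<open>f (T v)\<close> over \<open>v\<close> is invariant under translations of \<open>f\<close>,
  and two invariant integrals are proportional by Fubini applied to
  \<open>f y * g (y + T v)\<close>.\<close>

lemma nn_integral_linear_proportional:
  fixes T :: "'v::euclidean_space \<Rightarrow> 'v" and f g :: "'v \<Rightarrow> ennreal"
  assumes T: "linear T" "bij T"
    and f[measurable]: "f \<in> borel_measurable borel" and g[measurable]: "g \<in> borel_measurable borel"
  shows "(\<integral>\<^sup>+x. f x \<partial>lborel) * (\<integral>\<^sup>+v. g (T v) \<partial>lborel) = (\<integral>\<^sup>+x. g x \<partial>lborel) * (\<integral>\<^sup>+v. f (T v) \<partial>lborel)"
proof -
  have [measurable]: "T \<in> borel_measurable borel"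
    using T(1) by (intro borel_measurable_continuous_onI linear_continuous_on) (simp add: linear_conv_bounded_linear)
  have surj: "\<exists>w. y = T w" for y using T(2) by (metis bij_pointE)
  have shift: "(\<integral>\<^sup>+v. k (y + T v) \<partial>lborel) = (\<integral>\<^sup>+v. k (T v) \<partial>lborel)"
    if [measurable]: "k \<in> borel_measurable borel" for k :: "'v \<Rightarrow> ennreal" and y
  proof -
    obtain w where "y = T w" using surj by blast
    then have "(\<integral>\<^sup>+v. k (y + T v) \<partial>lborel) = (\<integral>\<^sup>+v. k (T (w + v)) \<partial>lborel)"
      by (simp add: linear_add[OF T(1)])
    then show ?thesis by (simp add: nn_integral_lborel_translation[of "\<lambda>v. k (T v)"])
  qed
  have "(\<integral>\<^sup>+x. f x \<partial>lborel) * (\<integral>\<^sup>+v. g (T v) \<partial>lborel) = (\<integral>\<^sup>+y. (\<integral>\<^sup>+v. f y * g (y + T v) \<partial>lborel) \<partial>lborel)"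
    by (simp add: nn_integral_cmult nn_integral_multc shift)
  also have "\<dots> = (\<integral>\<^sup>+v. (\<integral>\<^sup>+y. f y * g (y + T v) \<partial>lborel) \<partial>lborel)"
    by (rule lborel_pair.Fubini') measurable
  also have "\<dots> = (\<integral>\<^sup>+v. (\<integral>\<^sup>+y. f (- T v + y) * g y \<partial>lborel) \<partial>lborel)"
  proof (rule nn_integral_cong)
    fix v
    show "(\<integral>\<^sup>+y. f y * g (y + T v) \<partial>lborel) = (\<integral>\<^sup>+y. f (- T v + y) * g y \<partial>lborel)"
      using nn_integral_lborel_translation[of "\<lambda>y. f y * g (y + T v)" "- T v"] by simp
  qed
  also have "\<dots> = (\<integral>\<^sup>+y. (\<integral>\<^sup>+v. f (- T v + y) * g y \<partial>lborel) \<partial>lborel)"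
    by (rule lborel_pair.Fubini') measurable
  also have "\<dots> = (\<integral>\<^sup>+y. (\<integral>\<^sup>+v. f (y + T (- v)) \<partial>lborel) * g y \<partial>lborel)"
    by (simp add: nn_integral_multc linear_neg[OF T(1)] add.commute)
  also have "\<dots> = (\<integral>\<^sup>+y. (\<integral>\<^sup>+v. f (T v) \<partial>lborel) * g y \<partial>lborel)"
    by (intro nn_integral_cong) (simp add: nn_integral_lborel_reflection[of "\<lambda>v. f (_ + T v)"] shift)
  also have "\<dots> = (\<integral>\<^sup>+v. f (T v) \<partial>lborel) * (\<integral>\<^sup>+y. g y \<partial>lborel)"
    by (rule nn_integral_cmult) simp
  finally show ?thesis by (simp add: mult.commute)
qed

text \<open>Testing proportionality on the unit cube identifies the factor. The preimage of the cube
  is bounded, hence of finite measure; were it null, the integral of \<open>k (T v)\<close> would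
  vanish for every \<open>k\<close>, also for the \<open>k\<close> that turns it into the integral
  of the cube.\<close>

lemma lin_det_substitution:
  fixes T :: "'v::euclidean_space \<Rightarrow> 'v" and f :: "'v \<Rightarrow> ennreal"
  assumes T: "linear T" "bij T" and f[measurable]: "f \<in> borel_measurable borel"
  shows "(\<integral>\<^sup>+x. f x \<partial>lborel) = ennreal (lin_det T) * (\<integral>\<^sup>+x. f (T x) \<partial>lborel)" and "0 < lin_det T"
proof -
  let ?C = "cbox (0::'v) One"
  let ?S = "T -` ?C"
  obtain T' where T': "linear T'" "T' \<circ> T = id"
    using linear_injective_left_inverse[OF T(1) bij_is_inj[OF T(2)]] by blast
  have cont: "continuous_on UNIV T" if "linear T" for T :: "'v \<Rightarrow> 'v"
    using that linear_continuous_on linear_conv_bounded_linear by blast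
  have cl: "closed ?S" using cont[OF T(1)]
    by (intro continuous_closed_vimage closed_cbox) (simp add: continuous_on_eq_continuous_at)
  have "T' ` (T ` ?S) = ?S" unfolding image_comp T'(2) by simp
  moreover have "T ` ?S = ?C" using T(2) by (simp add: bij_is_surj surj_image_vimage_eq)
  ultimately have S: "?S = T' ` ?C" by simp
  then have "bounded ?S" using bounded_linear_image[of ?C T'] T'(1)
    by (simp add: linear_conv_bounded_linear)
  then have fin: "emeasure lborel ?S < \<infinity>" by (rule emeasure_bounded_finite)
  have [measurable]: "T \<in> borel_measurable borel" "?S \<in> sets borel"
    using cont[OF T(1)] cl by (auto intro: borel_measurable_continuous_onI)
  have C1: "(\<integral>\<^sup>+x. indicator ?C x \<partial>lborel) = (1::ennreal)" by (simp add: emeasure_lborel_cbox_eq)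
  have I: "(\<integral>\<^sup>+v. indicator ?C (T v) \<partial>lborel) = emeasure lborel ?S"
  proof -
    have "(\<lambda>v. indicator ?C (T v) :: ennreal) = indicator ?S" by (auto simp: fun_eq_iff indicator_def)
    then show ?thesis by simp
  qed
  have scale: "(\<integral>\<^sup>+x. k x \<partial>lborel) * emeasure lborel ?S = (\<integral>\<^sup>+v. k (T v) \<partial>lborel)"
    if "k \<in> borel_measurable borel" for k :: "'v \<Rightarrow> ennreal"
    using nn_integral_linear_proportional[OF T that, of "indicator ?C"] I C1 by simp
  have "emeasure lborel ?S \<noteq> 0"
  proof
    assume 0: "emeasure lborel ?S = 0"
    have "(\<lambda>x. indicator ?C (T' x)) \<in> borel_measurable borel"
      using borel_measurable_continuous_onI[OF cont[OF T'(1)]] by simp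
    from scale[OF this] have "(\<integral>\<^sup>+v. indicator ?C (T' (T v)) \<partial>lborel) = (0::ennreal)" by (simp add: 0)
    then show False using T'(2) C1 by (simp add: o_def fun_eq_iff)
  qed
  moreover have m2: "emeasure lborel ?S = ennreal (measure lborel ?S)"
    by (rule emeasure_eq_ennreal_measure) (use fin in auto)
  ultimately have m1: "0 < measure lborel ?S"
    using measure_nonneg[of lborel ?S] by (metis ennreal_0 less_eq_real_def)
  note m = m1 m2
  then show "0 < lin_det T" by (simp add: lin_det_def)
  have "ennreal (lin_det T) * emeasure lborel ?S = 1"
    unfolding m(2) lin_det_def using m(1) by (simp add: ennreal_mult[symmetric])
  then show "(\<integral>\<^sup>+x. f x \<partial>lborel) = ennreal (lin_det T) * (\<integral>\<^sup>+x. f (T x) \<partial>lborel)"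
    unfolding scale[OF f, symmetric] by (metis mult.commute mult.left_commute mult_1)
qed

section \<open>Coefficient space and slicing along a surjection\<close>

abbreviation coeff_lborel :: "nat \<Rightarrow> (nat \<Rightarrow> real) measure" where
  "coeff_lborel n \<equiv> \<Pi>\<^sub>M i\<in>{..<n}. lborel"

lemma sigma_finite_coeff_lborel: "sigma_finite_measure (coeff_lborel n)"
proof -
  interpret product_sigma_finite "\<lambda>_::nat. lborel :: real measure" by standard
  show ?thesis by (rule sigma_finite) simp
qed

text \<open>Indices from \<open>n\<close> on carry \<open>undefined\<close>; a translation that is 0
  there maps the space of the product measure to itself.\<close>

lemma measurable_translation_coeff:
  assumes "\<And>i. n \<le> i \<Longrightarrow> t i = 0"
  shows "(\<lambda>c i. c i + t i) \<in> measurable (coeff_lborel n) (coeff_lborel n)"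
proof (rule measurable_PiM_single')
  show "(\<lambda>c i. c i + t i) \<in> space (coeff_lborel n) \<rightarrow> (\<Pi>\<^sub>E i\<in>{..<n}. space lborel)"
    using assms by (auto simp: space_PiM PiE_def extensional_def)
qed measurable

lemma distr_translation_coeff:
  assumes t: "\<And>i. n \<le> i \<Longrightarrow> t i = 0"
  shows "distr (coeff_lborel n) (coeff_lborel n) (\<lambda>c i. c i + t i) = coeff_lborel n"
proof -
  interpret product_sigma_finite "\<lambda>_::nat. lborel :: real measure" by standard
  note [measurable] = measurable_translation_coeff[OF t]
  show ?thesis
  proof (rule PiM_eqI)
    fix S assume S: "\<And>i. i \<in> {..<n} \<Longrightarrow> S i \<in> sets (lborel :: real measure)"
    let ?S = "\<lambda>i. (\<lambda>x. x + t i) -` S i"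
    have S': "?S i \<in> sets borel" if "i < n" for i
      using S[of i] that measurable_sets[of "\<lambda>x. x + t i" borel borel "S i"] by simp
    have "(\<lambda>c i. c i + t i) -` (Pi\<^sub>E {..<n} S) \<inter> space (coeff_lborel n) = Pi\<^sub>E {..<n} ?S"
      using t by (auto simp: space_PiM PiE_def extensional_def Pi_def)
    then have "emeasure (distr (coeff_lborel n) (coeff_lborel n) (\<lambda>c i. c i + t i)) (Pi\<^sub>E {..<n} S) =
        emeasure (coeff_lborel n) (Pi\<^sub>E {..<n} ?S)"
      using S by (subst emeasure_distr) (auto intro!: sets_PiM_I_finite)
    also have "\<dots> = (\<Prod>i<n. emeasure lborel (?S i))"
      by (rule emeasure_PiM) (use S' in auto)
    also have "\<dots> = (\<Prod>i<n. emeasure lborel (S i))"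
    proof (rule prod.cong)
      fix i assume "i \<in> {..<n}"
      then have [measurable]: "S i \<in> sets borel" using S by simp
      have "emeasure lborel (S i) = emeasure (distr lborel borel ((+) (t i))) (S i)"
        by (simp add: lborel_distr_plus)
      also have "\<dots> = emeasure lborel (?S i)"
        by (subst emeasure_distr) (auto simp: vimage_def add.commute)
      finally show "emeasure lborel (?S i) = emeasure lborel (S i)" ..
    qed simp
    finally show "emeasure (distr (coeff_lborel n) (coeff_lborel n) (\<lambda>c i. c i + t i)) (Pi\<^sub>E {..<n} S) =
      (\<Prod>i<n. emeasure lborel (S i))" .
  qed auto
qed

lemma nn_integral_coeff_translation:
  assumes t: "\<And>i. n \<le> i \<Longrightarrow> t i = 0" and [measurable]: "f \<in> borel_measurable (coeff_lborel n)"
  shows "(\<integral>\<^sup>+c. f (\<lambda>i. c i + t i) \<partial>coeff_lborel n) = (\<integral>\<^sup>+c. f c \<partial>coeff_lborel n)"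
proof -
  note [measurable] = measurable_translation_coeff[OF t]
  have "(\<integral>\<^sup>+c. f c \<partial>coeff_lborel n) = (\<integral>\<^sup>+c. f c \<partial>(distr (coeff_lborel n) (coeff_lborel n) (\<lambda>c i. c i + t i)))"
    by (simp only: distr_translation_coeff[OF t])
  then show ?thesis by (simp add: nn_integral_distr)
qed

text \<open>For a surjection \<open>L : \<real>\<^sup>n \<rightarrow> \<real>\<^sup>k\<close> with columns \<open>a\<^sub>i\<close>, \<open>slice x\<close> moves a point into the fibre over \<open>x\<close>
  along the image of the adjoint of \<open>L\<close>. Integrating \<open>Q \<circ> slice x\<close> against a weight whose integral along
  each translate of that image is 1 yields the integral of \<open>Q\<close> over the fibre up to the factor \<open>det (L L\<^sup>*)\<close>,
  independently of the weight; no measure on the fibre is needed.\<close>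

locale spanning_family =
  fixes n :: nat and a :: "nat \<Rightarrow> real ^ 'k"
  assumes span: "\<And>x. \<exists>z. lin_comb n a z = x"
begin

text \<open>The adjoint of the surjection, extended by 0 so that translating by it preserves the
  coefficient space.\<close>

definition adj :: "real ^ 'k \<Rightarrow> nat \<Rightarrow> real" where
  "adj v i = (if i < n then a i \<bullet> v else 0)"

definition gram :: "real ^ 'k \<Rightarrow> real ^ 'k" where
  "gram v = (\<Sum>i<n. (a i \<bullet> v) *\<^sub>R a i)"

definition slice :: "real ^ 'k \<Rightarrow> (nat \<Rightarrow> real) \<Rightarrow> nat \<Rightarrow> real" where
  "slice x c = (\<lambda>i. c i + adj (inv gram (x - lin_comb n a c)) i)"

text \<open>The square block of the adjoint with rows \<open>\<iota>\<close>, so that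
  \<open>lin_det (minor_map \<iota>)\<close> is the modulus of a maximal minor when
  \<open>\<iota>\<close> is admissible.\<close>

definition minor_map :: "('k \<Rightarrow> nat) \<Rightarrow> real ^ 'k \<Rightarrow> real ^ 'k" where
  "minor_map \<iota> v = (\<chi> j. a (\<iota> j) \<bullet> v)"

definition weight :: "('k \<Rightarrow> nat) \<Rightarrow> (nat \<Rightarrow> real) \<Rightarrow> ennreal" where
  "weight \<iota> c = ennreal (lin_det (minor_map \<iota>)) * indicator (cbox 0 One) (\<chi> j. c (\<iota> j))"

definition admissible :: "('k \<Rightarrow> nat) \<Rightarrow> bool" where
  "admissible \<iota> \<longleftrightarrow> (\<forall>j. \<iota> j < n) \<and> inj (minor_map \<iota>)"

lemma orthogonal_zero: "(\<And>i. i < n \<Longrightarrow> a i \<bullet> v = 0) \<Longrightarrow> v = 0"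
proof -
  assume *: "\<And>i. i < n \<Longrightarrow> a i \<bullet> v = 0"
  obtain z where "lin_comb n a z = v" using span by blast
  then have "v \<bullet> v = (\<Sum>i<n. z i * (a i \<bullet> v))"
    by (metis (no_types, lifting) inner_scaleR_left inner_sum_left lin_comb_def sum.cong)
  then show "v = 0" using * by simp
qed

lemma gram_linear: "linear gram"
  by (rule linearI) (simp_all add: gram_def inner_add_right scaleR_left_distrib sum.distrib scaleR_sum_right)

lemma gram_pos: "v \<noteq> 0 \<Longrightarrow> 0 < gram v \<bullet> v"
proof -
  assume v: "v \<noteq> 0"
  have "gram v \<bullet> v = (\<Sum>i<n. (a i \<bullet> v)\<^sup>2)"
    by (simp add: gram_def inner_sum_left power2_eq_square)
  moreover have "(\<Sum>i<n. (a i \<bullet> v)\<^sup>2) \<noteq> 0"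
    using orthogonal_zero[of v] v by (auto simp: sum_nonneg_eq_0_iff)
  ultimately show ?thesis by (simp add: less_le sum_nonneg)
qed

lemma gram_inv: "gram (inv gram v) = v" "inv gram (gram v) = v" "linear (inv gram)" "bij gram"
  using positive_definite_inverse[OF gram_linear gram_pos] positive_definite_bij[OF gram_linear gram_pos] by auto

lemma lin_comb_shift: "lin_comb n a (\<lambda>i. c i + adj v i) = lin_comb n a c + gram v"
  by (simp add: lin_comb_def adj_def gram_def scaleR_left_distrib sum.distrib)

lemma lin_comb_slice [simp]: "lin_comb n a (slice x c) = x"
  by (simp add: slice_def lin_comb_shift gram_inv)

lemma adj_linear: "adj (v + w) i = adj v i + adj w i" "adj (- v) i = - adj v i"
  by (simp_all add: adj_def inner_add_right)

lemma adj_zero: "n \<le> i \<Longrightarrow> adj v i = 0"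
  by (simp add: adj_def)

text \<open>Points that differ by an element of the image of the adjoint land at the same point of
  the fibre. This is what allows weights to be averaged out.\<close>

lemma slice_shift: "slice x (\<lambda>i. c i + adj v i) = slice x c"
proof -
  have "inv gram (x - (lin_comb n a c + gram v)) = inv gram (x - lin_comb n a c) + - v"
    using gram_inv(2)[of v] by (simp add: linear_diff[OF gram_inv(3)] diff_diff_add[symmetric])
  then show ?thesis
    by (simp add: slice_def lin_comb_shift adj_linear del: add_uminus_conv_diff)
qed

text \<open>Writing the target as \<open>lin_comb n a c + gram v\<close> turns slicing into a
  translation along the adjoint; this is the substitution behind
  \<open>slice_disintegration\<close>, and it costs the factor \<open>lin_det gram\<close>.\<close>

lemma slice_base: "slice (lin_comb n a c + gram v) c = (\<lambda>i. c i + adj v i)"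
  by (simp add: slice_def gram_inv)

lemma minor_map_linear: "linear (minor_map \<iota>)"
  by (rule linearI) (simp_all add: minor_map_def inner_add_right vec_eq_iff)

lemma minor_map_bij: "admissible \<iota> \<Longrightarrow> bij (minor_map \<iota>)"
  using linear_injective_imp_surjective[OF minor_map_linear]
  by (auto simp: admissible_def bij_def)

text \<open>Some k of the spanning columns form a basis. A vector orthogonal to all of these is 0,
  so the block built from them is injective.\<close>

lemma admissible_exists: "\<exists>\<iota>. admissible \<iota>"
proof -
  obtain B where B: "B \<subseteq> a ` {..<n}" "independent B" "a ` {..<n} \<subseteq> span B"
    using maximal_independent_subset by blast
  have sp: "x \<in> span B" for x
  proof -
    obtain z where "lin_comb n a z = x" using span by blast
    moreover have "lin_comb n a z \<in> span B"
      unfolding lin_comb_def using B(3) by (intro span_sum span_scale) auto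
    ultimately show ?thesis by simp
  qed
  then have "span B = UNIV" by auto
  then have "card B = CARD('k)"
    using B(2) by (metis dim_UNIV dim_eq_card_independent dim_span DIM_cart DIM_real mult.right_neutral)
  then obtain f where f: "bij_betw f (UNIV :: 'k set) B"
    using finite_same_card_bij[of "UNIV :: 'k set" B] B(1) finite_subset[of B "a ` {..<n}"] by auto
  have "\<exists>i<n. a i = f j" for j
  proof -
    have "f j \<in> a ` {..<n}" using B(1) f by (auto simp: bij_betw_def)
    then show ?thesis by auto
  qed
  then obtain \<iota> where \<iota>: "\<And>j. \<iota> j < n" "\<And>j. a (\<iota> j) = f j" by metis
  have "v = 0" if "minor_map \<iota> v = 0" for v
  proof -
    have fj: "f j \<bullet> v = 0" for j
      using that by (simp add: minor_map_def vec_eq_iff \<iota>)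
    have "w \<bullet> v = 0" if "w \<in> span B" for w
      using that
    proof (induction rule: span_induct_alt)
      case (step c x y)
      then obtain j where "x = f j" using f by (auto simp: bij_betw_def)
      then show ?case using step fj by (simp add: inner_add_left)
    qed simp
    then show "v = 0" using sp[of v] by (metis inner_eq_zero_iff)
  qed
  then have "inj (minor_map \<iota>)"
    unfolding linear_injective_0[OF minor_map_linear] by blast
  then show ?thesis using \<iota>(1) by (auto simp: admissible_def)
qed

lemma measurable_lin_comb [measurable]: "lin_comb n a \<in> borel_measurable (coeff_lborel n)"
  unfolding lin_comb_def[abs_def] by measurable

lemma measurable_inv_gram [measurable]: "inv gram \<in> borel_measurable borel"
  using gram_inv(3) linear_continuous_on linear_conv_bounded_linear
  by (intro borel_measurable_continuous_onI) blast

lemma measurable_slice [measurable]: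
  "(\<lambda>(c, x). slice x c) \<in> measurable (coeff_lborel n \<Otimes>\<^sub>M borel) (coeff_lborel n)"
proof (rule measurable_PiM_single')
  show "(\<lambda>y i. (case y of (c, x) \<Rightarrow> slice x c) i) \<in> space (coeff_lborel n \<Otimes>\<^sub>M borel) \<rightarrow> (\<Pi>\<^sub>E i\<in>{..<n}. space lborel)"
    by (auto simp: space_PiM PiE_def extensional_def space_pair_measure slice_def adj_zero)
qed (auto simp: slice_def adj_def case_prod_beta intro!: borel_measurable_add borel_measurable_inner)

lemma measurable_slice1 [measurable]: "slice x \<in> measurable (coeff_lborel n) (coeff_lborel n)"
  using measurable_compose[OF measurable_Pair2'[of x borel] measurable_slice] by simp

lemma measurable_weight [measurable]:
  assumes "admissible \<iota>"
  shows "weight \<iota> \<in> borel_measurable (coeff_lborel n)"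
proof -
  have [measurable]: "(\<lambda>c. (\<chi> j. c (\<iota> j)) :: real ^ 'k) \<in> borel_measurable (coeff_lborel n)"
    using assms by (subst borel_measurable_euclidean_space) (auto simp: admissible_def Basis_vec_def inner_axis)
  show ?thesis unfolding weight_def[abs_def] by measurable
qed

lemma measurable_shift [measurable]:
  "(\<lambda>(c, v) i. c i + adj v i) \<in> measurable (coeff_lborel n \<Otimes>\<^sub>M borel) (coeff_lborel n)"
proof (rule measurable_PiM_single')
  show "(\<lambda>y i. (case y of (c, v) \<Rightarrow> \<lambda>i. c i + adj v i) i) \<in> space (coeff_lborel n \<Otimes>\<^sub>M borel) \<rightarrow> (\<Pi>\<^sub>E i\<in>{..<n}. space lborel)"
    by (auto simp: space_PiM PiE_def extensional_def space_pair_measure adj_zero)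
qed (auto simp: adj_def case_prod_beta)

text \<open>Translating \<open>c\<close> by \<open>adj v\<close> moves the coordinates selected by
  \<open>\<iota>\<close> by \<open>minor_map \<iota> v\<close>, and the determinant in
  \<open>weight\<close> cancels the change of variables.\<close>

lemma weight_integral:
  assumes \<iota>: "admissible \<iota>"
  shows "(\<integral>\<^sup>+v. weight \<iota> (\<lambda>i. c i + adj v i) \<partial>lborel) = 1"
proof -
  let ?M = "minor_map \<iota>"
  let ?c = "(\<chi> j. c (\<iota> j)) :: real ^ 'k"
  have [measurable]: "?M \<in> borel_measurable borel"
    using minor_map_linear by (intro borel_measurable_continuous_onI linear_continuous_on) (simp add: linear_conv_bounded_linear)
  have "weight \<iota> (\<lambda>i. c i + adj v i) = ennreal (lin_det ?M) * indicator (cbox 0 One) (?c + ?M v)" for v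
  proof -
    have "(\<chi> j. c (\<iota> j) + adj v (\<iota> j)) = ?c + ?M v"
      using \<iota> by (simp add: vec_eq_iff minor_map_def adj_def admissible_def)
    then show ?thesis by (simp add: weight_def)
  qed
  then have "(\<integral>\<^sup>+v. weight \<iota> (\<lambda>i. c i + adj v i) \<partial>lborel) =
     (\<integral>\<^sup>+v. ennreal (lin_det ?M) * indicator (cbox 0 One) (?c + ?M v) \<partial>lborel)" by simp
  also have "\<dots> = ennreal (lin_det ?M) * (\<integral>\<^sup>+v. indicator (cbox 0 One) (?c + ?M v) \<partial>lborel)"
    by (rule nn_integral_cmult) measurable
  also have "\<dots> = (\<integral>\<^sup>+y. indicator (cbox 0 One) (?c + y) \<partial>lborel)"
    by (rule lin_det_substitution(1)[OF minor_map_linear minor_map_bij[OF \<iota>], symmetric]) measurable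
  also have "\<dots> = (\<integral>\<^sup>+y. indicator (cbox 0 One) (y :: real ^ 'k) \<partial>lborel)"
    by (rule nn_integral_lborel_translation) simp
  also have "\<dots> = 1" by (simp add: emeasure_lborel_cbox_eq)
  finally show ?thesis .
qed

lemma weight_integral_minus:
  assumes \<iota>: "admissible \<iota>" and c: "c \<in> space (coeff_lborel n)"
  shows "(\<integral>\<^sup>+v. weight \<iota> (\<lambda>i. c i + adj (- v) i) \<partial>lborel) = 1"
proof -
  have "(\<lambda>v. weight \<iota> (\<lambda>i. c i + adj v i)) \<in> borel_measurable borel"
    using measurable_compose[OF measurable_compose[OF measurable_Pair1'[OF c, of borel] measurable_shift] measurable_weight[OF \<iota>]]
    by simp
  from nn_integral_lborel_reflection[OF this] show ?thesis by (simp add: weight_integral[OF \<iota>])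
qed

interpretation sf: sigma_finite_measure "coeff_lborel n" by (rule sigma_finite_coeff_lborel)
interpretation pair: pair_sigma_finite "coeff_lborel n" "lborel :: (real ^ 'k) measure" ..

text \<open>Fubini and the translation of \<open>c\<close> by \<open>- adj v\<close> move the shift
  from \<open>u\<close> to the other factors. With \<open>u\<close> a second weight and
  \<open>Q\<close> constant along the adjoint, one weight is exchanged for another; with
  \<open>Q\<close> equal to 1 the weight disappears.\<close>

lemma integral_against_weights:
  assumes \<iota>: "admissible \<iota>" and u[measurable]: "u \<in> borel_measurable (coeff_lborel n)"
    and Q[measurable]: "Q \<in> borel_measurable (coeff_lborel n)"
  shows "(\<integral>\<^sup>+c. Q c * (\<integral>\<^sup>+v. weight \<iota> c * u (\<lambda>i. c i + adj v i) \<partial>lborel) \<partial>coeff_lborel n) =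
    (\<integral>\<^sup>+c. u c * (\<integral>\<^sup>+v. Q (\<lambda>i. c i + adj (- v) i) * weight \<iota> (\<lambda>i. c i + adj (- v) i) \<partial>lborel) \<partial>coeff_lborel n)"
proof -
  note [measurable] = measurable_weight[OF \<iota>]
  have sh[measurable]: "(\<lambda>y. (\<lambda>i. fst y i + adj (snd y) i)) \<in> measurable (coeff_lborel n \<Otimes>\<^sub>M lborel) (coeff_lborel n)"
    using measurable_shift by (simp add: case_prod_beta)
  have sh2[measurable]: "(\<lambda>y. (\<lambda>i. fst y i + adj (- snd y) i)) \<in> measurable (coeff_lborel n \<Otimes>\<^sub>M lborel) (coeff_lborel n)"
  proof -
    have "(\<lambda>y. (fst y, - snd y)) \<in> measurable (coeff_lborel n \<Otimes>\<^sub>M borel) (coeff_lborel n \<Otimes>\<^sub>M (borel :: (real ^ 'k) measure))"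
      by measurable
    from measurable_compose[OF this measurable_shift] show ?thesis by simp
  qed
  have [measurable]: "(\<lambda>v. u (\<lambda>i. c i + adj v i)) \<in> borel_measurable lborel" if "c \<in> space (coeff_lborel n)" for c
    using measurable_compose[OF measurable_compose[OF measurable_Pair1'[OF that, of borel] measurable_shift] u]
    by simp
  have m2[measurable]: "(\<lambda>v. Q (\<lambda>i. c i + adj (- v) i) * weight \<iota> (\<lambda>i. c i + adj (- v) i)) \<in> borel_measurable lborel"
    if "c \<in> space (coeff_lborel n)" for c
  proof -
    have "(\<lambda>v. (\<lambda>i. c i + adj (- v) i)) \<in> measurable borel (coeff_lborel n)"
      using measurable_compose[OF measurable_compose[OF borel_measurable_uminus[OF measurable_ident] measurable_Pair1'[OF that, of borel]] measurable_shift]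
      by simp
    then show ?thesis by measurable
  qed
  have "(\<integral>\<^sup>+c. Q c * (\<integral>\<^sup>+v. weight \<iota> c * u (\<lambda>i. c i + adj v i) \<partial>lborel) \<partial>coeff_lborel n) =
    (\<integral>\<^sup>+c. (\<integral>\<^sup>+v. Q c * weight \<iota> c * u (\<lambda>i. c i + adj v i) \<partial>lborel) \<partial>coeff_lborel n)"
    by (intro nn_integral_cong) (simp add: nn_integral_cmult mult.assoc)
  also have "\<dots> = (\<integral>\<^sup>+v. (\<integral>\<^sup>+c. Q c * weight \<iota> c * u (\<lambda>i. c i + adj v i) \<partial>coeff_lborel n) \<partial>lborel)"
    by (rule pair.Fubini'[symmetric]) (simp add: case_prod_beta)
  also have "\<dots> = (\<integral>\<^sup>+v. (\<integral>\<^sup>+c. u c * (Q (\<lambda>i. c i + adj (- v) i) * weight \<iota> (\<lambda>i. c i + adj (- v) i)) \<partial>coeff_lborel n) \<partial>lborel)"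
  proof (rule nn_integral_cong)
    fix v :: "real ^ 'k"
    have [measurable]: "(\<lambda>c i. c i + adj (- v) i) \<in> measurable (coeff_lborel n) (coeff_lborel n)"
      by (rule measurable_translation_coeff) (simp add: adj_zero)
    have "(\<integral>\<^sup>+c. u c * (Q (\<lambda>i. c i + adj (- v) i) * weight \<iota> (\<lambda>i. c i + adj (- v) i)) \<partial>coeff_lborel n) =
      (\<integral>\<^sup>+c. u (\<lambda>i. c i + adj v i) * (Q (\<lambda>i. (c i + adj v i) + adj (- v) i) *
         weight \<iota> (\<lambda>i. (c i + adj v i) + adj (- v) i)) \<partial>coeff_lborel n)"
      by (rule nn_integral_coeff_translation[symmetric, where t = "adj v"]) (auto simp: adj_zero)
    then show "(\<integral>\<^sup>+c. Q c * weight \<iota> c * u (\<lambda>i. c i + adj v i) \<partial>coeff_lborel n) =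
      (\<integral>\<^sup>+c. u c * (Q (\<lambda>i. c i + adj (- v) i) * weight \<iota> (\<lambda>i. c i + adj (- v) i)) \<partial>coeff_lborel n)"
      by (simp add: adj_linear mult_ac)
  qed
  also have "\<dots> = (\<integral>\<^sup>+c. (\<integral>\<^sup>+v. u c * (Q (\<lambda>i. c i + adj (- v) i) * weight \<iota> (\<lambda>i. c i + adj (- v) i)) \<partial>lborel) \<partial>coeff_lborel n)"
    by (rule pair.Fubini') (simp add: case_prod_beta)
  also have "\<dots> = (\<integral>\<^sup>+c. u c * (\<integral>\<^sup>+v. Q (\<lambda>i. c i + adj (- v) i) * weight \<iota> (\<lambda>i. c i + adj (- v) i) \<partial>lborel) \<partial>coeff_lborel n)"
    by (intro nn_integral_cong nn_integral_cmult m2)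
  finally show ?thesis .
qed

lemma slice_integral_independent:
  assumes \<iota>: "admissible \<iota>" "admissible \<kappa>" and Q: "Q \<in> borel_measurable (coeff_lborel n)"
  shows "(\<integral>\<^sup>+c. weight \<iota> c * Q (slice x c) \<partial>coeff_lborel n) = (\<integral>\<^sup>+c. weight \<kappa> c * Q (slice x c) \<partial>coeff_lborel n)"
proof -
  note [measurable] = Q measurable_weight[OF \<iota>(1)] measurable_weight[OF \<iota>(2)]
  have QS: "(\<lambda>c. Q (slice x c)) \<in> borel_measurable (coeff_lborel n)"
    by measurable
  have ms: "(\<lambda>v. weight \<kappa> (\<lambda>i. c i + adj v i)) \<in> borel_measurable lborel"
    "(\<lambda>v. weight \<iota> (\<lambda>i. c i + adj (- v) i)) \<in> borel_measurable lborel" if "c \<in> space (coeff_lborel n)" for c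
    using measurable_compose[OF measurable_compose[OF measurable_Pair1'[OF that, of borel] measurable_shift] measurable_weight[OF \<iota>(2)]]
      measurable_compose[OF measurable_compose[OF measurable_compose[OF borel_measurable_uminus[OF measurable_ident] measurable_Pair1'[OF that, of borel]] measurable_shift] measurable_weight[OF \<iota>(1)]]
    by simp_all
  have "(\<integral>\<^sup>+c. weight \<iota> c * Q (slice x c) \<partial>coeff_lborel n) =
    (\<integral>\<^sup>+c. Q (slice x c) * (\<integral>\<^sup>+v. weight \<iota> c * weight \<kappa> (\<lambda>i. c i + adj v i) \<partial>lborel) \<partial>coeff_lborel n)"
    using ms by (intro nn_integral_cong) (simp add: nn_integral_cmult weight_integral[OF \<iota>(2)] mult.commute)
  also have "\<dots> = (\<integral>\<^sup>+c. weight \<kappa> c * (\<integral>\<^sup>+v. Q (slice x (\<lambda>i. c i + adj (- v) i)) * weight \<iota> (\<lambda>i. c i + adj (- v) i) \<partial>lborel) \<partial>coeff_lborel n)"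
    by (rule integral_against_weights[OF \<iota>(1) measurable_weight[OF \<iota>(2)] QS])
  also have "\<dots> = (\<integral>\<^sup>+c. weight \<kappa> c * Q (slice x c) \<partial>coeff_lborel n)"
    using ms by (intro nn_integral_cong) (simp add: slice_shift nn_integral_cmult weight_integral_minus[OF \<iota>(1)])
  finally show ?thesis .
qed

lemma slice_disintegration:
  assumes \<iota>: "admissible \<iota>" and Q: "Q \<in> borel_measurable (coeff_lborel n)"
  shows "(\<integral>\<^sup>+x. (\<integral>\<^sup>+c. weight \<iota> c * Q (slice x c) \<partial>coeff_lborel n) \<partial>lborel) =
    ennreal (lin_det gram) * (\<integral>\<^sup>+c. Q c \<partial>coeff_lborel n)"
proof -
  note [measurable] = Q measurable_weight[OF \<iota>]
  have ms: "(\<lambda>y. slice (snd y) (fst y)) \<in> measurable (coeff_lborel n \<Otimes>\<^sub>M lborel) (coeff_lborel n)"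
    using measurable_slice by (simp add: case_prod_beta)
  have QS: "(\<lambda>y. Q (slice (snd y) (fst y))) \<in> borel_measurable (coeff_lborel n \<Otimes>\<^sub>M lborel)"
    by (rule measurable_compose[OF ms Q])
  have QS1: "(\<lambda>x. Q (slice x c)) \<in> borel_measurable borel" if "c \<in> space (coeff_lborel n)" for c
    using measurable_compose[OF measurable_compose[OF measurable_Pair1'[OF that, of borel] measurable_slice] Q]
    by simp
  have mv: "(\<lambda>v. Q (\<lambda>i. c i + adj v i)) \<in> borel_measurable lborel"
    if "c \<in> space (coeff_lborel n)" for c
    using measurable_compose[OF measurable_compose[OF measurable_Pair1'[OF that, of borel] measurable_shift] Q]
    by simp
  have shm: "(\<lambda>c. \<integral>\<^sup>+v. Q (\<lambda>i. c i + adj v i) \<partial>lborel) \<in> borel_measurable (coeff_lborel n)"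
    using measurable_compose[OF measurable_shift Q]
    by (intro lborel.borel_measurable_nn_integral) (simp add: case_prod_beta)
  have "(\<integral>\<^sup>+x. (\<integral>\<^sup>+c. weight \<iota> c * Q (slice x c) \<partial>coeff_lborel n) \<partial>lborel) =
    (\<integral>\<^sup>+c. (\<integral>\<^sup>+x. weight \<iota> c * Q (slice x c) \<partial>lborel) \<partial>coeff_lborel n)"
    by (rule pair.Fubini') (use QS in \<open>simp add: case_prod_beta\<close>)
  also have "\<dots> = (\<integral>\<^sup>+c. ennreal (lin_det gram) * (\<integral>\<^sup>+v. weight \<iota> c * Q (\<lambda>i. c i + adj v i) \<partial>lborel) \<partial>coeff_lborel n)"
  proof (rule nn_integral_cong)
    fix c assume c: "c \<in> space (coeff_lborel n)"
    have "(\<integral>\<^sup>+x. Q (slice x c) \<partial>lborel) = (\<integral>\<^sup>+x. Q (slice (lin_comb n a c + x) c) \<partial>lborel)"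
      by (rule nn_integral_lborel_translation[symmetric, OF QS1[OF c]])
    also have "\<dots> = ennreal (lin_det gram) * (\<integral>\<^sup>+v. Q (slice (lin_comb n a c + gram v) c) \<partial>lborel)"
      by (rule lin_det_substitution(1)[OF gram_linear gram_inv(4)])
        (rule measurable_compose[OF _ QS1[OF c]], simp)
    finally show "(\<integral>\<^sup>+x. weight \<iota> c * Q (slice x c) \<partial>lborel) =
      ennreal (lin_det gram) * (\<integral>\<^sup>+v. weight \<iota> c * Q (\<lambda>i. c i + adj v i) \<partial>lborel)"
      using QS1[OF c] mv[OF c] by (simp add: nn_integral_cmult slice_base mult_ac)
  qed
  also have "\<dots> = ennreal (lin_det gram) * (\<integral>\<^sup>+c. 1 * (\<integral>\<^sup>+v. weight \<iota> c * Q (\<lambda>i. c i + adj v i) \<partial>lborel) \<partial>coeff_lborel n)"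
    using mv shm by (subst nn_integral_cmult[symmetric]) (auto simp: nn_integral_cmult cong: measurable_cong intro!: nn_integral_cong)
  also have "(\<integral>\<^sup>+c. 1 * (\<integral>\<^sup>+v. weight \<iota> c * Q (\<lambda>i. c i + adj v i) \<partial>lborel) \<partial>coeff_lborel n) =
    (\<integral>\<^sup>+c. Q c * (\<integral>\<^sup>+v. 1 * weight \<iota> (\<lambda>i. c i + adj (- v) i) \<partial>lborel) \<partial>coeff_lborel n)"
    by (rule integral_against_weights[OF \<iota> Q, where Q = "\<lambda>_. 1"]) simp
  also have "\<dots> = (\<integral>\<^sup>+c. Q c \<partial>coeff_lborel n)"
    by (intro nn_integral_cong) (simp add: weight_integral_minus[OF \<iota>])
  finally show ?thesis .
qed

end

lemma tendsto_componentwise_fun: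
  fixes f :: "'i \<Rightarrow> 'j \<Rightarrow> 'b::topological_space"
  shows "(f \<longlongrightarrow> l) F \<longleftrightarrow> (\<forall>j. ((\<lambda>i. f i j) \<longlongrightarrow> l j) F)"
  using limitin_componentwise[of "\<lambda>_::'j. euclidean :: 'b topology" UNIV f l F]
  by (simp add: euclidean_product_topology)

section \<open>Integrability of power decay\<close>

lemma nn_integral_power_decay_finite:
  assumes "1 < \<gamma>"
  shows "(\<integral>\<^sup>+t. ennreal ((1 + \<bar>t\<bar>) powr (- \<gamma>)) \<partial>(lborel :: real measure)) < \<infinity>"
proof -
  let ?f = "\<lambda>t::real. (1 + \<bar>t\<bar>) powr (- \<gamma>)"
  let ?F = "\<lambda>t::real. (1 + t) powr (1 - \<gamma>) / (1 - \<gamma>)"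
  have half: "(\<integral>\<^sup>+t. ennreal (?f t) * indicator {0..} t \<partial>lborel) = ennreal (0 - ?F 0)"
  proof -
    have "(\<integral>\<^sup>+t. ennreal ((1 + t) powr (- \<gamma>)) * indicator {0..} t \<partial>lborel) = ennreal (0 - ?F 0)"
    proof (rule nn_integral_FTC_atLeast)
      show "(?F has_real_derivative (1 + t) powr (- \<gamma>)) (at t)" if "0 \<le> t" for t
      proof -
        have "((\<lambda>t. 1 + t) has_real_derivative 1) (at t)" by (auto intro!: derivative_eq_intros)
        from DERIV_cdivide[OF DERIV_fun_powr[OF this, of "1 - \<gamma>"], of "1 - \<gamma>"] that assms
        show ?thesis by simp
      qed
      have "((\<lambda>t. (1 + t) powr (1 - \<gamma>)) \<longlongrightarrow> 0) at_top"
        by (rule tendsto_neg_powr) (use assms in \<open>auto intro: filterlim_tendsto_add_at_top tendsto_const filterlim_ident\<close>)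
      from tendsto_divide[OF this tendsto_const[of "1 - \<gamma>"]] assms
      show "(?F \<longlongrightarrow> 0) at_top" by simp
    qed auto
    moreover have "(\<integral>\<^sup>+t. ennreal (?f t) * indicator {0..} t \<partial>lborel) =
       (\<integral>\<^sup>+t. ennreal ((1 + t) powr (- \<gamma>)) * indicator {0..} t \<partial>lborel)"
      by (intro nn_integral_cong) (auto simp: indicator_def)
    ultimately show ?thesis by simp
  qed
  have "(\<integral>\<^sup>+t. ennreal (?f t) \<partial>lborel) \<le>
      (\<integral>\<^sup>+t. ennreal (?f t) * indicator {0..} t + ennreal (?f (- t)) * indicator {0..} (- t) \<partial>lborel)"
    by (intro nn_integral_mono) (auto simp: indicator_def)
  also have "\<dots> = (\<integral>\<^sup>+t. ennreal (?f t) * indicator {0..} t \<partial>lborel) +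
      (\<integral>\<^sup>+t. ennreal (?f (- t)) * indicator {0..} (- t) \<partial>lborel)"
    by (rule nn_integral_add) auto
  also have "(\<integral>\<^sup>+t. ennreal (?f (- t)) * indicator {0..} (- t) \<partial>lborel) =
      (\<integral>\<^sup>+t. ennreal (?f t) * indicator {0..} t \<partial>lborel)"
    by (rule nn_integral_lborel_reflection[of "\<lambda>t. ennreal (?f t) * indicator {0..} t"]) simp
  also have "(\<integral>\<^sup>+t. ennreal (?f t) * indicator {0..} t \<partial>lborel) +
      (\<integral>\<^sup>+t. ennreal (?f t) * indicator {0..} t \<partial>lborel) < \<infinity>"
    unfolding half by (simp add: ennreal_plus[symmetric] del: ennreal_plus)
  finally show ?thesis .
qed

definition coeff_size :: "nat \<Rightarrow> (nat \<Rightarrow> real) \<Rightarrow> real" where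
  "coeff_size n c = (\<Sum>i<n. \<bar>c i\<bar>)"

lemma coeff_size_nonneg [simp]: "0 \<le> coeff_size n c"
  by (simp add: coeff_size_def sum_nonneg)

lemma abs_le_coeff_size: "i < n \<Longrightarrow> \<bar>c i\<bar> \<le> coeff_size n c"
  unfolding coeff_size_def by (rule member_le_sum) auto

lemma measurable_coeff_size [measurable]: "coeff_size n \<in> borel_measurable (coeff_lborel n)"
  unfolding coeff_size_def[abs_def] by measurable

text \<open>On the slab \<open>c\<^sub>i \<in> [0,1]\<close> (\<open>i \<in> I\<close>), the decay is dominated by a product of integrable functions
  of single coordinates.\<close>

lemma slab_decay_integrable:
  assumes I: "I \<subseteq> {..<n}" and \<beta>: "real (n - card I) < \<beta>"
  shows "(\<integral>\<^sup>+c. ennreal ((1 + coeff_size n c) powr (- \<beta>)) * indicator {c. \<forall>i\<in>I. 0 \<le> c i \<and> c i \<le> 1} c \<partial>coeff_lborel n) < \<infinity>"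
proof -
  interpret product_sigma_finite "\<lambda>_::nat. lborel :: real measure" by standard
  let ?J = "{..<n} - I"
  have finI: "finite I" using I finite_subset by blast
  have cJ: "card ?J = n - card I" using I by (simp add: card_Diff_subset finI)
  \<comment> \<open>The exponent \<beta> is shared equally among the free coordinates; as it exceeds
    their number, each gets more than 1. With no free coordinate the product over \<open>?J\<close>
    is empty and 2 is an arbitrary exponent above 1.\<close>
  define \<gamma> where "\<gamma> = (if ?J = {} then 2 else \<beta> / real (card ?J))"
  have \<gamma>: "1 < \<gamma>" "\<gamma> * real (card ?J) \<le> \<beta>"
  proof -
    have "0 < card ?J" if "?J \<noteq> {}" using that by (simp add: card_gt_0_iff)
    then show "1 < \<gamma>" using \<beta> cJ by (auto simp: \<gamma>_def field_simps)
    show "\<gamma> * real (card ?J) \<le> \<beta>"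
    proof (cases "?J = {}")
      case True
      then have "card ?J = 0" by (metis card.empty)
      then show ?thesis using \<beta> cJ by (metis less_eq_real_def mult_zero_right of_nat_0)
    next
      case False
      then show ?thesis by (simp add: \<gamma>_def card_gt_0_iff)
    qed
  qed
  define f where "f i t = (if i \<in> I then indicator {0..1} t else ennreal ((1 + \<bar>t\<bar>) powr (- \<gamma>)))" for i :: nat and t :: real
  have f[measurable]: "f i \<in> borel_measurable lborel" for i unfolding f_def[abs_def] by measurable
  have bound: "ennreal ((1 + coeff_size n c) powr (- \<beta>)) * indicator {c. \<forall>i\<in>I. 0 \<le> c i \<and> c i \<le> 1} c \<le> (\<Prod>i<n. f i (c i))" for c
  proof (cases "\<forall>i\<in>I. 0 \<le> c i \<and> c i \<le> 1")
    case True
    have "(1 + coeff_size n c) powr (- \<beta>) \<le> (1 + coeff_size n c) powr (- (\<gamma> * real (card ?J)))"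
      using \<gamma>(2) by (intro powr_mono) auto
    also have "\<dots> = (\<Prod>i\<in>?J. (1 + coeff_size n c) powr (- \<gamma>))"
    proof -
      have "0 < 1 + coeff_size n c" by (simp add: add_pos_nonneg)
      then show ?thesis
        by (simp only: prod_constant powr_realpow[symmetric] powr_gt_zero powr_powr) (simp add: powr_powr powr_realpow[symmetric])
    qed
    also have "\<dots> \<le> (\<Prod>i\<in>?J. (1 + \<bar>c i\<bar>) powr (- \<gamma>))"
      using \<gamma>(1) abs_le_coeff_size[of _ n c] by (intro prod_mono conjI powr_mono2') auto
    finally have "ennreal ((1 + coeff_size n c) powr (- \<beta>)) \<le> (\<Prod>i\<in>?J. ennreal ((1 + \<bar>c i\<bar>) powr (- \<gamma>)))"
      by (subst prod_ennreal) (auto intro: ennreal_leI)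
    also have "\<dots> = (\<Prod>i\<in>?J. f i (c i)) * (\<Prod>i\<in>I. f i (c i))"
      using True by (simp add: f_def)
    also have "\<dots> = (\<Prod>i<n. f i (c i))"
      using I by (metis prod.subset_diff finite_lessThan)
    finally show ?thesis using True by simp
  qed simp
  have "(\<integral>\<^sup>+c. ennreal ((1 + coeff_size n c) powr (- \<beta>)) * indicator {c. \<forall>i\<in>I. 0 \<le> c i \<and> c i \<le> 1} c \<partial>coeff_lborel n) \<le>
     (\<integral>\<^sup>+c. (\<Prod>i<n. f i (c i)) \<partial>coeff_lborel n)"
    by (intro nn_integral_mono bound)
  also have "\<dots> = (\<Prod>i<n. \<integral>\<^sup>+t. f i t \<partial>lborel)"
    by (rule product_nn_integral_prod) auto
  also have "\<dots> < \<infinity>"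
  proof -
    have "(\<integral>\<^sup>+t. f i t \<partial>lborel) < \<infinity>" for i
      using nn_integral_power_decay_finite[OF \<gamma>(1)] by (cases "i \<in> I") (simp_all add: f_def)
    then show ?thesis by (simp add: less_top[symmetric] ennreal_prod_eq_top)
  qed
  finally show ?thesis .
qed

text \<open>An indicator of a cube behaves badly under limits at its boundary. The continuous tent
  \<open>?g\<close> yields the same factor as a quotient of integrals, and dominated convergence
  applies because coercivity keeps the supports in one ball.\<close>

lemma lin_det_tendsto:
  fixes T :: "nat \<Rightarrow> 'v::euclidean_space \<Rightarrow> 'v"
  assumes T: "eventually (\<lambda>i. linear (T i) \<and> bij (T i)) sequentially" and T0: "linear T0" "bij T0"
    and lim: "\<And>v. (\<lambda>i. T i v) \<longlonglongrightarrow> T0 v"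
  shows "(\<lambda>i. lin_det (T i)) \<longlonglongrightarrow> lin_det T0"
proof -
  let ?g = "\<lambda>y::'v. max 0 (1 - norm y)"
  let ?G = "\<lambda>T::'v \<Rightarrow> 'v. \<integral>\<^sup>+v. ennreal (?g (T v)) \<partial>lborel"
  define m where "m = (\<integral>\<^sup>+v. ennreal (?g v) \<partial>lborel)"
  have cont: "continuous_on UNIV S" if "linear S" for S :: "'v \<Rightarrow> 'v"
    using that linear_continuous_on linear_conv_bounded_linear by blast
  have "eventually (\<lambda>i. linear (T i)) sequentially" using T by eventually_elim simp
  from coercive_family[OF this T0(1) bij_is_inj[OF T0(2)] lim]
  obtain a where a: "0 < a" "eventually (\<lambda>i. \<forall>v. a * norm v \<le> norm (T i v)) sequentially" by blast
  obtain N where N: "\<And>i. N \<le> i \<Longrightarrow> linear (T i) \<and> bij (T i) \<and> (\<forall>v. a * norm v \<le> norm (T i v))"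
    using eventually_conj[OF T a(2)] unfolding eventually_sequentially by blast
  let ?T = "\<lambda>i. T (i + N)"
  have TN: "linear (?T i)" "bij (?T i)" "\<And>v. a * norm v \<le> norm (?T i v)" for i using N[of "i + N"] by auto
  have m_sub: "m = ennreal (lin_det S) * ?G S" if "linear S" "bij S" for S :: "'v \<Rightarrow> 'v"
    unfolding m_def by (rule lin_det_substitution(1)[OF that]) simp
  have m_fin: "m < \<infinity>"
  proof -
    have "m \<le> (\<integral>\<^sup>+v. indicator (cball (0::'v) 1) v \<partial>lborel)"
      unfolding m_def by (intro nn_integral_mono) (auto simp: indicator_def max_def)
    also have "\<dots> < \<infinity>" using emeasure_bounded_finite[of "cball (0::'v) 1"] by simp
    finally show ?thesis .
  qed
  have m_pos: "m \<noteq> 0"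
  proof
    assume "m = 0"
    then have "emeasure lborel {v \<in> space lborel. ennreal (?g v) \<noteq> 0} = 0"
      unfolding m_def by (subst (asm) nn_integral_0_iff) auto
    moreover have "{v \<in> space lborel. ennreal (?g v) \<noteq> 0} = ball 0 1" by (auto simp: max_def)
    ultimately have "negligible (ball (0::'v) 1)"
      by (simp add: negligible_iff_null_sets null_setsI null_sets_completionI)
    then show False using open_not_negligible[of "ball (0::'v) 1"] by simp
  qed
  have G_lim: "(\<lambda>i. ?G (?T i)) \<longlonglongrightarrow> ?G T0"
  proof (rule nn_integral_dominated_convergence[where w = "indicator (cball 0 (1 / a))"])
    show "(\<lambda>v. ennreal (?g (?T i v))) \<in> borel_measurable lborel" for i
      using borel_measurable_continuous_onI[OF cont[OF TN(1)]] by simp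
    show "(\<lambda>v. ennreal (?g (T0 v))) \<in> borel_measurable lborel"
      using borel_measurable_continuous_onI[OF cont[OF T0(1)]] by simp
    show "AE v in lborel. ennreal (?g (?T i v)) \<le> indicator (cball 0 (1 / a)) v" for i
    proof (rule AE_I2)
      fix v
      have "norm v \<le> 1 / a" if "norm (?T i v) < 1"
        using TN(3)[of v i] that a(1) by (simp add: field_simps)
      then show "ennreal (?g (?T i v)) \<le> indicator (cball 0 (1 / a)) v"
        by (cases "norm (?T i v) < 1") (auto simp: indicator_def max_def)
    qed
    show "AE v in lborel. (\<lambda>i. ennreal (?g (?T i v))) \<longlonglongrightarrow> ennreal (?g (T0 v))"
      by (intro AE_I2 tendsto_ennrealI tendsto_intros LIMSEQ_ignore_initial_segment[OF lim])
    show "(\<integral>\<^sup>+v. indicator (cball 0 (1 / a)) v \<partial>(lborel :: 'v measure)) < \<infinity>"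
      using emeasure_bounded_finite[of "cball (0::'v) (1 / a)"] by simp
    show "indicator (cball 0 (1 / a)) \<in> borel_measurable (lborel :: 'v measure)"
      by (intro borel_measurable_indicator) simp
  qed
  have G: "?G S < \<infinity>" "?G S \<noteq> 0" "lin_det S = enn2real m / enn2real (?G S)" if S: "linear S" "bij S" for S
  proof -
    have p: "0 < lin_det S" by (rule lin_det_substitution(2)[OF S, of "\<lambda>_. 0"]) simp
    show 1: "?G S < \<infinity>" "?G S \<noteq> 0"
      using m_sub[OF S] m_fin m_pos p by (auto simp: ennreal_mult_eq_top_iff less_top[symmetric])
    have "enn2real m = lin_det S * enn2real (?G S)"
      unfolding m_sub[OF S] using p by (simp add: enn2real_mult)
    moreover have "enn2real (?G S) \<noteq> 0" using 1 by (simp add: enn2real_eq_0_iff less_top[symmetric])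
    ultimately show "lin_det S = enn2real m / enn2real (?G S)" by simp
  qed
  have "(\<lambda>i. enn2real m / enn2real (?G (?T i))) \<longlonglongrightarrow> enn2real m / enn2real (?G T0)"
    using G(1,2)[OF T0] G_lim
    by (intro tendsto_divide tendsto_const tendsto_enn2real) (auto simp: enn2real_eq_0_iff less_top[symmetric])
  then have "(\<lambda>i. lin_det (?T i)) \<longlonglongrightarrow> lin_det T0"
    using G(3)[OF TN(1,2)] G(3)[OF T0] by simp
  then show ?thesis by (rule LIMSEQ_offset)
qed

section \<open>Slices depending on a base point\<close>

locale spanning_sections =
  fixes n :: nat and b :: "nat \<Rightarrow> 'a::{t2_space, second_countable_topology} \<Rightarrow> real ^ 'k"
  assumes spanning: "\<And>p. spanning_family n (\<lambda>i. b i p)"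
    and continuous: "\<And>i p. i < n \<Longrightarrow> isCont (b i) p"
begin

sublocale S: spanning_family n "\<lambda>i. b i p" for p by (rule spanning)

lemma b_tendsto: "i < n \<Longrightarrow> (q \<longlongrightarrow> p) F \<Longrightarrow> ((\<lambda>l. b i (q l)) \<longlongrightarrow> b i p) F"
  using continuous isCont_tendsto_compose by blast

lemma slice_tendsto:
  assumes q: "(q \<longlongrightarrow> p) F" and x: "(x \<longlongrightarrow> x0) F"
  shows "((\<lambda>l. S.slice (q l) (x l) c) \<longlongrightarrow> S.slice p x0 c) F"
  unfolding tendsto_componentwise_fun
proof
  fix j
  have g: "((\<lambda>l. S.gram (q l) v) \<longlongrightarrow> S.gram p v) F" for v
    unfolding S.gram_def by (intro tendsto_intros b_tendsto[OF _ q]) auto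
  have "((\<lambda>l. x l - lin_comb n (\<lambda>i. b i (q l)) c) \<longlongrightarrow> x0 - lin_comb n (\<lambda>i. b i p) c) F"
    unfolding lin_comb_def by (intro tendsto_intros b_tendsto[OF _ q] x) auto
  from tendsto_inverse_operator(1)[OF _ S.gram_linear S.gram_pos g this]
  have i: "((\<lambda>l. inv (S.gram (q l)) (x l - lin_comb n (\<lambda>i. b i (q l)) c)) \<longlongrightarrow>
      inv (S.gram p) (x0 - lin_comb n (\<lambda>i. b i p) c)) F"
    using S.gram_linear S.gram_pos by (simp add: always_eventually)
  show "((\<lambda>l. S.slice (q l) (x l) c j) \<longlongrightarrow> S.slice p x0 c j) F"
    unfolding S.slice_def S.adj_def
    by (cases "j < n") (auto intro!: tendsto_intros b_tendsto[OF _ q] i)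
qed

lemma minor_map_tendsto:
  assumes "\<And>j. \<iota> j < n" "(q \<longlongrightarrow> p) F"
  shows "((\<lambda>l. S.minor_map (q l) \<iota> v) \<longlongrightarrow> S.minor_map p \<iota> v) F"
  unfolding S.minor_map_def by (intro tendsto_intros b_tendsto[OF assms(1) assms(2)])

text \<open>On the slab the coordinates of \<open>c\<close> selected by \<open>\<iota>\<close> are
  bounded, so those of the slice control \<open>minor_map q \<iota> v\<close>, hence by coercivity
  the displacement \<open>v\<close> and with it every coordinate of \<open>c\<close>. The target
  \<open>x\<close> enters through \<open>v\<close> alone, so the constant is independent of
  it.\<close>

lemma slice_lower_bound:
  assumes \<iota>: "S.admissible p \<iota>"
  shows "\<exists>K\<ge>1. eventually (\<lambda>q. S.admissible q \<iota> \<and> (\<forall>x c. (\<forall>j. 0 \<le> c (\<iota> j) \<and> c (\<iota> j) \<le> 1) \<longrightarrow>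
     1 + coeff_size n c \<le> K * (1 + coeff_size n (S.slice q x c)))) (nhds p)"
proof -
  have \<iota>n: "\<And>j. \<iota> j < n" and inj: "inj (S.minor_map p \<iota>)" using \<iota> by (auto simp: S.admissible_def)
  have id: "((\<lambda>q. q) \<longlongrightarrow> p) (nhds p)" by (simp add: filterlim_ident)
  obtain a where a: "0 < a" "eventually (\<lambda>q. \<forall>v. a * norm v \<le> norm (S.minor_map q \<iota> v)) (nhds p)"
    using coercive_family[OF _ S.minor_map_linear inj minor_map_tendsto[OF \<iota>n id]] S.minor_map_linear
    by (auto simp: always_eventually)
  define B where "B = (\<Sum>i<n. norm (b i p)) + 1"
  have "((\<lambda>q. \<Sum>i<n. norm (b i q)) \<longlongrightarrow> (\<Sum>i<n. norm (b i p))) (nhds p)"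
    by (intro tendsto_intros b_tendsto[OF _ id]) auto
  then have B: "eventually (\<lambda>q. (\<Sum>i<n. norm (b i q)) < B) (nhds p)"
    by (rule order_tendstoD(2)) (simp add: B_def)
  have B0: "0 \<le> B" by (simp add: B_def sum_nonneg)
  define k where "k = real CARD('k)"
  \<comment> \<open>Each of the k coordinates of \<open>minor_map\<close> is at most
    \<open>1 + s\<close>, which gives \<open>norm v \<le> (k / a) * (1 + s)\<close>;
    \<open>B\<close> bounds the sum of the \<open>norm (b i q)\<close>.\<close>
  define K where "K = 1 + B * (k / a)"
  have "eventually (\<lambda>q. S.admissible q \<iota> \<and> (\<forall>x c. (\<forall>j. 0 \<le> c (\<iota> j) \<and> c (\<iota> j) \<le> 1) \<longrightarrow>
     1 + coeff_size n c \<le> K * (1 + coeff_size n (S.slice q x c)))) (nhds p)"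
    using a(2) B
  proof eventually_elim
    case (elim q)
    have "S.minor_map q \<iota> v = 0 \<Longrightarrow> v = 0" for v
      using elim(1)[rule_format, of v] a(1) by (simp add: mult_le_0_iff)
    then have adm: "S.admissible q \<iota>"
      unfolding S.admissible_def linear_injective_0[OF S.minor_map_linear] using \<iota>n by blast
    have "1 + coeff_size n c \<le> K * (1 + coeff_size n (S.slice q x c))"
      if c: "\<forall>j. 0 \<le> c (\<iota> j) \<and> c (\<iota> j) \<le> 1" for x c
    proof -
      define s where "s = coeff_size n (S.slice q x c)"
      define v where "v = inv (S.gram q) (x - lin_comb n (\<lambda>i. b i q) c)"
      have sl: "S.slice q x c i = c i + b i q \<bullet> v" if "i < n" for i
        using that by (simp add: S.slice_def S.adj_def v_def)
      have s0: "0 \<le> s" by (simp add: s_def)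
      have "a * norm v \<le> norm (S.minor_map q \<iota> v)" using elim(1) by blast
      also have "\<dots> \<le> (\<Sum>j\<in>UNIV. \<bar>S.minor_map q \<iota> v $ j\<bar>)" by (rule norm_le_l1_cart)
      also have "\<dots> \<le> (\<Sum>j\<in>(UNIV::'k set). 1 + s)"
      proof (rule sum_mono)
        fix j
        have "S.minor_map q \<iota> v $ j = S.slice q x c (\<iota> j) - c (\<iota> j)"
          using sl[OF \<iota>n[of j]] by (simp add: S.minor_map_def)
        moreover have "\<bar>S.slice q x c (\<iota> j)\<bar> \<le> s" unfolding s_def by (rule abs_le_coeff_size[OF \<iota>n])
        ultimately show "\<bar>S.minor_map q \<iota> v $ j\<bar> \<le> 1 + s" using c[rule_format, of j] by linarith
      qed
      finally have nv: "norm v \<le> (k / a) * (1 + s)" using a(1) by (simp add: k_def field_simps)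
      have "coeff_size n c \<le> (\<Sum>i<n. \<bar>S.slice q x c i\<bar> + norm (b i q) * norm v)"
        unfolding coeff_size_def
      proof (rule sum_mono)
        fix i assume "i \<in> {..<n}"
        then have "c i = S.slice q x c i - b i q \<bullet> v" using sl by simp
        then show "\<bar>c i\<bar> \<le> \<bar>S.slice q x c i\<bar> + norm (b i q) * norm v"
          using Cauchy_Schwarz_ineq2[of "b i q" v] by linarith
      qed
      also have "\<dots> = s + (\<Sum>i<n. norm (b i q)) * norm v"
        by (simp add: s_def coeff_size_def sum.distrib sum_distrib_right)
      also have "\<dots> \<le> s + B * ((k / a) * (1 + s))"
        using elim(2) nv B0 by (intro add_left_mono mult_mono) auto
      finally show ?thesis using s0 by (simp add: K_def s_def[symmetric] algebra_simps)
    qed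
    with adm show ?case by blast
  qed
  moreover have "1 \<le> K" using B0 a(1) by (simp add: K_def k_def)
  ultimately show ?thesis by blast
qed

text \<open>A repeated index would give \<open>minor_map\<close> two equal components, against its
  surjectivity.\<close>

lemma admissible_inj: "S.admissible p \<iota> \<Longrightarrow> inj \<iota>"
proof (rule injI, rule ccontr)
  fix i j assume \<iota>: "S.admissible p \<iota>" and ij: "\<iota> i = \<iota> j" "i \<noteq> j"
  obtain v where "S.minor_map p \<iota> v = axis i 1"
    using S.minor_map_bij[OF \<iota>] by (metis bij_pointE)
  then have "b (\<iota> i) p \<bullet> v = 1" "b (\<iota> j) p \<bullet> v = 0"
    using ij(2) by (auto simp: S.minor_map_def vec_eq_iff axis_def)
  then show False using ij(1) by simp
qed

definition cube :: "('k \<Rightarrow> nat) \<Rightarrow> (nat \<Rightarrow> real) set" where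
  "cube \<iota> = {c. \<forall>j. 0 \<le> c (\<iota> j) \<and> c (\<iota> j) \<le> 1}"

lemma measurable_cube [measurable]:
  assumes "\<And>j. \<iota> j < n"
  shows "indicator (cube \<iota>) \<in> borel_measurable (coeff_lborel n)"
proof -
  have [measurable]: "(\<lambda>c. c (\<iota> j)) \<in> borel_measurable (coeff_lborel n)" for j
    using measurable_component_singleton[of "\<iota> j" "{..<n}" "\<lambda>_. lborel :: real measure"] assms by simp
  have "{c \<in> space (coeff_lborel n). c \<in> cube \<iota>} \<in> sets (coeff_lborel n)"
    unfolding cube_def mem_Collect_eq by measurable
  then show ?thesis by (intro borel_measurable_indicator') (simp add: pred_def)
qed

text \<open>Dominated convergence: \<open>slice_lower_bound\<close> turns decay of
  \<open>\<phi>\<close> along the fibre into decay in the variable of integration, uniformly in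
  \<open>x\<close> and in base points near \<open>p\<close>, and the slab leaves n - k free
  coordinates. Sequences suffice, as the manifold is second countable.\<close>

lemma slice_integral_tendsto:
  assumes \<iota>: "S.admissible p \<iota>" and \<beta>: "real n - real CARD('k) < \<beta>" "0 \<le> \<beta>"
    and meas: "\<And>q. \<phi> q \<in> borel_measurable (coeff_lborel n)"
    and bound: "eventually (\<lambda>q. \<forall>c. \<bar>\<phi> q c\<bar> \<le> K * (1 + coeff_size n c) powr (- \<beta>)) (nhds p)"
    and conv: "\<And>(q' :: nat \<Rightarrow> 'a) c' c. q' \<longlonglongrightarrow> p \<Longrightarrow> c' \<longlonglongrightarrow> c \<Longrightarrow> (\<lambda>i. \<phi> (q' i) (c' i)) \<longlonglongrightarrow> \<phi> p c"
  shows "eventually (\<lambda>q. S.admissible q \<iota> \<and>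
      (\<forall>x. integrable (coeff_lborel n) (\<lambda>c. \<phi> q (S.slice q x c) * indicator (cube \<iota>) c))) (nhds p)"
    and "isCont (\<lambda>(q, x). \<integral>c. \<phi> q (S.slice q x c) * indicator (cube \<iota>) c \<partial>coeff_lborel n) (p, x0)"
proof -
  have \<iota>n: "\<And>j. \<iota> j < n" using \<iota> by (auto simp: S.admissible_def)
  note [measurable] = meas measurable_cube[OF \<iota>n]
  obtain L where L: "1 \<le> L" "eventually (\<lambda>q. S.admissible q \<iota> \<and> (\<forall>x c. (\<forall>j. 0 \<le> c (\<iota> j) \<and> c (\<iota> j) \<le> 1) \<longrightarrow>
     1 + coeff_size n c \<le> L * (1 + coeff_size n (S.slice q x c)))) (nhds p)"
    using slice_lower_bound[OF \<iota>] by blast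
  \<comment> \<open>\<open>L powr \<beta>\<close> is the price of passing from the size of the slice
    to the size of \<open>c\<close>.\<close>
  define w where "w c = \<bar>K\<bar> * (L powr \<beta> * ((1 + coeff_size n c) powr (- \<beta>) * indicator (cube \<iota>) c))" for c
  have w: "integrable (coeff_lborel n) w"
  proof -
    have I: "\<iota> ` UNIV \<subseteq> {..<n}" using \<iota>n by auto
    have ci: "card (\<iota> ` UNIV) = CARD('k)" using admissible_inj[OF \<iota>] by (simp add: card_image)
    have "card (\<iota> ` UNIV) \<le> n" using card_mono[OF _ I] by simp
    then have "real (n - card (\<iota> ` UNIV)) < \<beta>" using \<beta> ci by simp
    from slab_decay_integrable[OF I this]
    have fin: "(\<integral>\<^sup>+c. ennreal ((1 + coeff_size n c) powr (- \<beta>)) * indicator (cube \<iota>) c \<partial>coeff_lborel n) < \<infinity>"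
      by (simp add: cube_def)
    have "integrable (coeff_lborel n) (\<lambda>c. (1 + coeff_size n c) powr (- \<beta>) * indicator (cube \<iota>) c)"
    proof (rule integrableI_nonneg)
      have "(\<integral>\<^sup>+c. ennreal ((1 + coeff_size n c) powr (- \<beta>) * indicator (cube \<iota>) c) \<partial>coeff_lborel n) =
        (\<integral>\<^sup>+c. ennreal ((1 + coeff_size n c) powr (- \<beta>)) * indicator (cube \<iota>) c \<partial>coeff_lborel n)"
        by (intro nn_integral_cong) (auto simp: indicator_def)
      then show "(\<integral>\<^sup>+c. ennreal ((1 + coeff_size n c) powr (- \<beta>) * indicator (cube \<iota>) c) \<partial>coeff_lborel n) < \<infinity>"
        using fin by simp
    qed auto
    then show ?thesis unfolding w_def by (intro integrable_mult_right)
  qed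
  have dom: "eventually (\<lambda>q. S.admissible q \<iota> \<and> (\<forall>x c. \<bar>\<phi> q (S.slice q x c) * indicator (cube \<iota>) c\<bar> \<le> w c)) (nhds p)"
    using bound L(2)
  proof eventually_elim
    case (elim q)
    have "\<bar>\<phi> q (S.slice q x c) * indicator (cube \<iota>) c\<bar> \<le> w c" for x c
    proof (cases "c \<in> cube \<iota>")
      case True
      let ?s = "1 + coeff_size n (S.slice q x c)" and ?t = "1 + coeff_size n c"
      have t: "0 < ?t" "0 < ?s" by (simp_all add: add_pos_nonneg)
      have "?t / L \<le> ?s" using elim(2) True L(1) by (simp add: cube_def field_simps)
      then have "?s powr (- \<beta>) \<le> (?t / L) powr (- \<beta>)"
        using \<beta>(2) t L(1) by (intro powr_mono2') auto
      also have "\<dots> = L powr \<beta> * ?t powr (- \<beta>)"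
        using t L(1) by (simp add: powr_divide powr_minus field_simps)
      finally have 1: "?s powr (- \<beta>) \<le> L powr \<beta> * ?t powr (- \<beta>)" .
      have "\<bar>\<phi> q (S.slice q x c)\<bar> \<le> K * ?s powr (- \<beta>)" using elim(1) by blast
      also have "\<dots> \<le> \<bar>K\<bar> * ?s powr (- \<beta>)" by (intro mult_right_mono) auto
      also have "\<dots> \<le> \<bar>K\<bar> * (L powr \<beta> * ?t powr (- \<beta>))" by (intro mult_left_mono 1) simp
      finally show ?thesis using True by (simp add: w_def)
    qed (simp add: w_def)
    then show ?case using elim(2) by blast
  qed
  have mS[measurable]: "(\<lambda>c. \<phi> q (S.slice q x c) * indicator (cube \<iota>) c) \<in> borel_measurable (coeff_lborel n)" for q x
    using measurable_compose[OF S.measurable_slice1 meas] by simp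
  show "eventually (\<lambda>q. S.admissible q \<iota> \<and>
      (\<forall>x. integrable (coeff_lborel n) (\<lambda>c. \<phi> q (S.slice q x c) * indicator (cube \<iota>) c))) (nhds p)"
    using dom by eventually_elim (auto intro!: Bochner_Integration.integrable_bound[OF w] AE_I2 order_trans[OF _ abs_ge_self])
  show "isCont (\<lambda>(q, x). \<integral>c. \<phi> q (S.slice q x c) * indicator (cube \<iota>) c \<partial>coeff_lborel n) (p, x0)"
    unfolding isCont_def tendsto_at_iff_sequentially
  proof (intro allI impI)
    fix Z :: "nat \<Rightarrow> 'a \<times> (real ^ 'k)" assume "Z \<longlonglongrightarrow> (p, x0)"
    then have Z: "(\<lambda>i. fst (Z i)) \<longlonglongrightarrow> p" "(\<lambda>i. snd (Z i)) \<longlonglongrightarrow> x0"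
      using tendsto_fst tendsto_snd by force+
    let ?I = "\<lambda>y c. \<phi> (fst y) (S.slice (fst y) (snd y) c) * indicator (cube \<iota>) c"
    obtain M where M: "\<And>i x c. M \<le> i \<Longrightarrow> \<bar>\<phi> (fst (Z i)) (S.slice (fst (Z i)) x c) * indicator (cube \<iota>) c\<bar> \<le> w c"
      using filterlim_iff[THEN iffD1, OF Z(1), rule_format, OF dom] unfolding eventually_sequentially by blast
    have "(\<lambda>i. \<integral>c. ?I (Z (i + M)) c \<partial>coeff_lborel n) \<longlonglongrightarrow> (\<integral>c. ?I (p, x0) c \<partial>coeff_lborel n)"
    proof (rule integral_dominated_convergence[where w = w])
      show "AE c in coeff_lborel n. (\<lambda>i. ?I (Z (i + M)) c) \<longlonglongrightarrow> ?I (p, x0) c"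
      proof (rule AE_I2)
        fix c
        have "(\<lambda>i. ?I (Z i) c) \<longlonglongrightarrow> ?I (p, x0) c"
          unfolding fst_conv snd_conv
          by (intro tendsto_mult tendsto_const conv Z(1) slice_tendsto Z)
        then show "(\<lambda>i. ?I (Z (i + M)) c) \<longlonglongrightarrow> ?I (p, x0) c" by (rule LIMSEQ_ignore_initial_segment)
      qed
      show "AE c in coeff_lborel n. norm (?I (Z (i + M)) c) \<le> w c" for i
        using M by (intro AE_I2) simp
    qed (use w mS in auto)
    then have "(\<lambda>i. \<integral>c. ?I (Z i) c \<partial>coeff_lborel n) \<longlonglongrightarrow> (\<integral>c. ?I (p, x0) c \<partial>coeff_lborel n)"
      by (rule LIMSEQ_offset)
    then show "((\<lambda>(q, x). \<integral>c. \<phi> q (S.slice q x c) * indicator (cube \<iota>) c \<partial>coeff_lborel n) \<circ> Z)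
      \<longlonglongrightarrow> (case (p, x0) of (q, x) \<Rightarrow> \<integral>c. \<phi> q (S.slice q x c) * indicator (cube \<iota>) c \<partial>coeff_lborel n)"
      by (simp add: o_def case_prod_beta)
  qed
qed

end

section \<open>The conditional laws of a random linear combination\<close>

lemma smooth_maps_isCont:
  fixes A :: "('a::{t2_space, second_countable_topology}, 'e::euclidean_space) chart set"
    and f :: "'a \<Rightarrow> 'b::real_normed_vector"
  assumes A: "smooth_atlas A" and f: "f \<in> smooth_maps A"
  shows "isCont f p"
proof -
  obtain c where c: "c \<in> A" "p \<in> fst c" using atlas_chart_ex[OF A] by blast
  have "continuous_on (snd c ` fst c) (local_rep c f)"
    using f c(1) by (intro smooth_on_imp_continuous_on) (simp add: smooth_maps_def)
  from chart_tendsto[OF A c _ this, of "\<lambda>q. q" "nhds p"]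
  have "((\<lambda>q. local_rep c f (snd c q)) \<longlongrightarrow> local_rep c f (snd c p)) (nhds p)"
    by (simp add: filterlim_ident)
  moreover have "eventually (\<lambda>q. local_rep c f (snd c q) = f q) (nhds p)"
    using eventually_nhds_in_open[OF chart_open(1)[OF A c(1)] c(2)]
    by eventually_elim (rule local_rep_apply[OF A c(1)])
  ultimately have "(f \<longlongrightarrow> f p) (nhds p)"
    unfolding local_rep_apply[OF A c] by (rule Lim_transform_eventually)
  then show ?thesis unfolding isCont_def by (rule filterlim_mono) (auto simp: at_within_le_nhds)
qed

text \<open>The situation in coordinates. Entries from \<open>n\<close> on are arbitrary, so
  positivity at the origin is stated for every \<open>c\<close> whose first \<open>n\<close> entries
  vanish. The size is shifted by 1 so that one power bound covers small and large \<open>c\<close>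
  alike.\<close>

locale smooth_random_sections =
  fixes A :: "('a::{t2_space, second_countable_topology}, 'e::euclidean_space) chart set"
    and g :: "'a \<Rightarrow> (('a \<Rightarrow> real) \<Rightarrow> real) \<Rightarrow> (('a \<Rightarrow> real) \<Rightarrow> real) \<Rightarrow> real"
    and n :: nat and b :: "nat \<Rightarrow> 'a \<Rightarrow> real ^ 'k"
    and r :: "(nat \<Rightarrow> real) \<Rightarrow> real" and C \<alpha> :: real
  assumes atlas: "smooth_atlas A" and metric: "riemannian_metric A g"
    and smooth: "\<And>i. i < n \<Longrightarrow> b i \<in> smooth_maps A"
    and evaluation: "\<And>p x. \<exists>z. lin_comb n b z p = x"
    and r_cont: "continuous_on UNIV r" and r_nonneg: "\<And>c. 0 \<le> r c"
    and r_pos: "\<And>c. (\<And>i. i < n \<Longrightarrow> c i = 0) \<Longrightarrow> 0 < r c"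
    and r_decay: "\<And>c. r c \<le> C * (1 + coeff_size n c) powr (- \<alpha>)" and \<alpha>: "real n < \<alpha>"

sublocale smooth_random_sections \<subseteq> spanning_sections n b
proof
  show "\<exists>z. lin_comb n (\<lambda>i. b i p) z = x" for p x
    using evaluation[of p x] by (simp add: lin_comb_apply) (simp add: lin_comb_def)
  show "isCont (b i) p" if "i < n" for i p
    by (rule smooth_maps_isCont[OF atlas smooth[OF that]])
qed

context smooth_random_sections
begin

abbreviation "W \<equiv> borel_of (whitney_topology A :: ('a \<Rightarrow> real ^ 'k) topology)"
abbreviation "N \<equiv> coeff_lborel n"

lemma lin_comb_at: "lin_comb n b z p = lin_comb n (\<lambda>i. b i p) z"
  by (simp add: lin_comb_apply) (simp add: lin_comb_def)

lemma b_C1: "i < n \<Longrightarrow> b i \<in> Ck_maps 1 A"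
  by (rule smooth_maps_Ck_maps[OF smooth])

lemma lin_comb_C1: "lin_comb n b z \<in> Ck_maps 1 A"
  by (rule lin_comb_Ck_maps[OF atlas b_C1])

lemma lin_comb_cont: "continuous_map euclidean (whitney_topology A) (lin_comb n b)"
  by (rule continuous_lin_comb_whitney[OF atlas b_C1])

lemma r_measurable [measurable]: "r \<in> borel_measurable N"
  by (rule continuous_on_measurable_PiM[OF r_cont])

lemma lin_comb_measurable [measurable]: "lin_comb n b \<in> measurable N W"
  by (rule continuous_map_measurable_PiM[OF lin_comb_cont])

lemma space_W: "space W = Ck_maps 1 A"
  by (simp add: topspace_whitney[OF atlas])

lemma gram_det_pos: "0 < lin_det (S.gram p)"
  by (rule lin_det_substitution(2)[OF S.gram_linear S.gram_inv(4), of "\<lambda>_. 0"]) simp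

lemma minor_det_pos: "S.admissible p \<iota> \<Longrightarrow> 0 < lin_det (S.minor_map p \<iota>)"
  by (rule lin_det_substitution(2)[OF S.minor_map_linear S.minor_map_bij, of p \<iota> "\<lambda>_. 0"]) auto

lemma weight_cube: "S.weight p \<iota> c = ennreal (lin_det (S.minor_map p \<iota>) * indicator (cube \<iota>) c)"
  if "S.admissible p \<iota>"
proof -
  have One: "(One :: real ^ 'k) $ i = 1" for i
    by (simp add: cart_eq_inner_axis inner_sum_left inner_Basis axis_in_Basis_iff)
  have "((\<chi> j. c (\<iota> j)) \<in> cbox 0 (One :: real ^ 'k)) \<longleftrightarrow> c \<in> cube \<iota>"
    using One by (simp add: mem_box_cart cube_def)
  then show ?thesis
    by (auto simp: S.weight_def indicator_def)
qed

text \<open>The law restricted to the fibre over \<open>x\<close>, not normalised. Dividing by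
  \<open>lin_det\<close> of \<open>gram\<close> compensates the factor in
  \<open>slice_disintegration\<close>, so that integrating these measures over \<open>x\<close>
  gives back the law of the field.\<close>

definition slice_law :: "('k \<Rightarrow> nat) \<Rightarrow> 'a \<Rightarrow> real ^ 'k \<Rightarrow> ('a \<Rightarrow> real ^ 'k) measure" where
  "slice_law \<iota> p x = distr (density N (\<lambda>c. S.weight p \<iota> c * ennreal (r (S.slice p x c) / lin_det (S.gram p))))
     W (\<lambda>c. lin_comb n b (S.slice p x c))"

lemma sets_slice_law [simp]: "sets (slice_law \<iota> p x) = sets W" "space (slice_law \<iota> p x) = topspace (whitney_topology A)"
  by (simp_all add: slice_law_def)

lemma slice_comb_measurable [measurable]: "(\<lambda>c. lin_comb n b (S.slice p x c)) \<in> measurable N W"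
  using measurable_compose[OF S.measurable_slice1 lin_comb_measurable] .

lemma slice_r_measurable [measurable]: "(\<lambda>c. r (S.slice p x c)) \<in> borel_measurable N"
  using measurable_compose[OF S.measurable_slice1 r_measurable] .

lemma nn_integral_slice_law:
  assumes \<iota>: "S.admissible p \<iota>" and f[measurable]: "f \<in> borel_measurable W"
  shows "(\<integral>\<^sup>+h. f h \<partial>slice_law \<iota> p x) = (\<integral>\<^sup>+c. S.weight p \<iota> c *
    (ennreal (r (S.slice p x c) / lin_det (S.gram p)) * f (lin_comb n b (S.slice p x c))) \<partial>N)"
proof -
  note [measurable] = S.measurable_weight[OF \<iota>]
  show ?thesis unfolding slice_law_def
    by (subst nn_integral_distr) (simp_all add: nn_integral_density mult.assoc)
qed

text \<open>The index chosen at each point may jump as the point moves. Independence of it allows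
  one index to be used throughout a neighbourhood.\<close>

lemma slice_law_independent:
  assumes "S.admissible p \<iota>" "S.admissible p \<kappa>"
  shows "slice_law \<iota> p x = slice_law \<kappa> p x"
proof (rule measure_eqI)
  fix B assume "B \<in> sets (slice_law \<iota> p x)"
  then have B[measurable]: "B \<in> sets W" by simp
  have Qm: "(\<lambda>c. ennreal (r c / lin_det (S.gram p)) * indicator B (lin_comb n b c)) \<in> borel_measurable N"
    by measurable
  have "emeasure (slice_law \<tau> p x) B = (\<integral>\<^sup>+c. S.weight p \<tau> c *
    (ennreal (r (S.slice p x c) / lin_det (S.gram p)) * indicator B (lin_comb n b (S.slice p x c))) \<partial>N)"
    if "S.admissible p \<tau>" for \<tau>
    using nn_integral_slice_law[OF that, of "indicator B" x] B by simp
  moreover from S.slice_integral_independent[OF assms Qm, of x]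
  have "(\<integral>\<^sup>+c. S.weight p \<iota> c *
    (ennreal (r (S.slice p x c) / lin_det (S.gram p)) * indicator B (lin_comb n b (S.slice p x c))) \<partial>N) =
    (\<integral>\<^sup>+c. S.weight p \<kappa> c *
    (ennreal (r (S.slice p x c) / lin_det (S.gram p)) * indicator B (lin_comb n b (S.slice p x c))) \<partial>N)" .
  ultimately show "emeasure (slice_law \<iota> p x) B = emeasure (slice_law \<kappa> p x) B" using assms by simp
qed simp

lemma slice_law_real_density:
  assumes \<iota>: "S.admissible p \<iota>"
  shows "slice_law \<iota> p x = distr (density N (\<lambda>c. ennreal (lin_det (S.minor_map p \<iota>) / lin_det (S.gram p) *
      (r (S.slice p x c) * indicator (cube \<iota>) c)))) W (\<lambda>c. lin_comb n b (S.slice p x c))"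
proof -
  have "S.weight p \<iota> c * ennreal (r (S.slice p x c) / lin_det (S.gram p)) =
    ennreal (lin_det (S.minor_map p \<iota>) / lin_det (S.gram p) * (r (S.slice p x c) * indicator (cube \<iota>) c))" for c
    unfolding weight_cube[OF \<iota>] using minor_det_pos[OF \<iota>] gram_det_pos[of p] r_nonneg
    by (subst ennreal_mult[symmetric]) (auto simp: field_simps)
  then show ?thesis unfolding slice_law_def by presburger
qed

lemma integral_slice_law:
  assumes \<iota>: "S.admissible p \<iota>" and f[measurable]: "(f :: _ \<Rightarrow> real) \<in> borel_measurable W"
  shows "(\<integral>h. f h \<partial>slice_law \<iota> p x) = lin_det (S.minor_map p \<iota>) / lin_det (S.gram p) *
      (\<integral>c. (f (lin_comb n b (S.slice p x c)) * r (S.slice p x c)) * indicator (cube \<iota>) c \<partial>N)"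
    and "integrable N (\<lambda>c. (f (lin_comb n b (S.slice p x c)) * r (S.slice p x c)) * indicator (cube \<iota>) c) \<Longrightarrow>
      integrable (slice_law \<iota> p x) f"
proof -
  let ?k = "lin_det (S.minor_map p \<iota>) / lin_det (S.gram p)"
  have \<iota>n: "\<And>j. \<iota> j < n" using \<iota> by (simp add: S.admissible_def)
  note [measurable] = measurable_cube[OF \<iota>n]
  have k: "0 < ?k" using minor_det_pos[OF \<iota>] gram_det_pos[of p] by simp
  have nn: "0 \<le> ?k * (r (S.slice p x c) * indicator (cube \<iota>) c)" for c
    using k r_nonneg by (intro mult_nonneg_nonneg) auto
  have eq: "?k * (r (S.slice p x c) * indicator (cube \<iota>) c) * f (lin_comb n b (S.slice p x c)) =
    ?k * ((f (lin_comb n b (S.slice p x c)) * r (S.slice p x c)) * indicator (cube \<iota>) c)" for c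
    by (simp add: mult_ac)
  show "(\<integral>h. f h \<partial>slice_law \<iota> p x) = ?k *
      (\<integral>c. (f (lin_comb n b (S.slice p x c)) * r (S.slice p x c)) * indicator (cube \<iota>) c \<partial>N)"
    unfolding slice_law_real_density[OF \<iota>]
    by (subst integral_distr, simp, simp, subst integral_density)
      (use nn in \<open>auto simp: eq simp del: times_divide_eq_left\<close>)
  assume "integrable N (\<lambda>c. (f (lin_comb n b (S.slice p x c)) * r (S.slice p x c)) * indicator (cube \<iota>) c)"
  then have "integrable N (\<lambda>c. ?k * (r (S.slice p x c) * indicator (cube \<iota>) c) * f (lin_comb n b (S.slice p x c)))"
    unfolding eq by (rule integrable_mult_right)
  then show "integrable (slice_law \<iota> p x) f"
    unfolding slice_law_real_density[OF \<iota>]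
    by (subst integrable_distr_eq, simp, simp, subst integrable_density) (use nn in auto)
qed

definition chosen_index :: "'a \<Rightarrow> 'k \<Rightarrow> nat" where
  "chosen_index p = (SOME \<iota>. S.admissible p \<iota>)"

lemma chosen_index: "S.admissible p (chosen_index p)"
  unfolding chosen_index_def using someI_ex[OF S.admissible_exists] .

abbreviation fibre_law :: "'a \<Rightarrow> real ^ 'k \<Rightarrow> ('a \<Rightarrow> real ^ 'k) measure" where
  "fibre_law p x \<equiv> slice_law (chosen_index p) p x"

lemma k_le_n: "CARD('k) \<le> n"
proof -
  \<comment> \<open>A type is nonempty, so there is a point at which to take an admissible
    index.\<close>
  fix p :: 'a
  have "card (range (chosen_index p)) = CARD('k)"
    using admissible_inj[OF chosen_index] by (simp add: card_image)
  moreover have "range (chosen_index p) \<subseteq> {..<n}"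
    using chosen_index[of p] by (auto simp: S.admissible_def)
  ultimately show ?thesis using card_mono[of "{..<n}" "range (chosen_index p)"] by simp
qed

lemma lin_det_ratio_isCont:
  assumes \<iota>: "S.admissible p \<iota>"
  shows "isCont (\<lambda>(q, x :: real ^ 'k). lin_det (S.minor_map q \<iota>) / lin_det (S.gram q)) (p, x0)"
  unfolding isCont_def tendsto_at_iff_sequentially
proof (intro allI impI)
  fix Z :: "nat \<Rightarrow> 'a \<times> (real ^ 'k)" assume "Z \<longlonglongrightarrow> (p, x0)"
  then have Z: "(\<lambda>i. fst (Z i)) \<longlonglongrightarrow> p" using tendsto_fst by force
  have \<iota>n: "\<And>j. \<iota> j < n" using \<iota> by (simp add: S.admissible_def)
  have "eventually (\<lambda>q. S.admissible q \<iota>) (nhds p)"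
    using slice_lower_bound[OF \<iota>] by (auto elim: eventually_mono)
  then have "eventually (\<lambda>i. S.admissible (fst (Z i)) \<iota>) sequentially"
    using filterlim_iff[THEN iffD1, OF Z, rule_format] by blast
  then have adm: "eventually (\<lambda>i. linear (S.minor_map (fst (Z i)) \<iota>) \<and> bij (S.minor_map (fst (Z i)) \<iota>)) sequentially"
    by eventually_elim (simp add: S.minor_map_linear S.minor_map_bij)
  have 1: "(\<lambda>i. lin_det (S.minor_map (fst (Z i)) \<iota>)) \<longlonglongrightarrow> lin_det (S.minor_map p \<iota>)"
    by (rule lin_det_tendsto[OF adm S.minor_map_linear S.minor_map_bij[OF \<iota>] minor_map_tendsto[OF \<iota>n Z]])
  have gr: "(\<lambda>i. S.gram (fst (Z i)) v) \<longlonglongrightarrow> S.gram p v" for v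
    unfolding S.gram_def by (intro tendsto_intros b_tendsto[OF _ Z]) auto
  have 2: "(\<lambda>i. lin_det (S.gram (fst (Z i)))) \<longlonglongrightarrow> lin_det (S.gram p)"
    by (rule lin_det_tendsto[OF _ S.gram_linear S.gram_inv(4) gr])
      (simp add: S.gram_linear S.gram_inv(4))
  show "((\<lambda>(q, x). lin_det (S.minor_map q \<iota>) / lin_det (S.gram q)) \<circ> Z)
     \<longlonglongrightarrow> (case (p, x0) of (q, x) \<Rightarrow> lin_det (S.minor_map q \<iota>) / lin_det (S.gram q))"
    using tendsto_divide[OF 1 2] gram_det_pos[of p] by (simp add: o_def case_prod_beta)
qed

text \<open>Growth of order k lowers the exponent from \<alpha> to \<alpha> - k, which is still
  above n - k. The applications are the constant 1, which gives the mass, and the positive part of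
  the Jacobian times a test function.\<close>

lemma fibre_integral_continuous:
  fixes f :: "'a \<Rightarrow> ('a \<Rightarrow> real ^ 'k) \<Rightarrow> real"
  assumes meas: "\<And>q. f q \<in> borel_measurable W"
    and bound: "eventually (\<lambda>q. \<forall>c. \<bar>f q (lin_comb n b c)\<bar> \<le> K * (1 + coeff_size n c) ^ CARD('k)) (nhds p)"
    and conv: "\<And>(q' :: nat \<Rightarrow> 'a) c' c. q' \<longlonglongrightarrow> p \<Longrightarrow> c' \<longlonglongrightarrow> c \<Longrightarrow>
      (\<lambda>i. f (q' i) (lin_comb n b (c' i))) \<longlonglongrightarrow> f p (lin_comb n b c)"
  shows "integrable (fibre_law p x) (f p)"
    and "isCont (\<lambda>(q, x). \<integral>h. f q h \<partial>fibre_law q x) (p, x0)"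
proof -
  let ?\<iota> = "chosen_index p" and ?\<beta> = "\<alpha> - real CARD('k)"
  note \<iota> = chosen_index[of p]
  define \<phi> where "\<phi> q c = f q (lin_comb n b c) * r c" for q c
  have m: "\<phi> q \<in> borel_measurable N" for q
    unfolding \<phi>_def using measurable_compose[OF lin_comb_measurable meas] by measurable
  have bd: "eventually (\<lambda>q. \<forall>c. \<bar>\<phi> q c\<bar> \<le> (\<bar>K\<bar> * \<bar>C\<bar>) * (1 + coeff_size n c) powr (- ?\<beta>)) (nhds p)"
    using bound
  proof eventually_elim
    case (elim q)
    show ?case
    proof
      fix c
      let ?s = "1 + coeff_size n c"
      have s: "0 < ?s" by (simp add: add_pos_nonneg)
      have "\<bar>f q (lin_comb n b c)\<bar> \<le> \<bar>K\<bar> * ?s ^ CARD('k)"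
        by (rule order_trans[OF elim[rule_format]]) (use s in \<open>auto intro: mult_right_mono\<close>)
      moreover have "r c \<le> \<bar>C\<bar> * ?s powr (- \<alpha>)"
        by (rule order_trans[OF r_decay]) (auto intro: mult_right_mono)
      ultimately have "\<bar>\<phi> q c\<bar> \<le> (\<bar>K\<bar> * ?s ^ CARD('k)) * (\<bar>C\<bar> * ?s powr (- \<alpha>))"
        unfolding \<phi>_def abs_mult using r_nonneg[of c] s by (intro mult_mono) auto
      also have "\<dots> = (\<bar>K\<bar> * \<bar>C\<bar>) * (?s powr real CARD('k) * ?s powr (- \<alpha>))"
        using s by (simp add: powr_realpow mult_ac)
      also have "?s powr real CARD('k) * ?s powr (- \<alpha>) = ?s powr (- ?\<beta>)"
        by (simp add: powr_add[symmetric])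
      finally show "\<bar>\<phi> q c\<bar> \<le> (\<bar>K\<bar> * \<bar>C\<bar>) * ?s powr (- ?\<beta>)" .
    qed
  qed
  have cv: "(\<lambda>i. \<phi> (q' i) (c' i)) \<longlonglongrightarrow> \<phi> p c" if "q' \<longlonglongrightarrow> p" "c' \<longlonglongrightarrow> c" for q' :: "nat \<Rightarrow> 'a" and c' c
  proof -
    have "isCont r c" using r_cont by (simp add: continuous_on_eq_continuous_at)
    then have "(\<lambda>i. r (c' i)) \<longlonglongrightarrow> r c" using that(2) by (rule isCont_tendsto_compose)
    then show ?thesis unfolding \<phi>_def by (intro tendsto_mult conv that)
  qed
  have \<beta>: "real n - real CARD('k) < ?\<beta>" "0 \<le> ?\<beta>" using \<alpha> k_le_n by auto
  have T1: "eventually (\<lambda>q. S.admissible q ?\<iota> \<and>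
      (\<forall>x. integrable N (\<lambda>c. \<phi> q (S.slice q x c) * indicator (cube ?\<iota>) c))) (nhds p)"
    by (rule slice_integral_tendsto(1)[OF \<iota> \<beta> m bd]) (rule cv)
  have T2: "isCont (\<lambda>(q, x). \<integral>c. \<phi> q (S.slice q x c) * indicator (cube ?\<iota>) c \<partial>N) (p, x0)"
    by (rule slice_integral_tendsto(2)[OF \<iota> \<beta> m bd]) (rule cv)
  have "integrable N (\<lambda>c. \<phi> p (S.slice p x c) * indicator (cube ?\<iota>) c)"
    using eventually_nhds_x_imp_x[OF T1] by blast
  then show "integrable (fibre_law p x) (f p)"
    unfolding \<phi>_def by (rule integral_slice_law(2)[OF \<iota> meas])
  \<comment> \<open>Near \<open>p\<close> the index chosen at \<open>p\<close> replaces the one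
    chosen at \<open>q\<close>; the ratio of determinants and the slab integral then vary
    continuously.\<close>
  have ev: "eventually (\<lambda>y. (case y of (q, x) \<Rightarrow> lin_det (S.minor_map q ?\<iota>) / lin_det (S.gram q)) *
      (case y of (q, x) \<Rightarrow> \<integral>c. \<phi> q (S.slice q x c) * indicator (cube ?\<iota>) c \<partial>N) =
      (case y of (q, x) \<Rightarrow> \<integral>h. f q h \<partial>fibre_law q x)) (nhds (p, x0))"
  proof -
    have "eventually (\<lambda>q. S.admissible q ?\<iota>) (nhds p)" using T1 by (rule eventually_mono) (rule conjunct1)
    then have "eventually (\<lambda>y. S.admissible (fst y) ?\<iota>) (nhds (p, x0))"
      unfolding nhds_prod by (rule eventually_compose_filterlim[OF _ filterlim_fst])
    then show ?thesis
    proof eventually_elim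
      case (elim y)
      show ?case
        using integral_slice_law(1)[OF elim meas, where x = "snd y"] slice_law_independent[OF elim chosen_index]
        by (simp add: case_prod_beta \<phi>_def)
    qed
  qed
  have "isCont (\<lambda>y. (case y of (q, x) \<Rightarrow> lin_det (S.minor_map q ?\<iota>) / lin_det (S.gram q)) *
      (case y of (q, x) \<Rightarrow> \<integral>c. \<phi> q (S.slice q x c) * indicator (cube ?\<iota>) c \<partial>N)) (p, x0)"
    by (intro continuous_mult lin_det_ratio_isCont[OF \<iota>] T2)
  then show "isCont (\<lambda>(q, x). \<integral>h. f q h \<partial>fibre_law q x) (p, x0)"
    using isCont_cong[OF ev] by blast
qed

lemma constant_bound: "eventually (\<lambda>q. \<forall>c. \<bar>1 :: real\<bar> \<le> 1 * (1 + coeff_size n c) ^ CARD('k)) (nhds p)"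
  by (intro always_eventually allI) (simp add: one_le_power)

lemma fibre_law_finite: "finite_measure (fibre_law p x)"
proof -
  have "integrable (fibre_law p x) (\<lambda>_. 1 :: real)"
    by (rule fibre_integral_continuous(1)[where f = "\<lambda>_ _. 1", OF _ constant_bound]) auto
  then have "emeasure (fibre_law p x) (space (fibre_law p x)) < \<infinity>"
    by (simp add: integrable_iff_bounded del: sets_slice_law)
  then show ?thesis by (intro finite_measureI) auto
qed

text \<open>This is the density of the field at \<open>p\<close>, evaluated at \<open>x\<close>, by
  \<open>fibre_disintegration\<close> with the whole space for \<open>B\<close>.\<close>

definition mass :: "'a \<Rightarrow> real ^ 'k \<Rightarrow> real" where
  "mass p x = measure (fibre_law p x) (space W)"

lemma mass_nonneg [simp]: "0 \<le> mass p x" by (simp add: mass_def)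

lemma emeasure_fibre_law_space: "emeasure (fibre_law p x) (space W) = ennreal (mass p x)"
  unfolding mass_def by (rule finite_measure.emeasure_eq_measure[OF fibre_law_finite])

lemma mass_isCont: "isCont (\<lambda>(q, x). mass q x) (p, x0)"
proof -
  have "isCont (\<lambda>(q, x). \<integral>h. (1 :: real) \<partial>fibre_law q x) (p, x0)"
    by (rule fibre_integral_continuous(2)[where f = "\<lambda>_ _. 1", OF _ constant_bound]) auto
  moreover have "(\<integral>h. 1 \<partial>fibre_law q x) = mass q x" for q x
    by (simp add: mass_def)
  ultimately show ?thesis by simp
qed

lemma fibre_law_measurable:
  assumes B[measurable]: "B \<in> sets W"
  shows "(\<lambda>x. emeasure (fibre_law p x) B) \<in> borel_measurable borel"
proof -
  interpret sigma_finite_measure N by (rule sigma_finite_coeff_lborel)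
  note [measurable] = S.measurable_weight[OF chosen_index]
  have Q: "(\<lambda>c. ennreal (r c / lin_det (S.gram p)) * indicator B (lin_comb n b c)) \<in> borel_measurable N" by measurable
  have sw: "(\<lambda>y. (snd y, fst y)) \<in> measurable (borel \<Otimes>\<^sub>M N) (N \<Otimes>\<^sub>M (borel :: (real ^ 'k) measure))" by measurable
  have "(\<lambda>y. S.slice p (fst y) (snd y)) \<in> measurable (borel \<Otimes>\<^sub>M N) N"
    using measurable_compose[OF sw S.measurable_slice[of p]] by simp
  from measurable_compose[OF this Q]
  have "(\<lambda>(x, c). S.weight p (chosen_index p) c * (ennreal (r (S.slice p x c) / lin_det (S.gram p)) *
     indicator B (lin_comb n b (S.slice p x c)))) \<in> borel_measurable (borel \<Otimes>\<^sub>M N)"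
    by (simp add: case_prod_beta)
  from borel_measurable_nn_integral[OF this]
  have "(\<lambda>x. \<integral>\<^sup>+h. indicator B h \<partial>fibre_law p x) \<in> borel_measurable borel"
    unfolding nn_integral_slice_law[OF chosen_index borel_measurable_indicator[OF B]] .
  then show ?thesis using B by simp
qed

lemma mass_measurable [measurable]: "mass p \<in> borel_measurable borel"
proof -
  have "(\<lambda>x. enn2real (emeasure (fibre_law p x) (space W))) \<in> borel_measurable borel"
    by (rule borel_measurable_enn2real, rule fibre_law_measurable, rule sets.top)
  then show ?thesis by (simp add: mass_def[abs_def] measure_def)
qed

text \<open>On the slice over \<open>x\<close> the evaluation at \<open>p\<close> is constantly
  \<open>x\<close>, so the indicator of \<open>V\<close> moves inside the slice integral and
  \<open>slice_disintegration\<close> applies.\<close>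

lemma fibre_disintegration:
  assumes B[measurable]: "B \<in> sets W" and V[measurable]: "V \<in> sets borel"
  shows "(\<integral>\<^sup>+x. emeasure (fibre_law p x) B * indicator V x \<partial>lborel) =
    (\<integral>\<^sup>+c. ennreal (r c) * (indicator B (lin_comb n b c) * indicator V (lin_comb n b c p)) \<partial>N)"
proof -
  let ?k = "lin_det (S.gram p)"
  have [measurable]: "(\<lambda>c. lin_comb n b c p) \<in> borel_measurable N"
    unfolding lin_comb_at by measurable
  define Q where "Q c = ennreal (1 / ?k) * (ennreal (r c) * (indicator B (lin_comb n b c) * indicator V (lin_comb n b c p)))" for c
  have Q[measurable]: "Q \<in> borel_measurable N" unfolding Q_def[abs_def] by measurable
  have "emeasure (fibre_law p x) B * indicator V x = (\<integral>\<^sup>+c. S.weight p (chosen_index p) c * Q (S.slice p x c) \<partial>N)" for x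
  proof -
    note [measurable] = S.measurable_weight[OF chosen_index]
    have "emeasure (fibre_law p x) B = (\<integral>\<^sup>+c. S.weight p (chosen_index p) c *
      (ennreal (r (S.slice p x c) / ?k) * indicator B (lin_comb n b (S.slice p x c))) \<partial>N)"
      using nn_integral_slice_law[OF chosen_index, of "indicator B" p x] B by simp
    then have "emeasure (fibre_law p x) B * indicator V x = (\<integral>\<^sup>+c. S.weight p (chosen_index p) c *
      (ennreal (r (S.slice p x c) / ?k) * indicator B (lin_comb n b (S.slice p x c))) * indicator V x \<partial>N)"
      by (subst nn_integral_multc) auto
    also have "\<dots> = (\<integral>\<^sup>+c. S.weight p (chosen_index p) c * Q (S.slice p x c) \<partial>N)"
    proof (rule nn_integral_cong)
      fix c
      have "lin_comb n b (S.slice p x c) p = x" unfolding lin_comb_at by simp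
      moreover have "ennreal (r (S.slice p x c) / ?k) = ennreal (1 / ?k) * ennreal (r (S.slice p x c))"
        using gram_det_pos[of p] r_nonneg by (subst ennreal_mult[symmetric]) auto
      ultimately show "S.weight p (chosen_index p) c *
      (ennreal (r (S.slice p x c) / ?k) * indicator B (lin_comb n b (S.slice p x c))) * indicator V x =
       S.weight p (chosen_index p) c * Q (S.slice p x c)" by (simp add: Q_def mult_ac)
    qed
    finally show ?thesis .
  qed
  then have "(\<integral>\<^sup>+x. emeasure (fibre_law p x) B * indicator V x \<partial>lborel) = ennreal ?k * (\<integral>\<^sup>+c. Q c \<partial>N)"
    using S.slice_disintegration[OF chosen_index Q] by simp
  also have "\<dots> = (ennreal ?k * ennreal (1 / ?k)) * (\<integral>\<^sup>+c. ennreal (r c) * (indicator B (lin_comb n b c) * indicator V (lin_comb n b c p)) \<partial>N)"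
    unfolding Q_def by (subst nn_integral_cmult) (auto simp: mult.assoc)
  also have "ennreal ?k * ennreal (1 / ?k) = 1"
    using gram_det_pos[of p] by (simp add: ennreal_mult[symmetric])
  finally show ?thesis by simp
qed

text \<open>Were the mass 0, \<open>r\<close> composed with the slice map would vanish almost
  everywhere on the slab; averaging over translates removes the weight and extends this to almost
  every \<open>c\<close>. Boxes around 0 have positive measure, so zeros of \<open>r\<close> on the
  fibre accumulate at the origin, against continuity and \<open>r_pos\<close>.\<close>

lemma mass_zero_pos: "0 < mass p 0"
proof (rule ccontr)
  assume "\<not> 0 < mass p 0"
  then have "emeasure (fibre_law p 0) (space W) = 0"
    unfolding emeasure_fibre_law_space using mass_nonneg[of p 0] by simp
  then have z: "(\<integral>\<^sup>+h. 1 \<partial>fibre_law p 0) = 0" by simp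
  note [measurable] = S.measurable_weight[OF chosen_index]
  let ?w = "S.weight p (chosen_index p)"
  define Q where "Q c = ennreal (r (S.slice p 0 c) / lin_det (S.gram p))" for c
  have Q[measurable]: "Q \<in> borel_measurable N" unfolding Q_def by measurable
  have "(\<integral>\<^sup>+c. ?w c * Q c \<partial>N) = 0"
    using z nn_integral_slice_law[OF chosen_index, of "\<lambda>_. 1" p 0] by (simp add: Q_def)
  then have AE0: "AE c in N. ?w c * Q c = 0" by (subst (asm) nn_integral_0_iff_AE) auto
  \<comment> \<open>The inner integral is infinite where the weight is nonzero, but almost
    everywhere \<open>Q c\<close> is 0 there.\<close>
  have "(\<integral>\<^sup>+c. Q c * (\<integral>\<^sup>+v. ?w c * 1 \<partial>(lborel :: (real ^ 'k) measure)) \<partial>N) = (\<integral>\<^sup>+c. 0 \<partial>N)"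
    by (rule nn_integral_cong_AE, rule AE_mp[OF AE0]) (auto intro!: AE_I2)
  moreover have "(\<integral>\<^sup>+c. Q c * (\<integral>\<^sup>+v. ?w c * 1 \<partial>(lborel :: (real ^ 'k) measure)) \<partial>N) =
    (\<integral>\<^sup>+c. 1 * (\<integral>\<^sup>+v. Q (\<lambda>i. c i + S.adj p (- v) i) * ?w (\<lambda>i. c i + S.adj p (- v) i) \<partial>lborel) \<partial>N)"
    by (rule S.integral_against_weights[OF chosen_index _ Q, where u = "\<lambda>_. 1"]) simp
  moreover have "(\<integral>\<^sup>+c. 1 * (\<integral>\<^sup>+v. Q (\<lambda>i. c i + S.adj p (- v) i) * ?w (\<lambda>i. c i + S.adj p (- v) i) \<partial>lborel) \<partial>N) =
    (\<integral>\<^sup>+c. Q c \<partial>N)"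
  proof (rule nn_integral_cong)
    fix c assume c: "c \<in> space N"
    have m: "(\<lambda>v. ?w (\<lambda>i. c i + S.adj p (- v) i)) \<in> borel_measurable lborel"
      using measurable_compose[OF measurable_compose[OF measurable_compose[OF borel_measurable_uminus[OF measurable_ident] measurable_Pair1'[OF c, of borel]] S.measurable_shift] S.measurable_weight[OF chosen_index]]
      by simp
    have "Q (\<lambda>i. c i + S.adj p (- v) i) = Q c" for v by (simp add: Q_def S.slice_shift)
    then show "1 * (\<integral>\<^sup>+v. Q (\<lambda>i. c i + S.adj p (- v) i) * ?w (\<lambda>i. c i + S.adj p (- v) i) \<partial>lborel) = Q c"
      using m by (simp add: nn_integral_cmult S.weight_integral_minus[OF chosen_index c])
  qed
  ultimately have "(\<integral>\<^sup>+c. Q c \<partial>N) = 0" by simp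
  then have "AE c in N. Q c = 0" by (subst (asm) nn_integral_0_iff_AE) auto
  then have AEr: "AE c in N. r (S.slice p 0 c) = 0"
    by (rule AE_mp) (use r_nonneg gram_det_pos[of p] in \<open>auto intro!: AE_I2 intro: antisym simp: Q_def ennreal_eq_0_iff divide_le_0_iff less_le\<close>)
  define box where "box m = (Pi\<^sub>E {..<n} (\<lambda>_. {- (1 / real (Suc m)) <..< 1 / real (Suc m)}))" for m
  interpret product_sigma_finite "\<lambda>_::nat. lborel :: real measure" by standard
  have "\<exists>c\<in>box m. r (S.slice p 0 c) = 0" for m
  proof (rule ccontr)
    assume nb: "\<not> ?thesis"
    have "AE c in N. c \<notin> box m"
      by (rule AE_mp[OF AEr], rule AE_I2) (use nb in blast)
    moreover have bm: "box m \<in> sets N" unfolding box_def by (intro sets_PiM_I_finite) auto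
    ultimately have "emeasure N (box m) = 0" using AE_iff_null_sets[OF bm] by (simp add: null_setsD1)
    moreover have "emeasure N (box m) = (\<Prod>i<n. emeasure lborel {- (1 / real (Suc m)) <..< 1 / real (Suc m)})"
      unfolding box_def by (rule emeasure_PiM) auto
    moreover have "\<dots> = (\<Prod>i<n. ennreal (2 / real (Suc m)))" by simp
    ultimately show False by (simp add: prod_ennreal)
  qed
  then obtain c where c: "\<And>m. c m \<in> box m" "\<And>m. r (S.slice p 0 (c m)) = 0" by metis
  \<comment> \<open>The value \<open>undefined\<close> from \<open>n\<close> on is forced, since the
    approximating points lie in the space of the product measure.\<close>
  define c0 where "c0 i = (if i < n then 0 else undefined :: real)" for i
  have cl: "(\<lambda>m. c m i) \<longlonglongrightarrow> c0 i" for i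
  proof (cases "i < n")
    case True
    have "\<bar>c m i\<bar> \<le> 1 / real (Suc m)" for m
      using PiE_mem[OF c(1)[of m, unfolded box_def], of i] True by auto
    moreover have "(\<lambda>m. 1 / real (Suc m)) \<longlonglongrightarrow> 0" by (rule LIMSEQ_Suc[OF lim_1_over_n])
    ultimately have "(\<lambda>m. c m i) \<longlonglongrightarrow> 0"
      by (intro Lim_null_comparison[of "\<lambda>m. c m i" "\<lambda>m. 1 / real (Suc m)"]) auto
    then show ?thesis using True by (simp add: c0_def)
  next
    case False
    have "c m i = undefined" for m
      using PiE_arb[OF c(1)[of m, unfolded box_def], of i] False by auto
    then show ?thesis using False by (simp add: c0_def)
  qed
  have "isCont (inv (S.gram p)) x" for x
    using S.gram_inv(3) linear_continuous_at linear_conv_bounded_linear by blast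
  then have sl: "(\<lambda>m. S.slice p 0 (c m) i) \<longlonglongrightarrow> S.slice p 0 c0 i" for i
    unfolding S.slice_def S.adj_def lin_comb_def
    by (cases "i < n") (auto intro!: tendsto_intros cl isCont_tendsto_compose[of _ "inv (S.gram p)"])
  then have "(\<lambda>m. S.slice p 0 (c m)) \<longlonglongrightarrow> S.slice p 0 c0" by (simp add: tendsto_componentwise_fun)
  moreover have "isCont r (S.slice p 0 c0)" using r_cont by (simp add: continuous_on_eq_continuous_at)
  ultimately have "(\<lambda>m. r (S.slice p 0 (c m))) \<longlonglongrightarrow> r (S.slice p 0 c0)" by (rule isCont_tendsto_compose[rotated])
  then have "r (S.slice p 0 c0) = 0" using c(2) by (simp add: LIMSEQ_const_iff)
  moreover have "S.slice p 0 c0 i = 0" if "i < n" for i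
    using that by (simp add: S.slice_def S.adj_def lin_comb_def c0_def linear_0[OF S.gram_inv(3)])
  then have "0 < r (S.slice p 0 c0)" by (rule r_pos)
  ultimately show False by simp
qed

end

section \<open>Normalised conditional laws and their Jacobian densities\<close>

lemma topcontinuous_at_generated:
  assumes sp: "\<And>y. f y \<in> topspace (topology_generated_by S)"
    and S: "\<And>U. U \<in> S \<Longrightarrow> f x \<in> U \<Longrightarrow> eventually (\<lambda>y. f y \<in> U) (nhds x)"
  shows "topcontinuous_at euclidean (topology_generated_by S) f x"
proof -
  have "eventually (\<lambda>y. f y \<in> V) (nhds x)" if "generate_topology_on S V" "f x \<in> V" for V
    using that
  proof (induction rule: generate_topology_on.induct)
    case (Int a b)
    then show ?case by (auto intro: eventually_conj)
  next
    case (UN K)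
    then obtain k where k: "k \<in> K" "f x \<in> k" by blast
    with UN.IH have "eventually (\<lambda>y. f y \<in> k) (nhds x)" by blast
    then show ?case by (rule eventually_mono) (use k in blast)
  qed (auto intro: S)
  then have "\<exists>U. openin euclidean U \<and> x \<in> U \<and> (\<forall>y\<in>U. f y \<in> V)"
    if "openin (topology_generated_by S) V" "f x \<in> V" for V
    using that openin_topology_generated_by[OF that(1)] by (auto simp: eventually_nhds)
  then show ?thesis unfolding topcontinuous_at_def using sp by auto
qed

context smooth_random_sections
begin

text \<open>Values of \<open>x\<close> with zero mass are not charged by the law of the field at
  \<open>p\<close>, so any choice is consistent there. A point mass is a probability measure that
  stays finite when multiplied by the Jacobian, as \<open>z_KROK\<close> demands for every
  \<open>x\<close>.\<close>

definition cond_law :: "'a \<Rightarrow> real ^ 'k \<Rightarrow> ('a \<Rightarrow> real ^ 'k) measure" where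
  "cond_law p x = (if mass p x = 0 then return W (lin_comb n b (\<lambda>_. 0))
     else density (fibre_law p x) (\<lambda>_. ennreal (1 / mass p x)))"

lemma sets_cond_law [simp]: "sets (cond_law p x) = sets W"
  by (simp add: cond_law_def)

lemma emeasure_cond_law:
  "B \<in> sets W \<Longrightarrow> mass p x \<noteq> 0 \<Longrightarrow> emeasure (cond_law p x) B = ennreal (1 / mass p x) * emeasure (fibre_law p x) B"
  by (simp add: cond_law_def emeasure_density nn_integral_cmult_indicator)

text \<open>The mass undoes the normalisation. On a fibre of mass 0 both sides are 0, so the default
  value does not enter.\<close>

lemma mass_cond_law:
  assumes B: "B \<in> sets W"
  shows "ennreal (mass p x) * emeasure (cond_law p x) B = emeasure (fibre_law p x) B"
proof (cases "mass p x = 0")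
  case True
  then have "emeasure (fibre_law p x) (space W) = 0" by (simp only: emeasure_fibre_law_space ennreal_0)
  moreover have "emeasure (fibre_law p x) B \<le> emeasure (fibre_law p x) (space W)"
    by (rule emeasure_mono[OF sets.sets_into_space[OF B]]) (simp only: sets_slice_law sets.top)
  ultimately have "emeasure (fibre_law p x) B = 0" by simp
  then show ?thesis using True by simp
next
  case False
  then have "ennreal (mass p x) * ennreal (1 / mass p x) = 1"
    using mass_nonneg[of p x] by (subst ennreal_mult[symmetric]) auto
  then show ?thesis unfolding emeasure_cond_law[OF B False] by (simp add: mult.assoc[symmetric])
qed

lemma lin_comb_space: "lin_comb n b z \<in> space W"
  unfolding space_W by (rule lin_comb_C1)

lemma cond_law_prob: "prob_space (cond_law p x)"
proof (cases "mass p x = 0")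
  case True
  then show ?thesis by (simp add: cond_law_def prob_space_return lin_comb_space del: space_borel_of)
next
  case False
  have "emeasure (cond_law p x) (space W) = ennreal (1 / mass p x) * ennreal (mass p x)"
    by (simp only: emeasure_cond_law[OF sets.top False] emeasure_fibre_law_space)
  also have "\<dots> = 1" using False mass_nonneg[of p x] by (subst ennreal_mult[symmetric]) auto
  finally have "emeasure (cond_law p x) (space W) = 1" .
  then show ?thesis by (intro prob_spaceI) (simp add: sets_eq_imp_space_eq[OF sets_cond_law])
qed

lemma cond_law_measurable:
  assumes B: "B \<in> sets W"
  shows "(\<lambda>x. measure (cond_law p x) B) \<in> borel_measurable borel"
proof -
  have [measurable]: "(\<lambda>x. emeasure (fibre_law p x) B) \<in> borel_measurable borel"
    by (rule fibre_law_measurable[OF B])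
  have "measure (cond_law p x) B = (if mass p x = 0 then indicator B (lin_comb n b (\<lambda>_. 0))
     else enn2real (ennreal (1 / mass p x) * emeasure (fibre_law p x) B))" for x
    using B by (auto simp: measure_def emeasure_cond_law) (simp add: cond_law_def indicator_def)
  then show ?thesis by simp
qed

text \<open>As \<open>sqrt\<close> is odd in the library, the Jacobian is not nonnegative for free; since \<open>ennreal\<close> truncates
  at 0, working with \<open>max 0\<close> avoids showing that Gram determinants are.\<close>

lemma positive_jacobian_measurable [measurable]:
  "(\<lambda>f. max 0 (jacobian A g q f)) \<in> borel_measurable W"
  using jacobian_measurable[OF atlas metric, where p = q] by measurable

lemma derivative_tendsto:
  assumes c: "c \<in> A" "p \<in> fst c" and q: "(q \<longlongrightarrow> p) F" and i: "i < n"
  shows "((\<lambda>l. frechet_derivative (local_rep c (b i)) (at (snd c (q l))) v) \<longlongrightarrow>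
    frechet_derivative (local_rep c (b i)) (at (snd c p)) v) F"
proof (rule chart_tendsto[OF atlas c q])
  have "smooth_on (local_rep c (b i)) (snd c ` fst c)"
    using smooth[OF i] c(1) by (simp add: smooth_maps_def)
  then show "continuous_on (snd c ` fst c) (\<lambda>x. frechet_derivative (local_rep c (b i)) (at x) v)"
    by (intro smooth_on_imp_continuous_on smooth_on_derivative)
qed

text \<open>Derivatives of a combination are linear in its coefficients, and those of the basis
  sections are bounded near \<open>p\<close>. The power k is the one from
  \<open>jacobian_bound\<close>.\<close>

lemma jacobian_growth:
  "\<exists>K\<ge>0. eventually (\<lambda>q. \<forall>z. max 0 (jacobian A g q (lin_comb n b z)) \<le> K * (1 + coeff_size n z) ^ CARD('k)) (nhds p)"
proof -
  obtain c where c: "c \<in> A" "p \<in> fst c" using atlas_chart_ex[OF atlas] by blast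
  obtain C' where C': "0 \<le> C'" "eventually (\<lambda>q. \<forall>(f :: 'a \<Rightarrow> real ^ 'k) m. f \<in> Ck_maps 1 A \<longrightarrow>
     (\<forall>v\<in>Basis. norm (frechet_derivative (local_rep c f) (at (snd c q)) v) \<le> m) \<longrightarrow>
     jacobian A g q f \<le> C' * m ^ CARD('k)) (nhds p)"
    using jacobian_bound[OF atlas metric c, where 'k = 'k] by blast
  let ?D = "\<lambda>i q v. frechet_derivative (local_rep c (b i)) (at (snd c q)) v"
  let ?S = "\<lambda>q. \<Sum>i<n. \<Sum>v\<in>Basis. norm (?D i q v)"
  have id: "((\<lambda>q. q) \<longlongrightarrow> p) (nhds p)" by (simp add: filterlim_ident)
  have "(?S \<longlongrightarrow> ?S p) (nhds p)"
    by (intro tendsto_intros derivative_tendsto[OF c id]) auto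
  then have ev: "eventually (\<lambda>q. ?S q < ?S p + 1) (nhds p)" by (rule order_tendstoD(2)) simp
  define B where "B = ?S p + 1"
  have B: "0 \<le> B" unfolding B_def by (simp add: sum_nonneg add_nonneg_nonneg)
  have "eventually (\<lambda>q. q \<in> fst c) (nhds p)"
    using eventually_nhds_in_open[OF chart_open(1)[OF atlas c(1)] c(2)] .
  then have "eventually (\<lambda>q. \<forall>z. max 0 (jacobian A g q (lin_comb n b z)) \<le> (C' * B ^ CARD('k)) * (1 + coeff_size n z) ^ CARD('k)) (nhds p)"
    using C'(2) ev
  proof eventually_elim
    case (elim q)
    show ?case
    proof
      fix z
      have s: "0 \<le> 1 + coeff_size n z" by (simp add: add_nonneg_nonneg)
      have "norm (frechet_derivative (local_rep c (lin_comb n b z)) (at (snd c q)) v) \<le> B * (1 + coeff_size n z)"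
        if v: "v \<in> Basis" for v
      proof -
        have "frechet_derivative (local_rep c (lin_comb n b z)) (at (snd c q)) v = (\<Sum>i<n. z i *\<^sub>R ?D i q v)"
          by (rule lin_comb_derivative[OF atlas b_C1 c(1) elim(1)])
        then have "norm (frechet_derivative (local_rep c (lin_comb n b z)) (at (snd c q)) v) \<le> (\<Sum>i<n. norm (z i *\<^sub>R ?D i q v))"
          by (simp only: norm_sum)
        also have "\<dots> \<le> (\<Sum>i<n. coeff_size n z * (\<Sum>v\<in>Basis. norm (?D i q v)))"
        proof (rule sum_mono)
          fix i assume i: "i \<in> {..<n}"
          have "norm (?D i q v) \<le> (\<Sum>v\<in>Basis. norm (?D i q v))"
            by (rule member_le_sum[OF v]) auto
          then show "norm (z i *\<^sub>R ?D i q v) \<le> coeff_size n z * (\<Sum>v\<in>Basis. norm (?D i q v))"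
            unfolding norm_scaleR real_norm_def using abs_le_coeff_size[of i n z] i
            by (intro mult_mono) auto
        qed
        also have "\<dots> = coeff_size n z * ?S q" by (simp add: sum_distrib_left)
        also have "\<dots> \<le> (1 + coeff_size n z) * B"
          using elim(3) B by (intro mult_mono) (auto simp: B_def sum_nonneg)
        finally show ?thesis by (simp add: mult.commute)
      qed
      then have "jacobian A g q (lin_comb n b z) \<le> C' * (B * (1 + coeff_size n z)) ^ CARD('k)"
        using elim(2) lin_comb_C1 by blast
      moreover have "0 \<le> C' * (B * (1 + coeff_size n z)) ^ CARD('k)" using C'(1) B s by simp
      ultimately show "max 0 (jacobian A g q (lin_comb n b z)) \<le> (C' * B ^ CARD('k)) * (1 + coeff_size n z) ^ CARD('k)"
        by (simp add: power_mult_distrib mult.assoc)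
    qed
  qed
  moreover have "0 \<le> C' * B ^ CARD('k)" using C'(1) B by simp
  ultimately show ?thesis by blast
qed

lemma jacobian_lin_comb_tendsto:
  fixes q :: "nat \<Rightarrow> 'a"
  assumes q: "q \<longlonglongrightarrow> p" and z: "z \<longlonglongrightarrow> z0"
  shows "(\<lambda>i. jacobian A g (q i) (lin_comb n b (z i))) \<longlonglongrightarrow> jacobian A g p (lin_comb n b z0)"
proof -
  obtain c where c: "c \<in> A" "p \<in> fst c" using atlas_chart_ex[OF atlas] by blast
  have zj: "(\<lambda>i. z i j) \<longlonglongrightarrow> z0 j" for j using z by (simp add: tendsto_componentwise_fun)
  have ev: "eventually (\<lambda>i. q i \<in> fst c) sequentially"
    using q c(2) chart_open(1)[OF atlas c(1)] by (simp add: topological_tendstoD)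
  show ?thesis
  proof (rule jacobian_tendsto[OF atlas metric c q lin_comb_C1 lin_comb_C1])
    fix v :: 'e
    have "(\<lambda>i. \<Sum>j<n. z i j *\<^sub>R frechet_derivative (local_rep c (b j)) (at (snd c (q i))) v) \<longlonglongrightarrow>
      (\<Sum>j<n. z0 j *\<^sub>R frechet_derivative (local_rep c (b j)) (at (snd c p)) v)"
      by (intro tendsto_intros zj derivative_tendsto[OF c q]) auto
    moreover have "eventually (\<lambda>i. (\<Sum>j<n. z i j *\<^sub>R frechet_derivative (local_rep c (b j)) (at (snd c (q i))) v) =
      frechet_derivative (local_rep c (lin_comb n b (z i))) (at (snd c (q i))) v) sequentially"
      using ev by eventually_elim (rule lin_comb_derivative[OF atlas b_C1 c(1), symmetric])
    moreover have "(\<Sum>j<n. z0 j *\<^sub>R frechet_derivative (local_rep c (b j)) (at (snd c p)) v) =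
      frechet_derivative (local_rep c (lin_comb n b z0)) (at (snd c p)) v"
      by (rule lin_comb_derivative[OF atlas b_C1 c, symmetric])
    ultimately show "(\<lambda>i. frechet_derivative (local_rep c (lin_comb n b (z i))) (at (snd c (q i))) v) \<longlonglongrightarrow>
      frechet_derivative (local_rep c (lin_comb n b z0)) (at (snd c p)) v"
      using Lim_transform_eventually by force
  qed
qed

text \<open>A bounded test function preserves growth of order k, and its continuity on the Whitney
  space passes to the coefficients through \<open>lin_comb_cont\<close>.\<close>

lemma jacobian_weighted_integral:
  assumes h: "continuous_map (whitney_topology A) euclideanreal h" and bd: "bounded (h ` topspace (whitney_topology A))"
  shows "integrable (fibre_law p x) (\<lambda>f. max 0 (jacobian A g p f) * h f)"
    and "isCont (\<lambda>(q, x). \<integral>f. max 0 (jacobian A g q f) * h f \<partial>fibre_law q x) (p, x0)"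
proof -
  have hm[measurable]: "h \<in> borel_measurable W" by (rule continuous_map_borel_measurable[OF h])
  have m: "(\<lambda>f. max 0 (jacobian A g q f) * h f) \<in> borel_measurable W" for q by measurable
  obtain H where H: "\<And>f. f \<in> topspace (whitney_topology A) \<Longrightarrow> \<bar>h f\<bar> \<le> H"
    using bd by (auto simp: bounded_iff)
  have Hl: "\<bar>h (lin_comb n b z)\<bar> \<le> H" for z
    using H lin_comb_space by simp
  then have H0: "0 \<le> H" by (meson abs_ge_zero order_trans)
  obtain K where K: "0 \<le> K" "eventually (\<lambda>q. \<forall>z. max 0 (jacobian A g q (lin_comb n b z)) \<le> K * (1 + coeff_size n z) ^ CARD('k)) (nhds p)"
    using jacobian_growth by blast
  have b: "eventually (\<lambda>q. \<forall>z. \<bar>max 0 (jacobian A g q (lin_comb n b z)) * h (lin_comb n b z)\<bar> \<le>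
      (K * H) * (1 + coeff_size n z) ^ CARD('k)) (nhds p)"
    using K(2)
  proof eventually_elim
    case (elim q)
    show ?case
    proof
      fix z
      have "\<bar>max 0 (jacobian A g q (lin_comb n b z)) * h (lin_comb n b z)\<bar> \<le> (K * (1 + coeff_size n z) ^ CARD('k)) * H"
        unfolding abs_mult using elim Hl K(1) by (intro mult_mono) (auto simp: add_nonneg_nonneg)
      then show "\<bar>max 0 (jacobian A g q (lin_comb n b z)) * h (lin_comb n b z)\<bar> \<le> (K * H) * (1 + coeff_size n z) ^ CARD('k)"
        by (simp add: mult_ac)
    qed
  qed
  have cv: "(\<lambda>i. max 0 (jacobian A g (q' i) (lin_comb n b (c' i))) * h (lin_comb n b (c' i))) \<longlonglongrightarrow>
     max 0 (jacobian A g p (lin_comb n b c)) * h (lin_comb n b c)"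
    if "q' \<longlonglongrightarrow> p" "c' \<longlonglongrightarrow> c" for q' :: "nat \<Rightarrow> 'a" and c' c
  proof -
    have "continuous_on UNIV (\<lambda>c. h (lin_comb n b c))"
      using continuous_map_compose[OF lin_comb_cont h] by (simp add: o_def)
    then have "isCont (\<lambda>c. h (lin_comb n b c)) c" by (simp add: continuous_on_eq_continuous_at)
    then have "(\<lambda>i. h (lin_comb n b (c' i))) \<longlonglongrightarrow> h (lin_comb n b c)"
      using that(2) by (rule isCont_tendsto_compose)
    then show ?thesis by (intro tendsto_mult tendsto_max tendsto_const jacobian_lin_comb_tendsto that)
  qed
  show "integrable (fibre_law p x) (\<lambda>f. max 0 (jacobian A g p f) * h f)"
    by (rule fibre_integral_continuous(1)[where f = "\<lambda>q f. max 0 (jacobian A g q f) * h f", OF m b cv])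
  show "isCont (\<lambda>(q, x). \<integral>f. max 0 (jacobian A g q f) * h f \<partial>fibre_law q x) (p, x0)"
    by (rule fibre_integral_continuous(2)[where f = "\<lambda>q f. max 0 (jacobian A g q f) * h f", OF m b cv])
qed

definition jacobian_law :: "'a \<Rightarrow> real ^ 'k \<Rightarrow> ('a \<Rightarrow> real ^ 'k) measure" where
  "jacobian_law p x = density (cond_law p x) (\<lambda>f. ennreal (jacobian A g p f))"

lemma jacobian_law_pos: "jacobian_law p x = density (cond_law p x) (\<lambda>f. ennreal (max 0 (jacobian A g p f)))"
  unfolding jacobian_law_def by (rule arg_cong[where f = "density _"]) (auto simp: max_def ennreal_neg)

lemma integral_jacobian_law:
  assumes h[measurable]: "h \<in> borel_measurable W" and nz: "mass p x \<noteq> 0"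
  shows "(\<integral>f. h f \<partial>jacobian_law p x) = (\<integral>f. max 0 (jacobian A g p f) * h f \<partial>fibre_law p x) / mass p x"
proof -
  have meq: "borel_measurable (cond_law p x) = borel_measurable W" "borel_measurable (fibre_law p x) = borel_measurable W"
    by (rule measurable_cong_sets; simp)+
  have "(\<integral>f. h f \<partial>jacobian_law p x) = (\<integral>f. max 0 (jacobian A g p f) * h f \<partial>cond_law p x)"
    unfolding jacobian_law_pos by (subst integral_density) (auto simp: meq)
  also have "\<dots> = (\<integral>f. (1 / mass p x) * (max 0 (jacobian A g p f) * h f) \<partial>fibre_law p x)"
    unfolding cond_law_def using nz by (simp, subst integral_density) (auto simp: meq)
  also have "\<dots> = (\<integral>f. max 0 (jacobian A g p f) * h f \<partial>fibre_law p x) / mass p x" by simp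
  finally show ?thesis .
qed

text \<open>On fibres of positive mass the test function 1 in
  \<open>jacobian_weighted_integral\<close> gives finiteness; on the others the integral against the
  point mass is a single value.\<close>

lemma jacobian_law_finite: "finite_measure (jacobian_law p x)"
proof (rule finite_measureI)
  have meq: "borel_measurable (cond_law p x) = borel_measurable W" "borel_measurable (fibre_law p x) = borel_measurable W"
    by (rule measurable_cong_sets; simp)+
  have "emeasure (jacobian_law p x) (space (jacobian_law p x)) = (\<integral>\<^sup>+f. ennreal (max 0 (jacobian A g p f)) \<partial>cond_law p x)"
  proof -
    have 1: "(\<lambda>f. ennreal (max 0 (jacobian A g p f))) \<in> borel_measurable (cond_law p x)"
      unfolding meq by measurable
    show ?thesis
      unfolding jacobian_law_pos space_density emeasure_density[OF 1 sets.top]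
      by (intro nn_integral_cong) (simp del: ennreal_max_0)
  qed
  also have "\<dots> < \<infinity>"
  proof -
    define J where "J f = max 0 (jacobian A g p f)" for f :: "'a \<Rightarrow> real ^ 'k"
    have J[measurable]: "J \<in> borel_measurable W" unfolding J_def by measurable
    show ?thesis
      unfolding J_def[symmetric]
    proof (cases "mass p x = 0")
      case True
      have "(\<integral>\<^sup>+f. ennreal (J f) \<partial>return W (lin_comb n b (\<lambda>_. 0))) = ennreal (J (lin_comb n b (\<lambda>_. 0)))"
        by (rule nn_integral_return[OF lin_comb_space]) measurable
      then show "(\<integral>\<^sup>+f. ennreal (J f) \<partial>cond_law p x) < \<infinity>" using True by (simp add: cond_law_def)
    next
      case False
      have "integrable (fibre_law p x) (\<lambda>f. J f * 1)"
        unfolding J_def by (rule jacobian_weighted_integral(1)) (auto simp: bounded_iff)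
      then have "(\<integral>\<^sup>+f. ennreal (norm (J f * 1)) \<partial>fibre_law p x) < \<infinity>"
        unfolding integrable_iff_bounded by blast
      moreover have "norm (J f * 1) = J f" for f by (simp add: J_def)
      ultimately have "(\<integral>\<^sup>+f. ennreal (J f) \<partial>fibre_law p x) < \<infinity>" by simp
      moreover have "(\<integral>\<^sup>+f. ennreal (J f) \<partial>cond_law p x) = ennreal (1 / mass p x) * (\<integral>\<^sup>+f. ennreal (J f) \<partial>fibre_law p x)"
        using False by (simp add: cond_law_def nn_integral_density meq nn_integral_cmult)
      ultimately show "(\<integral>\<^sup>+f. ennreal (J f) \<partial>cond_law p x) < \<infinity>"
        by (simp add: ennreal_mult_less_top)
    qed
  qed
  finally show "emeasure (jacobian_law p x) (space (jacobian_law p x)) \<noteq> \<infinity>" by simp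
qed

text \<open>Near \<open>(p, 0)\<close> the mass is positive, so the default branch of
  \<open>cond_law\<close> is not met and each test integral is a quotient of two functions
  continuous at \<open>(p, 0)\<close>.\<close>

lemma jacobian_law_continuous:
  "topcontinuous_at euclidean (weak_topology (whitney_topology A)) (\<lambda>(q, x). jacobian_law q x) (p, 0)"
  unfolding weak_topology_def
proof (rule topcontinuous_at_generated)
  let ?T = "whitney_topology A :: ('a \<Rightarrow> real ^ 'k) topology"
  have fm: "jacobian_law q x \<in> finite_borel_measures ?T" for q x
    using jacobian_law_finite by (simp add: finite_borel_measures_def) (simp add: jacobian_law_def)
  let ?S = "{{M \<in> finite_borel_measures ?T. (\<integral>x. h x \<partial>M) \<in> U} |h U.
     continuous_map ?T euclideanreal h \<and> bounded (h ` topspace ?T) \<and> open U}"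
  \<comment> \<open>The test function 0 exhibits the set of all finite Borel measures as one of the
    generators, hence as part of the space of the weak topology.\<close>
  have "continuous_map ?T euclideanreal (\<lambda>_. 0) \<and> bounded ((\<lambda>_. 0 :: real) ` topspace ?T) \<and> open (UNIV :: real set)"
    by (auto simp: bounded_iff)
  then have "{M \<in> finite_borel_measures ?T. (\<integral>x. (0 :: real) \<partial>M) \<in> UNIV} \<in> ?S" by blast
  then have "finite_borel_measures ?T \<in> ?S" by simp
  then show "(case y of (q, x) \<Rightarrow> jacobian_law q x) \<in> topspace (topology_generated_by ?S)" for y
    unfolding topology_generated_by_topspace using fm by (cases y) auto
  fix U assume "U \<in> ?S" and inU: "(case (p, 0) of (q, x) \<Rightarrow> jacobian_law q x) \<in> U"
  then obtain h V where U: "U = {M \<in> finite_borel_measures ?T. (\<integral>x. h x \<partial>M) \<in> V}"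
    and h: "continuous_map ?T euclideanreal h" "bounded (h ` topspace ?T)" and V: "open V" by blast
  have hm: "h \<in> borel_measurable W" by (rule continuous_map_borel_measurable[OF h(1)])
  let ?G = "\<lambda>y. (case y of (q, x) \<Rightarrow> \<integral>f. max 0 (jacobian A g q f) * h f \<partial>fibre_law q x) / (case y of (q, x) \<Rightarrow> mass q x)"
  have nz: "mass p 0 \<noteq> 0" using mass_zero_pos[of p] by simp
  have cont: "isCont ?G (p, 0)"
    by (intro isCont_divide jacobian_weighted_integral(2)[OF h] mass_isCont) (use nz in simp)
  have "?G (p, 0) \<in> V" using inU integral_jacobian_law[OF hm nz] by (simp add: U)
  then have "eventually (\<lambda>y. ?G y \<in> V) (nhds (p, 0))"
    using cont V by (simp add: continuous_at topological_tendstoD tendsto_nhds_iff[symmetric] eventually_nhds_conv_at)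
  moreover have "eventually (\<lambda>y. (case y of (q, x) \<Rightarrow> mass q x) > 0) (nhds (p, 0))"
  proof -
    have "((\<lambda>y. case y of (q, x) \<Rightarrow> mass q x) \<longlongrightarrow> mass p 0) (at (p, 0))"
      using mass_isCont[of p 0] by (simp add: isCont_def)
    from order_tendstoD(1)[OF this mass_zero_pos] mass_zero_pos[of p]
    show ?thesis by (simp add: eventually_nhds_conv_at)
  qed
  ultimately show "eventually (\<lambda>y. (case y of (q, x) \<Rightarrow> jacobian_law q x) \<in> U) (nhds (p, 0))"
  proof eventually_elim
    case (elim y)
    obtain q x where y: "y = (q, x)" by (cases y)
    show ?case using elim fm integral_jacobian_law[OF hm, of q x] by (simp add: U y)
  qed
qed

theorem random_section_z_KROK:
  assumes P: "prob_space P" and Y: "distributed P N Y (\<lambda>c. ennreal (r c))"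
    and X: "\<And>\<omega>. \<omega> \<in> space P \<Longrightarrow> X \<omega> = lin_comb n b (Y \<omega>)"
  shows "z_KROK A g P X"
proof -
  have mY[measurable]: "Y \<in> measurable P N" using Y by (rule distributed_measurable)
  have "(\<lambda>\<omega>. lin_comb n b (Y \<omega>)) \<in> measurable P W"
    by (rule measurable_compose[OF mY lin_comb_measurable])
  then have mX[measurable]: "X \<in> measurable P W"
    by (rule measurable_cong[THEN iffD1, rotated]) (simp add: X)
  have mL[measurable]: "(\<lambda>c. lin_comb n b c p) \<in> borel_measurable N" for p
    unfolding lin_comb_at by measurable
  have mXp[measurable]: "(\<lambda>\<omega>. X \<omega> p) \<in> borel_measurable P" for p
    by (rule measurable_cong[THEN iffD1, OF _ measurable_compose[OF mY mL[of p]]]) (simp add: X)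
  \<comment> \<open>One identity serves twice: the whole space for \<open>B\<close> gives the
    density of the field at \<open>p\<close>, an arbitrary \<open>B\<close> the conditional
    laws.\<close>
  have joint: "emeasure P {\<omega> \<in> space P. X \<omega> \<in> B \<and> X \<omega> p \<in> V} =
      (\<integral>\<^sup>+x. emeasure (fibre_law p x) B * indicator V x \<partial>lborel)"
    if B[measurable]: "B \<in> sets W" and V[measurable]: "V \<in> sets borel" for p B V
  proof -
    have "{\<omega> \<in> space P. X \<omega> \<in> B \<and> X \<omega> p \<in> V} \<in> sets P" by measurable
    then have "emeasure P {\<omega> \<in> space P. X \<omega> \<in> B \<and> X \<omega> p \<in> V} =
      (\<integral>\<^sup>+\<omega>. indicator {\<omega> \<in> space P. X \<omega> \<in> B \<and> X \<omega> p \<in> V} \<omega> \<partial>P)" by simp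
    also have "\<dots> = (\<integral>\<^sup>+\<omega>. indicator B (lin_comb n b (Y \<omega>)) * indicator V (lin_comb n b (Y \<omega>) p) \<partial>P)"
      by (intro nn_integral_cong) (auto simp: X indicator_def)
    also have "\<dots> = (\<integral>\<^sup>+c. ennreal (r c) * (indicator B (lin_comb n b c) * indicator V (lin_comb n b c p)) \<partial>N)"
      by (rule distributed_nn_integral[OF Y, symmetric]) measurable
    also have "\<dots> = (\<integral>\<^sup>+x. emeasure (fibre_law p x) B * indicator V x \<partial>lborel)"
      by (rule fibre_disintegration[OF B V, symmetric])
    finally show ?thesis .
  qed
  have dens: "distributed P lborel (\<lambda>\<omega>. X \<omega> p) (\<lambda>x. ennreal (mass p x))" for p
    unfolding distributed_def
  proof (intro conjI)
    show "distr P lborel (\<lambda>\<omega>. X \<omega> p) = density lborel (\<lambda>x. ennreal (mass p x))"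
    proof (rule measure_eqI)
      fix V assume "V \<in> sets (distr P lborel (\<lambda>\<omega>. X \<omega> p))"
      then have V[measurable]: "V \<in> sets borel" by simp
      have "emeasure (distr P lborel (\<lambda>\<omega>. X \<omega> p)) V = emeasure P {\<omega> \<in> space P. X \<omega> \<in> space W \<and> X \<omega> p \<in> V}"
        using measurable_space[OF mX] by (subst emeasure_distr) (auto intro!: arg_cong[where f = "emeasure P"])
      also have "\<dots> = (\<integral>\<^sup>+x. ennreal (mass p x) * indicator V x \<partial>lborel)"
        unfolding joint[OF sets.top V] emeasure_fibre_law_space ..
      also have "\<dots> = emeasure (density lborel (\<lambda>x. ennreal (mass p x))) V"
        by (subst emeasure_density) auto
      finally show "emeasure (distr P lborel (\<lambda>\<omega>. X \<omega> p)) V = emeasure (density lborel (\<lambda>x. ennreal (mass p x))) V" .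
    qed simp
  qed auto
  have reg: "AE \<omega> in P. regular_value A (X \<omega>) 0"
  proof -
    have "AE c in N. regular_value A (lin_comb n b c) 0"
      by (rule AE_regular_value[OF atlas smooth evaluation])
    then have "AE c in density N (\<lambda>c. ennreal (r c)). regular_value A (lin_comb n b c) 0"
      by (subst AE_density) auto
    then have "AE c in distr P N Y. regular_value A (lin_comb n b c) 0"
      by (simp only: distributed_distr_eq_density[OF Y])
    from AE_distrD[OF mY this] show ?thesis by (rule AE_mp) (auto intro!: AE_I2 simp: X)
  qed
  have cond: "regular_conditional_prob A P X p (cond_law p)" for p
    unfolding regular_conditional_prob_def
  proof (intro conjI allI ballI)
    fix B V assume B: "B \<in> sets W" and V: "V \<in> sets (borel :: (real ^ 'k) measure)"
    have [measurable]: "(\<lambda>x. emeasure (cond_law p x) B) \<in> borel_measurable borel"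
    proof -
      have "emeasure (cond_law p x) B = ennreal (measure (cond_law p x) B)" for x
        using finite_measure.emeasure_eq_measure[OF prob_space.finite_measure[OF cond_law_prob]] .
      then show ?thesis using cond_law_measurable[OF B, of p] by simp
    qed
    have "distr P borel (\<lambda>\<omega>. X \<omega> p) = density lborel (\<lambda>x. ennreal (mass p x))"
      using distributed_distr_eq_density[OF dens[of p]] by (simp cong: distr_cong)
    then have "(\<integral>\<^sup>+x\<in>V. emeasure (cond_law p x) B \<partial>distr P borel (\<lambda>\<omega>. X \<omega> p)) =
      (\<integral>\<^sup>+x. ennreal (mass p x) * (emeasure (cond_law p x) B * indicator V x) \<partial>lborel)"
      using V by (simp add: nn_integral_density)
    also have "\<dots> = (\<integral>\<^sup>+x. emeasure (fibre_law p x) B * indicator V x \<partial>lborel)"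
      by (simp add: mult.assoc[symmetric] mass_cond_law[OF B])
    finally show "emeasure P {\<omega> \<in> space P. X \<omega> \<in> B \<and> X \<omega> p \<in> V} =
      (\<integral>\<^sup>+x\<in>V. emeasure (cond_law p x) B \<partial>distr P borel (\<lambda>\<omega>. X \<omega> p))"
      using joint[OF B V] by simp
  qed (use cond_law_prob cond_law_measurable in auto)
  show ?thesis
    unfolding z_KROK_def
  proof (intro conjI)
    show "\<exists>\<rho> :: 'a \<Rightarrow> real ^ 'k \<Rightarrow> real.
        (\<forall>p. (\<forall>x. 0 \<le> \<rho> p x) \<and> distributed P lborel (\<lambda>\<omega>. X \<omega> p) (\<lambda>x. ennreal (\<rho> p x))) \<and>
        (\<forall>p. isCont (\<lambda>(q, x). \<rho> q x) (p, 0))"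
      by (rule exI[of _ mass]) (use dens mass_isCont in auto)
    show "\<exists>\<mu> :: 'a \<Rightarrow> real ^ 'k \<Rightarrow> ('a \<Rightarrow> real ^ 'k) measure.
        (\<forall>p. regular_conditional_prob A P X p (\<mu> p)) \<and>
        (\<forall>p x. finite_measure (density (\<mu> p x) (\<lambda>f. ennreal (jacobian A g p f)))) \<and>
        (\<forall>p. topcontinuous_at euclidean (weak_topology (whitney_topology A))
           (\<lambda>(q, x). density (\<mu> q x) (\<lambda>f. ennreal (jacobian A g q f))) (p, 0))"
      by (rule exI[of _ cond_law])
        (use cond jacobian_law_finite jacobian_law_continuous in \<open>auto simp: jacobian_law_def\<close>)
  qed (use mX reg in auto)
qed

end

section \<open>Decay of the density in coordinates\<close>

lemma continuous_bounded_on_box: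
  fixes r :: "(nat \<Rightarrow> real) \<Rightarrow> real"
  assumes "continuous_on UNIV r"
  shows "\<exists>M. \<forall>c. (\<forall>i<n. \<bar>c i\<bar> \<le> R) \<longrightarrow> (\<forall>i\<ge>n. c i = 0) \<longrightarrow> \<bar>r c\<bar> \<le> M"
proof -
  \<comment> \<open>Pinning the entries from \<open>n\<close> on to 0 makes the box a product of
    compact sets, hence compact.\<close>
  let ?S = "\<lambda>i. if i < n then {- R..R} else {0 :: real}"
  have "compactin (product_topology (\<lambda>_::nat. euclidean) UNIV) (Pi\<^sub>E UNIV ?S)"
    by (subst compactin_PiE) (auto simp: compactin_euclidean_iff)
  then have "compact (Pi\<^sub>E UNIV ?S)" by (simp add: euclidean_product_topology)
  from compact_imp_bounded[OF compact_continuous_image[OF continuous_on_subset[OF assms] this]]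
  obtain M where "\<forall>c\<in>Pi\<^sub>E UNIV ?S. \<bar>r c\<bar> \<le> M" by (auto simp: bounded_iff)
  then show ?thesis by (intro exI[of _ M]) (auto simp: PiE_UNIV_domain abs_le_iff; force)
qed

text \<open>The O-bound speaks of large elements only; the others are covered by continuity on a
  compact box. Comparing \<open>coeff_size\<close> with the Euclidean norm merges the two into one
  bound.\<close>

lemma coefficient_decay:
  fixes ip :: "'v::real_vector \<Rightarrow> 'v \<Rightarrow> real" and b :: "nat \<Rightarrow> 'v"
  assumes F: "\<And>c. lin_comb n b c \<in> F" and norm: "\<And>c. ip_norm ip (lin_comb n b c) = L2_set c {..<n}"
    and nonneg: "\<And>\<phi>. \<phi> \<in> F \<Longrightarrow> 0 \<le> \<rho> \<phi>" and cont: "continuous_on UNIV (\<lambda>c. \<rho> (lin_comb n b c))"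
    and \<alpha>: "0 \<le> \<alpha>"
    and decay: "\<rho> \<in> O[inf (filtercomap (ip_norm ip) at_top) (principal F)](\<lambda>\<phi>. ip_norm ip \<phi> powr (- \<alpha>))"
  shows "\<exists>C. \<forall>c. \<rho> (lin_comb n b c) \<le> C * (1 + coeff_size n c) powr (- \<alpha>)"
proof -
  obtain C0 where C0: "0 < C0" "eventually (\<lambda>\<phi>. norm (\<rho> \<phi>) \<le> C0 * norm (ip_norm ip \<phi> powr (- \<alpha>)))
      (inf (filtercomap (ip_norm ip) at_top) (principal F))"
    using decay by (rule landau_o.bigE)
  then obtain R0 where R0: "\<And>\<phi>. R0 \<le> ip_norm ip \<phi> \<Longrightarrow> \<phi> \<in> F \<Longrightarrow> \<bar>\<rho> \<phi>\<bar> \<le> C0 * \<bar>ip_norm ip \<phi> powr (- \<alpha>)\<bar>"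
    by (auto simp: eventually_inf_principal eventually_filtercomap_at_top_linorder)
  define R where "R = max R0 1"
  obtain M where M: "\<And>c. (\<And>i. i < n \<Longrightarrow> \<bar>c i\<bar> \<le> R) \<Longrightarrow> (\<And>i. n \<le> i \<Longrightarrow> c i = 0) \<Longrightarrow> \<bar>\<rho> (lin_comb n b c)\<bar> \<le> M"
    using continuous_bounded_on_box[OF cont, of n R] by blast
  \<comment> \<open>If the Euclidean norm is at least \<open>R\<close>, hence at least 1, then
    \<open>1 + coeff_size n c \<le> (1 + real n) * L2_set c {..<n}\<close>; otherwise
    \<open>1 + coeff_size n c \<le> 1 + real n * R\<close>.\<close>
  define C where "C = max (C0 * (1 + real n) powr \<alpha>) (\<bar>M\<bar> * (1 + real n * R) powr \<alpha>)"
  have "\<rho> (lin_comb n b c) \<le> C * (1 + coeff_size n c) powr (- \<alpha>)" for c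
  proof -
    let ?s = "1 + coeff_size n c" and ?l = "L2_set c {..<n}"
    have s: "0 < ?s" by (simp add: add_pos_nonneg)
    have le: "\<bar>c i\<bar> \<le> ?l" if "i < n" for i
      using member_le_L2_set[of "{..<n}" i "\<lambda>i. \<bar>c i\<bar>"] that by (simp add: L2_set_def)
    have sl: "coeff_size n c \<le> real n * ?l"
      unfolding coeff_size_def using sum_mono[of "{..<n}" "\<lambda>i. \<bar>c i\<bar>" "\<lambda>_. ?l"] le by simp
    show ?thesis
    proof (cases "R \<le> ?l")
      case True
      then have l: "R0 \<le> ?l" "1 \<le> ?l" by (auto simp: R_def)
      have "?s \<le> (1 + real n) * ?l" using sl l(2) by (simp add: algebra_simps)
      then have "?s / (1 + real n) \<le> ?l" by (simp add: divide_le_eq mult.commute add_pos_nonneg)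
      then have "?l powr (- \<alpha>) \<le> (?s / (1 + real n)) powr (- \<alpha>)"
        using s \<alpha> by (intro powr_mono2') (auto simp: add_pos_nonneg)
      also have "\<dots> = (1 + real n) powr \<alpha> * ?s powr (- \<alpha>)"
        using s by (simp add: powr_divide powr_minus field_simps)
      finally have "?l powr (- \<alpha>) \<le> (1 + real n) powr \<alpha> * ?s powr (- \<alpha>)" .
      then have "C0 * ?l powr (- \<alpha>) \<le> C0 * ((1 + real n) powr \<alpha> * ?s powr (- \<alpha>))"
        using C0(1) by (intro mult_left_mono) auto
      moreover have "\<rho> (lin_comb n b c) \<le> C0 * ?l powr (- \<alpha>)"
        using R0[of "lin_comb n b c"] l(1) F by (simp add: norm)
      moreover have "C0 * (1 + real n) powr \<alpha> * ?s powr (- \<alpha>) \<le> C * ?s powr (- \<alpha>)"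
        unfolding C_def by (intro mult_right_mono) auto
      ultimately show ?thesis by (simp add: mult.assoc)
    next
      case False
      \<comment> \<open>\<open>M\<close> bounds the density on sequences that vanish from
        \<open>n\<close> on; cutting off the other entries does not change the combination.\<close>
      let ?c = "\<lambda>i. if i < n then c i else 0"
      have "lin_comb n b c = lin_comb n b ?c" by (simp add: lin_comb_def)
      then have "\<rho> (lin_comb n b c) \<le> \<bar>M\<bar>"
        using M[of ?c] le False by (smt (verit) leD)
      also have "\<dots> \<le> \<bar>M\<bar> * ((1 + real n * R) powr \<alpha> * ?s powr (- \<alpha>))"
      proof -
        have "real n * ?l \<le> real n * R" using False by (intro mult_left_mono) auto
        then have "?s \<le> 1 + real n * R" using sl by linarith
        then have "?s powr \<alpha> \<le> (1 + real n * R) powr \<alpha>" using s \<alpha> by (intro powr_mono2) auto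
        then have "1 \<le> (1 + real n * R) powr \<alpha> * ?s powr (- \<alpha>)"
          using s by (simp add: powr_minus field_simps)
        then show ?thesis using mult_left_mono[of 1 _ "\<bar>M\<bar>"] by simp
      qed
      also have "\<dots> \<le> C * ?s powr (- \<alpha>)"
        unfolding mult.assoc[symmetric] C_def by (intro mult_right_mono) auto
      finally show ?thesis .
    qed
  qed
  then show ?thesis by blast
qed

theorem proposition10p4:
  fixes A :: "('a::{t2_space, second_countable_topology}, 'e::euclidean_space) chart set"
    and g :: "'a \<Rightarrow> (('a \<Rightarrow> real) \<Rightarrow> real) \<Rightarrow> (('a \<Rightarrow> real) \<Rightarrow> real) \<Rightarrow> real"
    and F :: "('a \<Rightarrow> real ^ 'k) set"
    and ip :: "('a \<Rightarrow> real ^ 'k) \<Rightarrow> ('a \<Rightarrow> real ^ 'k) \<Rightarrow> real"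
    and n :: nat
    and P :: "'w measure"
    and X :: "'w \<Rightarrow> 'a \<Rightarrow> real ^ 'k"
    and \<rho> :: "('a \<Rightarrow> real ^ 'k) \<Rightarrow> real"
    and \<alpha> :: real
  assumes manifold: "smooth_atlas A" "riemannian_metric A g"
    and subspace: "F \<subseteq> smooth_maps A" "subspace F"
    and finite_dim: "\<exists>B. finite B \<and> span B = F" "dim F = n"
    and scalar_product: "scalar_product_on F ip"
    and evaluation: "\<And>p. (\<lambda>\<phi>. \<phi> p) ` F = UNIV"
    and probability: "prob_space P"
    and density: "distributed P (lborel_on F ip) X (\<lambda>\<phi>. ennreal (\<rho> \<phi>))"
      "\<And>\<phi>. \<phi> \<in> F \<Longrightarrow> 0 \<le> \<rho> \<phi>"
      "continuous_map (ip_topology F ip) euclideanreal \<rho>"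
      "0 < \<rho> 0"
    and decay: "real n < \<alpha>"
      "\<rho> \<in> O[inf (filtercomap (ip_norm ip) at_top) (principal F)](\<lambda>\<phi>. ip_norm ip \<phi> powr (- \<alpha>))"
  shows "z_KROK A g P X"
proof -
  obtain B where B: "finite B" "span B = F" using finite_dim(1) by blast
  obtain b Y where b0: "\<And>c. (\<Sum>i<dim F. c i *\<^sub>R b i) \<in> F"
    "\<And>\<phi>. \<phi> \<in> F \<Longrightarrow> \<exists>c. \<phi> = (\<Sum>i<dim F. c i *\<^sub>R b i)"
    "\<And>c. ip_norm ip (\<Sum>i<dim F. c i *\<^sub>R b i) = L2_set c {..<dim F}"
    "continuous_on UNIV (\<lambda>c. \<rho> (\<Sum>i<dim F. c i *\<^sub>R b i))"
    "distributed P (\<Pi>\<^sub>M i\<in>{..<dim F}. lborel) Y (\<lambda>c. ennreal (\<rho> (\<Sum>i<dim F. c i *\<^sub>R b i)))"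
    "\<And>\<omega>. \<omega> \<in> space P \<Longrightarrow> X \<omega> = (\<Sum>i<dim F. Y \<omega> i *\<^sub>R b i)"
    using coordinates_law[OF scalar_product subspace(2) B density(1,3)] by blast
  note b = b0[unfolded finite_dim(2), folded lin_comb_def]
  define r where "r c = \<rho> (lin_comb n b c)" for c
  obtain C where C: "\<And>c. \<rho> (lin_comb n b c) \<le> C * (1 + coeff_size n c) powr (- \<alpha>)"
    using coefficient_decay[OF b(1,3) density(2) b(4) _ decay(2)] decay(1) by force
  interpret smooth_random_sections A g n b r C \<alpha>
  proof
    \<comment> \<open>A basis vector is itself a combination of the basis, hence an element of
      \<open>F\<close>.\<close>
    show "b i \<in> smooth_maps A" if i: "i < n" for i
    proof -
      have "lin_comb n b (\<lambda>j. if j = i then 1 else 0) = (\<Sum>j<n. if j = i then b i else 0)"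
        unfolding lin_comb_def by (rule sum.cong) auto
      then have "lin_comb n b (\<lambda>j. if j = i then 1 else 0) = b i" using i by simp
      then show ?thesis using b(1) subspace(1) by (metis subsetD)
    qed
    show "\<exists>z. lin_comb n b z p = x" for p x
    proof -
      have "x \<in> (\<lambda>\<phi>. \<phi> p) ` F" by (simp add: evaluation)
      then obtain \<phi> where "\<phi> \<in> F" "x = \<phi> p" by blast
      then show ?thesis using b(2) by blast
    qed
    show "0 < r c" if "\<And>i. i < n \<Longrightarrow> c i = 0" for c
    proof -
      have "lin_comb n b c = 0" unfolding lin_comb_def using that by (intro sum.neutral) auto
      then show ?thesis using density(4) by (simp add: r_def)
    qed
  qed (use manifold b(1,4) density(2) C decay(1) in \<open>auto simp: r_def\<close>)
  show ?thesis
    by (rule random_section_z_KROK[OF probability]) (use b(5,6) in \<open>simp_all add: r_def\<close>)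
qed

end
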